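(* Let $(\mathbf{F},\mathbf{C})$ be a decorated contracted forest with root set $\{\rho,\bar\rho\}$ such that no contracting edge is incident to $\rho$ or $\bar\rho$. Suppose: (a) for every non-Dirac vertex $v\in V^*$, $z_v:=-\max\{a_e/4:e\in\mathfrak{C}(V_{F_v})\cap\mathfrak{C}(V\setminus V_{F_v})\}-|k_{\hat v,v}|/2+\gamma_{\hat v,v}>-1$; (b) for every $v\in I^*$, $\Lambda(F_v)+\min\{a_e/4:e\in\mathfrak{C}(V_{F_v})\cap\mathfrak{C}(V\setminus V_{F_v})\}>-1$; (c) $a_e\in(0,n)$ for all $e\in\mathfrak{C}$. Then for any $0\le\theta\le\max\{a_e:e\in\mathfrak{C}(L_{F_\rho})\cap\mathfrak{C}(L_{F_{\bar\rho}})\}$, $$\mathcal{I}^{\mathbf{F},\mathbf{C}}(t,\bar t,x-\bar x)\lesssim t^{\Lambda(F_\rho)+\theta/4}\,\bar t^{\Lambda(F_{\bar\rho})+\theta/4}|x-\bar x|^{-\theta}.$$ Suppose further that $U\subset W\subset C_\rho\cup C_{\bar\rho}$ with $|U\cap C_\rho|\le1$, $|U\cap C_{\bar\rho}|\le1$, and $0<s\le t\le2s$. Let $\kappa,\bar\kappa\in[0,1]$ be such that $\kappa<1+z_\ell$ if $U\cap C_\rho=\{\ell\}$ with $\ell$ non-Dirac, and $\bar\kappa<1+z_{\bar\ell}$ if $U\cap C_{\bar\rho}=\{\bar\ell\}$ with $\bar\ell$ non-Dirac, and set $\zeta=\kappa\mathbf{1}_{|U\cap C_\rho|=1}+\bar\kappa\mathbf{1}_{|U\cap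 C_{\bar\rho}|=1}$. Then $$\mathcal{K}^{\mathbf{F},\mathbf{C}}_{W;U}(t,x-\bar x;s)\lesssim|t-s|^{\zeta}t^{\Lambda(F_\rho)+\Lambda(F_{\bar\rho})+\theta/2-\zeta}|x-\bar x|^{-\theta}.$$
   Context: Forest: $\mathfrak{F}$ consists of two finite rooted trees with roots $\rho,\bar\rho$; $V,E$ its vertices/edges. A leaf is a non-root vertex of degree 1 or a root of degree 0; $L$ the leaves, $I=V\setminus L$, $V^*=V\setminus\{\rho,\bar\rho\}$, $L^*=L\setminus\{\rho,\bar\rho\}$, $I^*=I\setminus\{\rho,\bar\rho\}$. Every $v\in V^*$ has a parent $\hat v$ (its neighbour on the path to the root); $C_u$ is the set of children of $u$. For $v\in V$, the branch $F_v$ is the subtree consisting of $v$ and all its descendants, with root $v$; $V_{F_v},L_{F_v},E_{F_v}$ its vertices, leaves, edges. A contraction $\mathfrak{C}$ is a set of unordered pairs $\{u,v\}$ of distinct leaves such that each leaf lies in at most one pair ("contracting edges"); for $O\subset V$, $\mathfrak{C}(O)$ is the set of $e\in\mathfrak{C}$ incident to some element of $O$. Conventions: $\max\emptyset=\min\emptyset=0$. Decoration: reals $\beta_v$ ($v\in V$) with $\beta_v\ge-1$ for $v\in L^*$; for each edge $e$ a real $\gamma_e$ and multi-index $k_e\in\mathbb{N}_0^n$; for each $e\in\mathfrak{C}$ a real $a_e$. A vertex $v\in L^*$ with $\beta_v=-1$ is Dirac; $g_v=\delta_0$ (integration sets $t_v=0$) if $v$ is Dirac, else $g_v(t)=t^{\beta_v}\mathbf{1}_{t>0}$.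 $G_t(x)=\sum_{m\in\mathbb{Z}^n}(4\pi t)^{-n/2}e^{-|x+m|^2/(4t)}$ for $t>0$ is the heat kernel on $\mathbb{T}^n$, $G^{(k)}$ its $k$-th spatial derivative; factors $(r)^{\gamma}G^{(k)}_r$ with $r\le0$ are taken to be $0$. $D=(0,1)\times\mathbb{T}^n$. With $(t_\rho,x_\rho)=(t,x)$, $(t_{\bar\rho},x_{\bar\rho})=(\bar t,\bar x)\in D$: $\mathcal{I}^{\mathbf{F},\mathbf{C}}(t,\bar t,x-\bar x)=\int_{D^{V^*}}\prod_{\{u,v\}\in\mathfrak{C}}|x_u-x_v|^{-a_{u,v}}\prod_{w\in V}g_w(t_w)\prod_{w\in V^*}\big|(t_{\hat w}-t_w)^{\gamma_{\hat w,w}}G^{(k_{\hat w,w})}_{t_{\hat w}-t_w}(x_{\hat w}-x_w)\big|\,dx_wdt_w$. For $\bar t=t$, $s\in(0,1)$ and $U,W$ as in the claim, $\mathcal{K}^{\mathbf{F},\mathbf{C}}_{W;U}(t,x-\bar x;s)=\int_{D^{V^*}}\big|\prod_{w\in V}g_w(t_w)\prod_{\{u,v\}\in\mathfrak{C}}|x_u-x_v|^{-a_{u,v}}\prod_{u\in V^*\setminus W}(t_{\hat u}-t_u)^{\gamma_{\hat u,u}}G^{(k_{\hat u,u})}_{t_{\hat u}-t_u}(x_{\hat u}-x_u)\prod_{v\in W\setminus U}(s-t_v)^{\gamma_{\hat v,v}}G^{(k_{\hat v,v})}_{s-t_v}(x_{\hat v}-x_v)\prod_{w\in U}\{(t-t_w)^{\gamma_{\hat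 w,w}}G^{(k_{\hat w,w})}_{t-t_w}(x_{\hat w}-x_w)-(s-t_w)^{\gamma_{\hat w,w}}G^{(k_{\hat w,w})}_{s-t_w}(x_{\hat w}-x_w)\}\big|\prod_{w\in V^*}dx_wdt_w$. For a branch $\sigma$: $\Lambda(\sigma)=|E_\sigma|+\sum_{e\in E_\sigma}(\gamma_e-|k_e|/2)+\sum_{u\in V_\sigma}\beta_u-\frac14\sum_{\ell\in L_\sigma}b_\ell$, where $b_\ell=a_e$ if $\ell$ is in the contracting edge $e$ and $b_\ell=0$ otherwise. $\lesssim$ means up to a constant independent of $t,\bar t,s\in(0,1)$ and $x\ne\bar x$. *)

theory Defs
  imports "HOL-Analysis.Analysis"
begin

definition Max0 :: "real set \<Rightarrow> real" where
  "Max0 S = (if S = {} then 0 else Max S)"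
definition Min0 :: "real set \<Rightarrow> real" where
  "Min0 S = (if S = {} then 0 else Min S)"

text \<open>A decorated contracted forest. Each non-root vertex v has parent df_par v;
  the edge (parent v, v) is indexed by its child endpoint v, so df_gam v and df_k v are
  the decorations gamma and k of that edge. df_C is the contraction (a set of 2-sets of
  leaves) and df_a the decoration a on contracting edges.\<close>
record ('v, 'n::finite) dforest =
  df_V    :: "'v set"
  df_par  :: "'v \<Rightarrow> 'v"
  df_rho  :: 'v
  df_rhob :: 'v
  df_beta :: "'v \<Rightarrow> real"
  df_gam  :: "'v \<Rightarrow> real"
  df_k    :: "'v \<Rightarrow> nat ^ 'n"
  df_C    :: "'v set set"
  df_a    :: "'v set \<Rightarrow> real"

definition roots :: "('v, 'n::finite) dforest \<Rightarrow> 'v set" where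
  "roots F = {df_rho F, df_rhob F}"

definition Vstar :: "('v, 'n::finite) dforest \<Rightarrow> 'v set" where
  "Vstar F = df_V F - roots F"

definition children :: "('v, 'n::finite) dforest \<Rightarrow> 'v \<Rightarrow> 'v set" where
  "children F u = {v \<in> Vstar F. df_par F v = u}"

text \<open>leaves: non-root vertices of degree 1 (no children) and roots of degree 0
  (no children); i.e. exactly the vertices without children.\<close>
definition leaves :: "('v, 'n::finite) dforest \<Rightarrow> 'v set" where
  "leaves F = {v \<in> df_V F. children F v = {}}"

definition Lstar :: "('v, 'n::finite) dforest \<Rightarrow> 'v set" where
  "Lstar F = leaves F - roots F"

definition Istar :: "('v, 'n::finite) dforest \<Rightarrow> 'v set" where
  "Istar F = (df_V F - leaves F) - roots F"

definition branch :: "('v, 'n::finite) dforest \<Rightarrow> 'v \<Rightarrow> 'v set" where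
  "branch F v = {u \<in> df_V F. \<exists>k. (df_par F ^^ k) u = v \<and> (\<forall>j<k. (df_par F ^^ j) u \<notin> roots F)}"

definition cedges :: "('v, 'n::finite) dforest \<Rightarrow> 'v set \<Rightarrow> 'v set set" where
  "cedges F S = {e \<in> df_C F. e \<inter> S \<noteq> {}}"

definition is_dirac :: "('v, 'n::finite) dforest \<Rightarrow> 'v \<Rightarrow> bool" where
  "is_dirac F v \<longleftrightarrow> v \<in> Lstar F \<and> df_beta F v = -1"

definition wf_dforest :: "('v, 'n::finite) dforest \<Rightarrow> bool" where
  "wf_dforest F \<longleftrightarrow>
     finite (df_V F) \<and> df_rho F \<in> df_V F \<and> df_rhob F \<in> df_V F \<and> df_rho F \<noteq> df_rhob F \<and>
     (\<forall>v \<in> Vstar F. df_par F v \<in> df_V F \<and> (\<exists>k. (df_par F ^^ k) v \<in> roots F)) \<and>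
     (\<forall>e \<in> df_C F. \<exists>u v. e = {u, v} \<and> u \<noteq> v \<and> u \<in> leaves F \<and> v \<in> leaves F) \<and>
     (\<forall>l. \<forall>e \<in> df_C F. \<forall>e' \<in> df_C F. l \<in> e \<and> l \<in> e' \<longrightarrow> e = e') \<and>
     (\<forall>v \<in> Lstar F. df_beta F v \<ge> -1)"

definition kabs :: "nat ^ 'n::finite \<Rightarrow> real" where
  "kabs k = real (\<Sum>i\<in>UNIV. k $ i)"

definition bval :: "('v, 'n::finite) dforest \<Rightarrow> 'v \<Rightarrow> real" where
  "bval F l = (if \<exists>e \<in> df_C F. l \<in> e then df_a F (THE e. e \<in> df_C F \<and> l \<in> e) else 0)"

text \<open>Lambda(F_v); the edges of F_v are indexed by the strict descendants of v\<close>
definition Lambda :: "('v, 'n::finite) dforest \<Rightarrow> 'v \<Rightarrow> real" where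
  "Lambda F v = real (card (branch F v - {v}))
     + (\<Sum>w \<in> branch F v - {v}. df_gam F w - kabs (df_k F w) / 2)
     + (\<Sum>u \<in> branch F v. df_beta F u)
     - (1/4) * (\<Sum>l \<in> branch F v \<inter> leaves F. bval F l)"

definition zval :: "('v, 'n::finite) dforest \<Rightarrow> 'v \<Rightarrow> real" where
  "zval F v = - Max0 {df_a F e / 4 | e. e \<in> cedges F (branch F v) \<inter> cedges F (df_V F - branch F v)}
              - kabs (df_k F v) / 2 + df_gam F v"

definition thmax :: "('v, 'n::finite) dforest \<Rightarrow> real" where
  "thmax F = Max0 {df_a F e | e. e \<in> cedges F (branch F (df_rho F) \<inter> leaves F)
                                  \<inter> cedges F (branch F (df_rhob F) \<inter> leaves F)}"

text \<open>Heat kernel on the torus (points of T^n represented by real^n, functions periodic)\<close>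
definition heat :: "real \<Rightarrow> real ^ 'n \<Rightarrow> real" where
  "heat t x = (\<Sum>\<^sub>\<infinity>m::int ^ 'n. (4 * pi * t) powr (- real CARD('n) / 2)
                 * exp (- (norm (x + (\<chi> i. of_int (m $ i))))\<^sup>2 / (4 * t)))"

definition pdiff :: "'n \<Rightarrow> (real ^ 'n \<Rightarrow> real) \<Rightarrow> real ^ 'n \<Rightarrow> real" where
  "pdiff i f x = deriv (\<lambda>h. f (x + h *\<^sub>R axis i 1)) 0"

definition heatD :: "nat ^ 'n \<Rightarrow> real \<Rightarrow> real ^ 'n \<Rightarrow> real" where
  "heatD k t = foldr pdiff (SOME ks. \<forall>i. count (mset ks) i = k $ i) (heat t)"

definition kfac :: "real \<Rightarrow> nat ^ 'n \<Rightarrow> real \<Rightarrow> real ^ 'n \<Rightarrow> real" where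
  "kfac g k r y = (if r \<le> 0 then 0 else r powr g * heatD k r y)"

definition tnorm :: "real ^ 'n \<Rightarrow> real" where
  "tnorm z = Inf {norm (z + (\<chi> i. of_int (m $ i))) | m :: int ^ 'n. True}"

definition cube :: "(real ^ 'n) set" where
  "cube = {x. \<forall>i. 0 \<le> x $ i \<and> x $ i < 1}"

text \<open>integration measure for one vertex: (0,1) x T^n, or t fixed to 0 if Dirac\<close>
definition vmeas :: "bool \<Rightarrow> (real \<times> (real ^ 'n)) measure" where
  "vmeas d = (if d then distr (restrict_space lborel cube) borel (\<lambda>x. (0, x))
              else restrict_space lborel ({0<..<1} \<times> cube))"

definition gfac :: "('v, 'n::finite) dforest \<Rightarrow> 'v \<Rightarrow> real \<Rightarrow> real" where
  "gfac F w t = (if is_dirac F w then 1 else if t > 0 then t powr df_beta F w else 0)"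

definition cfac :: "('v, 'n::finite) dforest \<Rightarrow> ('v \<Rightarrow> real \<times> (real ^ 'n)) \<Rightarrow> 'v set \<Rightarrow> real" where
  "cfac F X e = (SOME d. \<exists>u v. e = {u, v} \<and> u \<noteq> v \<and>
                    d = tnorm (snd (X u) - snd (X v)) powr (- df_a F e))"

definition vint_measure :: "('v, 'n::finite) dforest \<Rightarrow> ('v \<Rightarrow> real \<times> (real ^ 'n)) measure" where
  "vint_measure F = PiM (Vstar F) (\<lambda>w. vmeas (is_dirac F w))"

definition Iint :: "('v, 'n::finite) dforest \<Rightarrow> real \<Rightarrow> real \<Rightarrow> real ^ 'n \<Rightarrow> real ^ 'n \<Rightarrow> ennreal" where
  "Iint F t tb x xb = (\<integral>\<^sup>+ X. ennreal (let Y = X(df_rho F := (t, x), df_rhob F := (tb, xb)) in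
      \<bar>(\<Prod>e \<in> df_C F. cfac F Y e) * (\<Prod>w \<in> df_V F. gfac F w (fst (Y w)))
       * (\<Prod>w \<in> Vstar F. kfac (df_gam F w) (df_k F w) (fst (Y (df_par F w)) - fst (Y w))
                                                   (snd (Y (df_par F w)) - snd (Y w)))\<bar>)
      \<partial>vint_measure F)"

definition Kint :: "('v, 'n::finite) dforest \<Rightarrow> 'v set \<Rightarrow> 'v set \<Rightarrow> real \<Rightarrow> real ^ 'n \<Rightarrow> real ^ 'n \<Rightarrow> real \<Rightarrow> ennreal" where
  "Kint F W U t x xb s = (\<integral>\<^sup>+ X. ennreal (let Y = X(df_rho F := (t, x), df_rhob F := (t, xb)) in
      \<bar>(\<Prod>w \<in> df_V F. gfac F w (fst (Y w))) * (\<Prod>e \<in> df_C F. cfac F Y e)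
       * (\<Prod>u \<in> Vstar F - W. kfac (df_gam F u) (df_k F u) (fst (Y (df_par F u)) - fst (Y u))
                                                     (snd (Y (df_par F u)) - snd (Y u)))
       * (\<Prod>v \<in> W - U. kfac (df_gam F v) (df_k F v) (s - fst (Y v)) (snd (Y (df_par F v)) - snd (Y v)))
       * (\<Prod>w \<in> U. kfac (df_gam F w) (df_k F w) (t - fst (Y w)) (snd (Y (df_par F w)) - snd (Y w))
                  - kfac (df_gam F w) (df_k F w) (s - fst (Y w)) (snd (Y (df_par F w)) - snd (Y w)))\<bar>)
      \<partial>vint_measure F)"

end

theory Submission
  imports Defs
begin

text \<open>The heat kernel is dominated by a polynomially decaying kernel, and the leaves of the forest
  are then integrated out one by one. Integrating a leaf against \<open>|x\<^sub>u - x\<^sub>v|\<^sup>-\<^sup>a\<close> either moves the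
  singularity to its parent without loss, or, when both ends of a contracting edge are integrated
  out together, removes it at the price of a factor \<open>r\<^sup>-\<^sup>a\<^sup>/\<^sup>4\<close> in the time increment \<open>r\<close> of each of
  the two tree edges. Half of every contracting edge is thus charged to one tree edge on either side
  and every tree edge receives at most one charge, which condition (a) permits. A pair contained in
  a smallest possible branch is removed first. Then a branch separated by some contracting edges keeps exactly one
  of them to the end, and condition (b) makes its time integral converge. The edge between
  the two trees that survives longest yields \<open>|x - x'|\<^sup>-\<^sup>\<theta>\<close>.

  A time difference of kernels at a child of a root is bounded by \<open>|t - s|\<^sup>\<kappa>\<close> times the sum of the
  kernels at times \<open>t\<close> and \<open>s\<close> with \<open>\<gamma>\<close> lowered by \<open>\<kappa>\<close>. Each root therefore carries two comparable
  times, and the kernel of every tree edge is replaced by the sum over the two times of its parent;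
  this covers both integrals at once.\<close>

section \<open>Distances and singular kernels on the torus\<close>

text \<open>Integrating a vertex out leaves a power of its parent's time, and this power is added to
  \<open>\<beta>\<close> of the parent. The exponent \<open>Lam\<close> of every surviving branch is
  thereby unchanged, whatever the order of the steps, so the exponents at the two roots can be read
  off from the initial forest. For a vertex that has become a leaf, \<open>Lam\<close> is
  \<open>\<beta> - b / 4\<close>, and (b) with the single edge still separating it says exactly
  \<open>\<beta> > -1\<close>: its time weight is integrable at 0. The obstacle is that a separating
  edge helps (b). Should the last one vanish too early, (b) would be required without its minimum,
  which is not assumed. The order of removal is thus dictated by the combinatorics; any separating
  edge may have to be charged, hence the maximum in (a), and any may be the last, hence the minimum
  in (b). The quarter comes from lowering the singularity in two equal portions, one per endpoint,
  while space scales like the square root of time.\<close>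

definition cen :: "real ^ 'n \<Rightarrow> real ^ 'n" where
  "cen w = (\<chi> i. w $ i - of_int (round (w $ i)))"

text \<open>Rounding is optimal in each coordinate separately, so a single lattice shift is optimal
  for all of them and the infimum in \<open>tnorm\<close> is attained.\<close>

lemma norm_cen_le: "norm (cen w) \<le> norm (w + (\<chi> i. of_int (m $ i)))"
proof (rule norm_le_componentwise_cart)
  fix i
  have "\<bar>w $ i - of_int (round (w $ i))\<bar> \<le> \<bar>w $ i - of_int (- (m $ i))\<bar>"
    by (rule round_diff_minimal)
  then show "norm (cen w $ i) \<le> norm ((w + (\<chi> i. of_int (m $ i))) $ i)"
    by (simp add: cen_def)
qed

lemma tnorm_eq_norm_cen: "tnorm w = norm (cen w)"
  unfolding tnorm_def
proof (rule cInf_eq_minimum)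
  have "cen w = w + (\<chi> i. of_int ((\<chi> i. - round (w $ i)) $ i))"
    by (simp add: cen_def vec_eq_iff)
  then show "norm (cen w) \<in> {norm (w + (\<chi> i. of_int (m $ i))) |m. True}"
    by (intro CollectI exI[of _ "\<chi> i. - round (w $ i)"]) simp
qed (auto intro: norm_cen_le)

lemma tnorm_nonneg [simp]: "0 \<le> tnorm w"
  by (simp add: tnorm_eq_norm_cen)

lemma tnorm_le_shift: "tnorm w \<le> norm (w + (\<chi> i. of_int (m $ i)))"
  by (simp add: tnorm_eq_norm_cen norm_cen_le)

lemma tnorm_le_norm: "tnorm w \<le> norm w"
  using tnorm_le_shift[of w 0] by (simp add: vec_eq_iff[symmetric] zero_vec_def[symmetric])

lemma tnorm_add_le: "tnorm (a + b) \<le> tnorm a + tnorm b"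
proof -
  let ?m = "(\<chi> i. - round (a $ i) - round (b $ i)) :: int ^ 'a"
  have "tnorm (a + b) \<le> norm (a + b + (\<chi> i. of_int (?m $ i)))"
    by (rule tnorm_le_shift)
  also have "a + b + (\<chi> i. of_int (?m $ i)) = cen a + cen b"
    by (simp add: cen_def vec_eq_iff)
  also have "norm \<dots> \<le> norm (cen a) + norm (cen b)"
    by (rule norm_triangle_ineq)
  finally show ?thesis by (simp add: tnorm_eq_norm_cen)
qed

lemma tnorm_minus: "tnorm (- w) = tnorm w"
proof -
  have "tnorm (- v) \<le> tnorm v" for v :: "real ^ 'a"
  proof -
    have "tnorm (- v) \<le> norm (- v + (\<chi> i. of_int ((\<chi> i. round (v $ i)) $ i)))"
      by (rule tnorm_le_shift)
    also have "- v + (\<chi> i. of_int ((\<chi> i. round (v $ i)) $ i)) = - cen v"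
      by (simp add: cen_def vec_eq_iff)
    finally show ?thesis by (simp add: tnorm_eq_norm_cen)
  qed
  from this[of w] this[of "- w"] show ?thesis by simp
qed

lemma tnorm_commute: "tnorm (a - b) = tnorm (b - a)"
  using tnorm_minus[of "a - b"] by simp

lemma continuous_on_tnorm: "continuous_on UNIV (tnorm :: real ^ 'n \<Rightarrow> real)"
proof (rule continuous_onI, rule exI, intro conjI ballI impI)
  fix x y :: "real ^ 'n" and e :: real
  assume e: "0 < e" and d: "dist y x < e"
  have "tnorm y \<le> tnorm x + tnorm (y - x)" "tnorm x \<le> tnorm y + tnorm (x - y)"
    using tnorm_add_le[of x "y - x"] tnorm_add_le[of y "x - y"] by simp_all
  moreover have "tnorm (y - x) < e" "tnorm (x - y) < e"
    using tnorm_le_norm[of "y - x"] d tnorm_commute[of x y] by (simp_all add: dist_norm)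
  ultimately show "dist (tnorm y) (tnorm x) \<le> e"
    by (simp add: dist_real_def)
qed auto

lemma borel_measurable_tnorm [measurable]: "tnorm \<in> borel_measurable borel"
  by (rule borel_measurable_continuous_onI[OF continuous_on_tnorm])

lemma sets_cube [measurable]: "cube \<in> sets borel"
proof -
  have "cube = (\<Inter>i. {x :: real ^ 'a. 0 \<le> x $ i \<and> x $ i < 1})"
    by (auto simp: cube_def)
  also have "\<dots> \<in> sets borel"
    by (intro sets.countable_INT) auto
  finally show ?thesis .
qed

section \<open>Integration over the fundamental cube and singular weights\<close>

lemma nn_integral_lborel_translate:
  fixes f :: "'a::euclidean_space \<Rightarrow> ennreal"
  assumes [measurable]: "f \<in> borel_measurable borel"
  shows "(\<integral>\<^sup>+ x. f (x + c) \<partial>lborel) = (\<integral>\<^sup>+ x. f x \<partial>lborel)"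
proof -
  have "(\<integral>\<^sup>+ x. f x \<partial>lborel) = (\<integral>\<^sup>+ x. f x \<partial>distr lborel borel ((+) c))"
    by (simp add: lborel_distr_plus)
  also have "\<dots> = (\<integral>\<^sup>+ x. f (x + c) \<partial>lborel)"
    by (subst nn_integral_distr) (simp_all add: add.commute)
  finally show ?thesis by simp
qed

text \<open>While \<open>x\<close> runs through the cube, the rounding of
  \<open>x $ i - z $ i\<close> exceeds that of \<open>- z $ i\<close> by 0 or 1. So only
  \<open>2 ^ CARD('n)\<close> lattice shifts occur, indexed by the set \<open>A\<close> of
  coordinates with the larger value, and each of them contributes at most a translate of the
  integral over the whole space.\<close>

lemma nn_integral_cube_tnorm_le:
  fixes f :: "real \<Rightarrow> ennreal" and z :: "real ^ 'n"
  assumes [measurable]: "f \<in> borel_measurable borel"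
  shows "(\<integral>\<^sup>+ x. f (tnorm (x - z)) * indicator cube x \<partial>lborel)
    \<le> 2 ^ CARD('n) * (\<integral>\<^sup>+ u. f (norm u) \<partial>(lborel :: (real ^ 'n) measure))"
proof -
  define c :: "'n set \<Rightarrow> real ^ 'n"
    where "c A = (\<chi> i. - z $ i - of_int (round (- z $ i)) - (if i \<in> A then 1 else 0))" for A
  have "f (tnorm (x - z)) * indicator cube x \<le> (\<Sum>A\<in>UNIV. f (norm (x + c A)))" for x
  proof (cases "x \<in> cube")
    case True
    define A where "A = {i. round (x $ i - z $ i) \<noteq> round (- z $ i)}"
    have rd: "round (x $ i - z $ i) = round (- z $ i) + (if i \<in> A then 1 else 0)" for i
    proof -
      have "0 \<le> x $ i" "x $ i < 1" using True by (auto simp: cube_def)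
      then have "round (- z $ i) \<le> round (x $ i - z $ i)"
        "round (x $ i - z $ i) \<le> round (- z $ i) + 1"
        unfolding round_def by linarith+
      then show ?thesis by (auto simp: A_def)
    qed
    have "cen (x - z) = x + c A"
      by (simp add: cen_def c_def vec_eq_iff rd)
    then have "f (tnorm (x - z)) = f (norm (x + c A))"
      by (simp add: tnorm_eq_norm_cen)
    also have "\<dots> \<le> (\<Sum>A\<in>UNIV. f (norm (x + c A)))"
      by (rule member_le_sum) auto
    finally show ?thesis using True by simp
  qed simp
  then have "(\<integral>\<^sup>+ x. f (tnorm (x - z)) * indicator cube x \<partial>lborel)
      \<le> (\<integral>\<^sup>+ x. (\<Sum>A\<in>UNIV. f (norm (x + c A))) \<partial>lborel)"
    by (intro nn_integral_mono)
  also have "\<dots> = (\<Sum>A\<in>UNIV. (\<integral>\<^sup>+ x. f (norm (x + c A)) \<partial>lborel))"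
    by (rule nn_integral_sum) auto
  also have "\<dots> = (\<Sum>A\<in>(UNIV :: 'n set set). (\<integral>\<^sup>+ u. f (norm u) \<partial>(lborel :: (real ^ 'n) measure)))"
    by (intro sum.cong refl nn_integral_lborel_translate[where f = "\<lambda>x. f (norm x)"]) auto
  also have "\<dots> = 2 ^ CARD('n) * (\<integral>\<^sup>+ u. f (norm u) \<partial>(lborel :: (real ^ 'n) measure))"
    by (simp add: card_UNIV_set)
  finally show ?thesis .
qed

text \<open>The singular weight \<open>d\<^sup>-\<^sup>a\<close> with value \<open>\<infinity>\<close> at \<open>d = 0\<close>: with the value
  \<open>0 powr (- a) = 0\<close> the smoothing estimates below would fail on the diagonal.\<close>

definition sing :: "real \<Rightarrow> real \<Rightarrow> ennreal" where
  "sing a d = (if a = 0 then 1 else if d = 0 then \<infinity> else ennreal (d powr (- a)))"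

lemma sing_0 [simp]: "sing 0 d = 1"
  by (simp add: sing_def)

lemma borel_measurable_sing [measurable]: "sing a \<in> borel_measurable borel"
  unfolding sing_def[abs_def] by measurable

lemma sing_antimono: "0 \<le> a \<Longrightarrow> 0 \<le> d \<Longrightarrow> d \<le> d' \<Longrightarrow> sing a d' \<le> sing a d"
  by (auto simp: sing_def intro!: ennreal_leI powr_mono2')

lemma sing_mult: "0 \<le> a \<Longrightarrow> 0 \<le> b \<Longrightarrow> sing a d * sing b d = sing (a + b) d"
  by (cases "d = 0") (auto simp: sing_def ennreal_mult[symmetric] powr_add[symmetric] ennreal_top_mult
      ennreal_mult_top add_nonneg_eq_0_iff)

lemma sing_power: "0 \<le> c \<Longrightarrow> sing c d ^ k = sing (real k * c) d"
  by (induction k) (simp_all add: sing_mult algebra_simps)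

lemma prod_mono_ennreal:
  fixes f g :: "'a \<Rightarrow> ennreal"
  shows "(\<And>i. i \<in> A \<Longrightarrow> f i \<le> g i) \<Longrightarrow> prod f A \<le> prod g A"
  by (induction A rule: infinite_finite_induct) (auto intro!: mult_mono)

text \<open>Every coordinate is at most the norm, so the exponent can be shared equally among the
  coordinates. This replaces polar coordinates: integrability of a radial singularity with
  \<open>a < n\<close> reduces to one dimension with exponent \<open>a / n < 1\<close>.\<close>

lemma sing_prod_components:
  fixes u :: "'a::euclidean_space"
  assumes "0 \<le> a"
  shows "sing a (norm u) \<le> (\<Prod>b\<in>Basis. sing (a / DIM('a)) \<bar>u \<bullet> b\<bar>)"
proof -
  have "sing a (norm u) = (\<Prod>b\<in>(Basis::'a set). sing (a / DIM('a)) (norm u))"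
    using assms by (simp add: sing_power)
  also have "\<dots> \<le> (\<Prod>b\<in>Basis. sing (a / DIM('a)) \<bar>u \<bullet> b\<bar>)"
    using assms by (intro prod_mono_ennreal sing_antimono) (auto simp: Basis_le_norm)
  finally show ?thesis .
qed

lemma nn_integral_even_le:
  fixes f :: "real \<Rightarrow> ennreal"
  assumes [measurable]: "f \<in> borel_measurable borel"
  shows "(\<integral>\<^sup>+ t. f \<bar>t\<bar> \<partial>lborel) \<le> 2 * (\<integral>\<^sup>+ t. f t * indicator {0..} t \<partial>lborel)"
proof -
  let ?g = "\<lambda>t. f t * indicator {0..} t"
  have "(\<integral>\<^sup>+ t. f \<bar>t\<bar> \<partial>lborel) \<le> (\<integral>\<^sup>+ t. ?g t + ?g (- t) \<partial>lborel)"
    by (intro nn_integral_mono) (auto simp: indicator_def abs_if)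
  also have "\<dots> = (\<integral>\<^sup>+ t. ?g t \<partial>lborel) + (\<integral>\<^sup>+ t. ?g (- t) \<partial>lborel)"
    by (rule nn_integral_add) measurable
  also have "(\<integral>\<^sup>+ t. ?g (- t) \<partial>lborel) = (\<integral>\<^sup>+ t. ?g t \<partial>lborel)"
    using nn_integral_real_affine[of ?g "-1" 0] by simp
  finally show ?thesis by (simp add: mult_2)
qed

lemma nn_integral_sing_le:
  assumes "0 \<le> c" "c < 1" "0 \<le> R"
  shows "(\<integral>\<^sup>+ t. sing c \<bar>t\<bar> * indicator {..R} \<bar>t\<bar> \<partial>lborel) \<le> ennreal (2 / (1 - c) * R powr (1 - c))"
proof -
  have "(\<integral>\<^sup>+ t. sing c \<bar>t\<bar> * indicator {..R} \<bar>t\<bar> \<partial>lborel)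
      \<le> 2 * (\<integral>\<^sup>+ t. sing c t * indicator {..R} t * indicator {0..} t \<partial>lborel)"
    by (rule nn_integral_even_le[where f = "\<lambda>t. sing c t * indicator {..R} t"]) measurable
  also have "(\<integral>\<^sup>+ t. sing c t * indicator {..R} t * indicator {0..} t \<partial>lborel)
      = (\<integral>\<^sup>+ t. ennreal (indicator {0..R} t * t powr (- c)) \<partial>lborel)"
  proof (rule nn_integral_cong_AE)
    show "AE t in lborel. sing c t * indicator {..R} t * indicator {0..} t
        = ennreal (indicator {0..R} t * t powr (- c))"
      using AE_lborel_singleton[of "0::real"]
      by eventually_elim (auto simp: sing_def indicator_def)
  qed
  also have "\<dots> = ennreal (R powr (- c + 1) / (- c + 1))"
    using nn_integral_has_integral_lebesgue[of "{0..R}" "\<lambda>t. t powr (- c)"]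
      has_integral_powr_from_0[of "- c" R] assms
    by simp
  also have "2 * \<dots> = ennreal (2 / (1 - c) * R powr (1 - c))"
    using assms by (simp add: ennreal_mult'[symmetric] numeral_mult_ennreal algebra_simps)
  finally show ?thesis .
qed

text \<open>The ball is enclosed in a cube, where the integral factorises. Each of the
  \<open>n\<close> factors scales like \<open>R powr (1 - a / n)\<close>, which multiplies up to the
  exponent \<open>n - a\<close>.\<close>

lemma nn_integral_sing_norm_le:
  fixes a :: real
  assumes "0 \<le> a" "a < DIM('a::euclidean_space)"
  shows "\<exists>C>0. \<forall>R>0. (\<integral>\<^sup>+ u. sing a (norm u) * indicator {..R} (norm u) \<partial>(lborel :: 'a measure))
    \<le> ennreal (C * R powr (DIM('a) - a))"
proof (intro exI conjI allI impI)
  define n where "n = DIM('a)"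
  define c where "c = a / n"
  have n: "n > 0" by (simp add: n_def)
  have c: "0 \<le> c" "c < 1" using assms n by (auto simp: c_def n_def)
  show "0 < (2 / (1 - c)) ^ n" using c by simp
  have e: "(1 - c) * real n = DIM('a) - a" using n by (simp add: c_def n_def left_diff_distrib)
  fix R :: real assume R: "R > 0"
  have "(\<integral>\<^sup>+ u. sing a (norm u) * indicator {..R} (norm u) \<partial>(lborel :: 'a measure))
      \<le> (\<integral>\<^sup>+ u. (\<Prod>b\<in>Basis. sing c \<bar>u \<bullet> b\<bar> * indicator {..R} \<bar>u \<bullet> b\<bar>) \<partial>(lborel :: 'a measure))"
  proof (rule nn_integral_mono)
    fix u :: 'a
    show "sing a (norm u) * indicator {..R} (norm u) \<le> (\<Prod>b\<in>Basis. sing c \<bar>u \<bullet> b\<bar> * indicator {..R} \<bar>u \<bullet> b\<bar>)"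
    proof (cases "norm u \<le> R")
      case True
      then have "\<bar>u \<bullet> b\<bar> \<le> R" if "b \<in> Basis" for b
        using Basis_le_norm[OF that, of u] by simp
      then have "(\<Prod>b\<in>Basis. sing c \<bar>u \<bullet> b\<bar> * indicator {..R} \<bar>u \<bullet> b\<bar>) = (\<Prod>b\<in>Basis. sing c \<bar>u \<bullet> b\<bar>)"
        by (intro prod.cong) auto
      then show ?thesis using True sing_prod_components[of a u] assms by (simp add: c_def n_def)
    qed simp
  qed
  also have "\<dots> = (\<Prod>b\<in>(Basis::'a set). (\<integral>\<^sup>+ t. sing c \<bar>t\<bar> * indicator {..R} \<bar>t\<bar> \<partial>lborel))"
    by (rule nn_integral_lborel_prod[where f = "\<lambda>b t. sing c \<bar>t\<bar> * indicator {..R} \<bar>t\<bar>"]) auto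
  also have "\<dots> \<le> (\<Prod>b\<in>(Basis::'a set). ennreal (2 / (1 - c) * R powr (1 - c)))"
    using c R by (intro prod_mono_ennreal nn_integral_sing_le) auto
  also have "\<dots> = ennreal ((2 / (1 - c) * R powr (1 - c)) ^ n)"
    using c by (simp add: n_def ennreal_power)
  also have "(2 / (1 - c) * R powr (1 - c)) ^ n = (2 / (1 - c)) ^ n * R powr (DIM('a) - a)"
    using R n by (simp add: power_mult_distrib powr_power e[symmetric] mult.commute power_divide)
  finally show "(\<integral>\<^sup>+ u. sing a (norm u) * indicator {..R} (norm u) \<partial>(lborel :: 'a measure))
      \<le> ennreal ((2 / (1 - c)) ^ n * R powr (DIM('a) - a))" .
qed

text \<open>A polynomially decaying substitute for the heat kernel in dimension \<open>N\<close>; unlike the heat kernel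
  it changes only by a constant factor when the time is doubled.\<close>

definition pk :: "nat \<Rightarrow> real \<Rightarrow> real \<Rightarrow> real" where
  "pk N r d = r powr (- real N / 2) * (1 + d / sqrt r) powr (- 2 * real N)"

lemma pk_nonneg [simp]: "0 \<le> pk N r d"
  by (simp add: pk_def)

lemma borel_measurable_pk [measurable (raw)]:
  "f \<in> borel_measurable M \<Longrightarrow> g \<in> borel_measurable M \<Longrightarrow> (\<lambda>x. pk N (f x) (g x)) \<in> borel_measurable M"
  unfolding pk_def by (intro borel_measurable_times powr_real_measurable borel_measurable_add
    borel_measurable_divide borel_measurable_const measurable_compose[OF _ borel_measurable_sqrt]) auto

lemma pk_le_time: "0 < r \<Longrightarrow> 0 \<le> d \<Longrightarrow> pk N r d \<le> sqrt r powr (- real N)"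
proof -
  assume r: "0 < r" and d: "0 \<le> d"
  have "(1 + d / sqrt r) powr (- 2 * real N) \<le> 1 powr (- 2 * real N)"
    using r d by (intro powr_mono2') auto
  moreover have "r powr (- real N / 2) = sqrt r powr (- real N)"
    using r by (simp add: powr_half_sqrt[symmetric] powr_powr)
  ultimately show ?thesis using mult_left_mono[of _ 1 "r powr (- real N / 2)"]
    by (simp add: pk_def)
qed

text \<open>Half of the decay of order \<open>2 * N\<close> is given away; the other
  \<open>N\<close> powers of \<open>d / sqrt r\<close> cancel the factor
  \<open>r powr (- N / 2)\<close> and leave a bound free of the time.\<close>

lemma pk_le_space: "0 < r \<Longrightarrow> 0 < d \<Longrightarrow> d \<le> d' \<Longrightarrow> pk N r d' \<le> d powr (- real N)"
proof -
  assume r: "0 < r" and d: "0 < d" "d \<le> d'"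
  have "(1 + d' / sqrt r) powr (- 2 * real N) \<le> (1 + d' / sqrt r) powr (- real N)"
    using r d by (intro powr_mono) auto
  also have "\<dots> \<le> (d / sqrt r) powr (- real N)"
    using r d by (intro powr_mono2') (auto simp: add_increasing divide_right_mono)
  also have "\<dots> = d powr (- real N) * sqrt r powr (real N)"
    using r d by (simp add: powr_divide powr_minus field_simps)
  finally have "pk N r d' \<le> r powr (- real N / 2) * (d powr (- real N) * sqrt r powr (real N))"
    by (simp add: pk_def mult_left_mono)
  also have "r powr (- real N / 2) * (d powr (- real N) * sqrt r powr (real N)) = d powr (- real N)"
    using r by (simp add: powr_half_sqrt[symmetric] powr_powr powr_add[symmetric])
  finally show ?thesis .
qed

lemma nn_integral_inverse_square: "(\<integral>\<^sup>+ s. ennreal ((1 + \<bar>s\<bar>) powr (- 2)) \<partial>lborel) \<le> 2"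
proof -
  have "(\<integral>\<^sup>+ s. ennreal ((1 + \<bar>s\<bar>) powr (- 2)) \<partial>lborel)
      \<le> 2 * (\<integral>\<^sup>+ s. ennreal ((1 + s) powr (- 2)) * indicator {0..} s \<partial>lborel)"
    by (rule nn_integral_even_le[where f = "\<lambda>s. ennreal ((1 + s) powr (- 2))"]) measurable
  also have "(\<integral>\<^sup>+ s. ennreal ((1 + s) powr (- 2)) * indicator {0..} s \<partial>lborel)
      = ennreal (0 - (- (1 / (1 + 0))))"
  proof (rule nn_integral_FTC_atLeast)
    fix s :: real assume s: "0 \<le> s"
    have "((\<lambda>s. - (1 / (1 + s))) has_real_derivative 1 / (1 + s) ^ 2) (at s)"
      using s by (auto intro!: derivative_eq_intros simp: power2_eq_square)
    also have "1 / (1 + s) ^ 2 = (1 + s) powr (- 2)"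
      using s by (simp add: powr_minus powr_numeral divide_inverse)
    finally show "((\<lambda>s. - (1 / (1 + s))) has_real_derivative (1 + s) powr (- 2)) (at s)" .
  next
    have "((\<lambda>s::real. 1 / (1 + s)) \<longlongrightarrow> 0) at_top"
      by (rule real_tendsto_divide_at_top[OF tendsto_const])
        (auto intro: filterlim_tendsto_add_at_top filterlim_ident)
    then show "((\<lambda>s::real. - (1 / (1 + s))) \<longlongrightarrow> 0) at_top"
      using tendsto_minus by fastforce
  qed auto
  finally show ?thesis by simp
qed

text \<open>The decay order \<open>2 * N\<close> in \<open>pk\<close> is made for this: shared among
  \<open>N\<close> coordinates it leaves order 2 for each, which is integrable on the line. Scaling
  by \<open>sqrt r\<close> then removes the time.\<close>

lemma nn_integral_pk_norm_le:
  assumes "0 < r"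
  shows "(\<integral>\<^sup>+ u. ennreal (pk DIM('a) r (norm u)) \<partial>(lborel :: 'a::euclidean_space measure)) \<le> 2 ^ DIM('a)"
proof -
  define n where "n = DIM('a)"
  define f where "f t = r powr (- 1 / 2) * (1 + \<bar>t\<bar> / sqrt r) powr (- 2)" for t :: real
  have [measurable]: "f \<in> borel_measurable borel" unfolding f_def by measurable
  have "ennreal (pk n r (norm u)) \<le> (\<Prod>b\<in>Basis. ennreal (f (u \<bullet> b)))" for u :: 'a
  proof -
    have "pk n r (norm u) = (\<Prod>b\<in>(Basis::'a set). r powr (- 1 / 2) * (1 + norm u / sqrt r) powr (- 2))"
    proof -
      have "(r powr (- 1 / 2)) ^ n = r powr (- real n / 2)"
        using assms by (simp add: powr_power)
      moreover have "((1 + norm u / sqrt r) powr (- 2)) ^ n = (1 + norm u / sqrt r) powr (- 2 * real n)"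
        using add_pos_nonneg[of 1 "norm u / sqrt r"] assms
        by (subst powr_power) (simp_all add: n_def mult.commute)
      ultimately show ?thesis by (simp add: pk_def n_def[symmetric] power_mult_distrib)
    qed
    also have "\<dots> \<le> (\<Prod>b\<in>Basis. f (u \<bullet> b))"
      unfolding f_def using assms
      by (intro prod_mono conjI mult_left_mono powr_mono2') (auto intro!: divide_right_mono simp: Basis_le_norm add_pos_nonneg)
    finally show ?thesis
      by (simp add: prod_ennreal f_def ennreal_leI)
  qed
  then have "(\<integral>\<^sup>+ u. ennreal (pk n r (norm u)) \<partial>(lborel :: 'a measure))
      \<le> (\<integral>\<^sup>+ u. (\<Prod>b\<in>Basis. ennreal (f (u \<bullet> b))) \<partial>(lborel :: 'a measure))"
    by (intro nn_integral_mono)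
  also have "\<dots> = (\<Prod>b\<in>(Basis::'a set). (\<integral>\<^sup>+ t. ennreal (f t) \<partial>lborel))"
    by (rule nn_integral_lborel_prod[where f = "\<lambda>b t. ennreal (f t)"]) auto
  also have "(\<integral>\<^sup>+ t. ennreal (f t) \<partial>lborel) = ennreal (sqrt r) * (\<integral>\<^sup>+ s. ennreal (f (sqrt r * s)) \<partial>lborel)"
    using nn_integral_real_affine[of "\<lambda>t. ennreal (f t)" "sqrt r" 0] assms by simp
  also have "(\<integral>\<^sup>+ s. ennreal (f (sqrt r * s)) \<partial>lborel)
      = (\<integral>\<^sup>+ s. ennreal (r powr (- 1 / 2)) * ennreal ((1 + \<bar>s\<bar>) powr (- 2)) \<partial>lborel)"
    using assms by (intro nn_integral_cong) (simp add: f_def abs_mult ennreal_mult')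
  also have "\<dots> = ennreal (r powr (- 1 / 2)) * (\<integral>\<^sup>+ s. ennreal ((1 + \<bar>s\<bar>) powr (- 2)) \<partial>lborel)"
    by (rule nn_integral_cmult) measurable
  also have "ennreal (sqrt r) * \<dots> = (\<integral>\<^sup>+ s. ennreal ((1 + \<bar>s\<bar>) powr (- 2)) \<partial>lborel)"
    using assms by (simp add: mult.assoc[symmetric] ennreal_mult'[symmetric] powr_half_sqrt[symmetric] powr_add[symmetric])
  also have "(\<Prod>b\<in>(Basis::'a set). \<dots>) \<le> (\<Prod>b\<in>(Basis::'a set). 2)"
    by (intro prod_mono_ennreal nn_integral_inverse_square)
  finally show ?thesis by (simp add: n_def)
qed

text \<open>The integral is split at distance \<open>R\<close> from \<open>z\<close>. Inside, the
  kernel is at most \<open>R powr (- n)\<close> and the weight has integral of order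
  \<open>R powr (n - a)\<close>; outside, the weight is at most \<open>R powr (- a)\<close> and the
  kernel has bounded mass. The radius stays free, and the premise records what its choice has to
  guarantee.\<close>

lemma nn_integral_cube_pk_sing_le_aux:
  fixes a :: real
  assumes "0 \<le> a" "a < CARD('n::finite)"
  shows "\<exists>C>0. \<forall>r R y z. 0 < r \<longrightarrow> 0 < R \<longrightarrow>
      (\<forall>x. tnorm (x - z) \<le> R \<longrightarrow> pk CARD('n) r (tnorm (y - x)) \<le> R powr (- real CARD('n))) \<longrightarrow>
     (\<integral>\<^sup>+ x. ennreal (pk CARD('n) r (tnorm (y - x))) * sing a (tnorm (x - z)) * indicator cube x \<partial>(lborel :: (real ^ 'n) measure))
      \<le> ennreal (C * R powr (- a))"
proof -
  let ?n = "CARD('n)"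
  obtain C where C: "C > 0" "\<And>R. R > 0 \<Longrightarrow>
      (\<integral>\<^sup>+ u. sing a (norm u) * indicator {..R} (norm u) \<partial>(lborel :: (real ^ 'n) measure)) \<le> ennreal (C * R powr (?n - a))"
    using nn_integral_sing_norm_le[where 'a = "real ^ 'n", of a] assms by auto
  show ?thesis
  proof (intro exI conjI allI impI)
    \<comment> \<open>\<open>4 ^ n\<close> is the product of \<open>2 ^ n\<close> lattice shifts and
      the bound \<open>2 ^ n\<close> for the mass of \<open>pk\<close>; the second summand belongs
      to the ball around \<open>z\<close>.\<close>
    show "0 < 4 ^ ?n + 2 ^ ?n * C" using C by (simp add: add_pos_pos)
    fix r R :: real and y z :: "real ^ 'n"
    assume r: "0 < r" and R: "0 < R"
      and le: "\<forall>x. tnorm (x - z) \<le> R \<longrightarrow> pk ?n r (tnorm (y - x)) \<le> R powr (- real ?n)"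
    have 1: "(\<integral>\<^sup>+ x. ennreal (pk ?n r (tnorm (x - y))) * indicator cube x \<partial>lborel) \<le> 4 ^ ?n"
    proof -
      have "(\<integral>\<^sup>+ x. ennreal (pk ?n r (tnorm (x - y))) * indicator cube x \<partial>lborel)
        \<le> 2 ^ ?n * (\<integral>\<^sup>+ u. ennreal (pk ?n r (norm u)) \<partial>(lborel :: (real ^ 'n) measure))"
        by (rule nn_integral_cube_tnorm_le) measurable
      also have "\<dots> \<le> 2 ^ ?n * 2 ^ ?n"
        using nn_integral_pk_norm_le[where 'a = "real ^ 'n", OF r] by (intro mult_left_mono) auto
      also have "\<dots> = 4 ^ ?n" by (simp add: power_mult_distrib[symmetric])
      finally show ?thesis .
    qed
    have 2: "(\<integral>\<^sup>+ x. sing a (tnorm (x - z)) * indicator {..R} (tnorm (x - z)) * indicator cube x \<partial>lborel)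
        \<le> ennreal (2 ^ ?n * (C * R powr (?n - a)))"
    proof -
      have "(\<integral>\<^sup>+ x. sing a (tnorm (x - z)) * indicator {..R} (tnorm (x - z)) * indicator cube x \<partial>lborel)
        \<le> 2 ^ ?n * (\<integral>\<^sup>+ u. sing a (norm u) * indicator {..R} (norm u) \<partial>(lborel :: (real ^ 'n) measure))"
        by (rule nn_integral_cube_tnorm_le[where f = "\<lambda>d. sing a d * indicator {..R} d"]) measurable
      also have "\<dots> \<le> 2 ^ ?n * ennreal (C * R powr (?n - a))"
        using C(2)[OF R] by (intro mult_left_mono) auto
      also have "\<dots> = ennreal (2 ^ ?n * (C * R powr (?n - a)))"
        by (simp add: ennreal_mult' ennreal_power[symmetric])
      finally show ?thesis .
    qed
    have "ennreal (pk ?n r (tnorm (y - x))) * sing a (tnorm (x - z)) * indicator cube x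
       \<le> ennreal (R powr (- a)) * (ennreal (pk ?n r (tnorm (x - y))) * indicator cube x)
         + ennreal (R powr (- real ?n)) * (sing a (tnorm (x - z)) * indicator {..R} (tnorm (x - z)) * indicator cube x)" for x
    proof (cases "tnorm (x - z) \<le> R")
      case True
      have "ennreal (pk ?n r (tnorm (y - x))) * sing a (tnorm (x - z)) * indicator cube x
         \<le> ennreal (R powr (- real ?n)) * sing a (tnorm (x - z)) * indicator cube x"
        using le True by (intro mult_right_mono ennreal_leI) auto
      also have "\<dots> = ennreal (R powr (- real ?n)) * (sing a (tnorm (x - z)) * indicator {..R} (tnorm (x - z)) * indicator cube x)"
        using True by (simp add: mult_ac)
      finally show ?thesis by (rule order_trans) simp
    next
      case False
      have "sing a (tnorm (x - z)) \<le> sing a R"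
        using False assms R by (intro sing_antimono) auto
      also have "\<dots> \<le> ennreal (R powr (- a))" using R by (simp add: sing_def)
      finally have "ennreal (pk ?n r (tnorm (y - x))) * sing a (tnorm (x - z)) * indicator cube x
         \<le> ennreal (pk ?n r (tnorm (y - x))) * ennreal (R powr (- a)) * indicator cube x"
        by (intro mult_right_mono mult_left_mono) auto
      also have "\<dots> = ennreal (R powr (- a)) * (ennreal (pk ?n r (tnorm (x - y))) * indicator cube x)"
        by (simp add: tnorm_commute[of x y] mult_ac)
      finally show ?thesis by (rule order_trans) simp
    qed
    then have "(\<integral>\<^sup>+ x. ennreal (pk ?n r (tnorm (y - x))) * sing a (tnorm (x - z)) * indicator cube x \<partial>lborel)
      \<le> (\<integral>\<^sup>+ x. ennreal (R powr (- a)) * (ennreal (pk ?n r (tnorm (x - y))) * indicator cube x)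
         + ennreal (R powr (- real ?n)) * (sing a (tnorm (x - z)) * indicator {..R} (tnorm (x - z)) * indicator cube x) \<partial>lborel)"
      by (intro nn_integral_mono)
    also have "\<dots> = ennreal (R powr (- a)) * (\<integral>\<^sup>+ x. ennreal (pk ?n r (tnorm (x - y))) * indicator cube x \<partial>lborel)
        + ennreal (R powr (- real ?n)) * (\<integral>\<^sup>+ x. sing a (tnorm (x - z)) * indicator {..R} (tnorm (x - z)) * indicator cube x \<partial>lborel)"
      by (simp add: nn_integral_add nn_integral_cmult)
    also have "\<dots> \<le> ennreal (R powr (- a)) * 4 ^ ?n + ennreal (R powr (- real ?n)) * ennreal (2 ^ ?n * (C * R powr (?n - a)))"
      by (intro add_mono mult_left_mono 1 2) auto
    also have "\<dots> = ennreal (R powr (- a) * 4 ^ ?n + R powr (- real ?n) * (2 ^ ?n * (C * R powr (?n - a))))"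
      using C by (simp add: ennreal_mult' ennreal_power[symmetric])
    also have "R powr (- a) * 4 ^ ?n + R powr (- real ?n) * (2 ^ ?n * (C * R powr (?n - a))) = (4 ^ ?n + 2 ^ ?n * C) * R powr (- a)"
      using R by (simp add: powr_diff powr_minus field_simps)
    finally show "(\<integral>\<^sup>+ x. ennreal (pk ?n r (tnorm (y - x))) * sing a (tnorm (x - z)) * indicator cube x \<partial>lborel)
      \<le> ennreal ((4 ^ ?n + 2 ^ ?n * C) * R powr (- a))" .
  qed
qed

text \<open>The result \<open>R powr (- a)\<close> is divided between the two lower bounds
  \<open>sqrt r\<close> and \<open>d / 2\<close> of the radius, with exponents
  \<open>a - \<theta>\<close> and \<open>\<theta>\<close>. The case \<open>\<theta> = a\<close>
  moves the singularity from \<open>x\<close> to \<open>y\<close> for free,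
  \<open>\<theta> = 0\<close> turns it entirely into a power of time.\<close>

lemma nn_integral_cube_pk_sing_le:
  fixes a \<theta> :: real
  assumes "0 \<le> \<theta>" "\<theta> \<le> a" "a < CARD('n::finite)"
  shows "\<exists>C>0. \<forall>r y z. 0 < r \<longrightarrow>
     (\<integral>\<^sup>+ x. ennreal (pk CARD('n) r (tnorm (y - x))) * sing a (tnorm (x - z)) * indicator cube x \<partial>(lborel :: (real ^ 'n) measure))
      \<le> ennreal (C * r powr (- (a - \<theta>) / 2)) * sing \<theta> (tnorm (y - z))"
proof -
  let ?n = "CARD('n)"
  have a: "0 \<le> a" using assms by simp
  obtain C where C: "C > 0" and le: "\<And>r R y z. 0 < r \<Longrightarrow> 0 < R \<Longrightarrow>
      (\<forall>x. tnorm (x - z) \<le> R \<longrightarrow> pk ?n r (tnorm (y - x)) \<le> R powr (- real ?n)) \<Longrightarrow>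
     (\<integral>\<^sup>+ x. ennreal (pk ?n r (tnorm (y - x))) * sing a (tnorm (x - z)) * indicator cube x \<partial>(lborel :: (real ^ 'n) measure))
      \<le> ennreal (C * R powr (- a))"
    using nn_integral_cube_pk_sing_le_aux[OF a assms(3)] by auto
  show ?thesis
  proof (intro exI conjI allI impI)
    show "0 < C * 2 powr \<theta>" using C by simp
    fix r :: real and y z :: "real ^ 'n"
    assume r: "0 < r"
    define d where "d = tnorm (y - z)"
    \<comment> \<open>If \<open>sqrt r\<close> is the larger one, the kernel is at most
      \<open>R powr (- n)\<close> everywhere. Otherwise \<open>R\<close> is half the distance of
      \<open>y\<close> and \<open>z\<close>, and a point within \<open>R\<close> of \<open>z\<close>
      is at least \<open>R\<close> away from \<open>y\<close>.\<close>
    define R where "R = max (sqrt r) (d / 2)"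
    have R: "0 < R" "sqrt r \<le> R" "d / 2 \<le> R" using r by (auto simp: R_def less_max_iff_disj)
    have d: "0 \<le> d" by (simp add: d_def)
    have "(\<integral>\<^sup>+ x. ennreal (pk ?n r (tnorm (y - x))) * sing a (tnorm (x - z)) * indicator cube x \<partial>(lborel :: (real ^ 'n) measure))
      \<le> ennreal (C * R powr (- a))"
    proof (rule le[OF r R(1)], intro allI impI)
      fix x assume x: "tnorm (x - z) \<le> R"
      show "pk ?n r (tnorm (y - x)) \<le> R powr (- real ?n)"
      proof (cases "sqrt r \<le> d / 2")
        case True
        then have Rd: "R = d / 2" by (simp add: R_def)
        have "d \<le> tnorm (y - x) + tnorm (x - z)"
          using tnorm_add_le[of "y - x" "x - z"] by (simp add: d_def)
        then have "R \<le> tnorm (y - x)" using x Rd by simp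
        then show ?thesis using r R by (intro pk_le_space)
      next
        case False
        then have "R = sqrt r" by (simp add: R_def)
        then show ?thesis using r by (simp add: pk_le_time)
      qed
    qed
    also have "\<dots> \<le> ennreal (C * 2 powr \<theta> * r powr (- (a - \<theta>) / 2)) * sing \<theta> d"
    proof (cases "\<theta> \<noteq> 0 \<and> d = 0")
      \<comment> \<open>On the diagonal with a positive exponent the right-hand side is
        infinite.\<close>
      case True
      then show ?thesis using r C by (simp add: sing_def ennreal_mult_top)
    next
      case False
      have "R powr (- (a - \<theta>)) \<le> sqrt r powr (- (a - \<theta>))"
        using r R assms by (intro powr_mono2') auto
      also have "\<dots> = r powr (- (a - \<theta>) / 2)"
        using r by (simp add: powr_half_sqrt[symmetric] powr_powr)
      finally have 1: "R powr (- (a - \<theta>)) \<le> r powr (- (a - \<theta>) / 2)" .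
      have 2: "ennreal (R powr (- \<theta>)) \<le> ennreal (2 powr \<theta>) * sing \<theta> d"
      proof (cases "\<theta> = 0")
        case th: False
        then have "d > 0" using False d by simp
        then have "R powr (- \<theta>) \<le> (d / 2) powr (- \<theta>)"
          using R assms by (intro powr_mono2') auto
        also have "\<dots> = 2 powr \<theta> * d powr (- \<theta>)"
          using \<open>d > 0\<close> by (simp add: powr_divide powr_minus field_simps)
        finally show ?thesis using \<open>d > 0\<close> th by (simp add: sing_def ennreal_mult'[symmetric] ennreal_leI)
      qed (use R in simp)
      have "ennreal (C * R powr (- a)) = ennreal (C * R powr (- (a - \<theta>))) * ennreal (R powr (- \<theta>))"
        using C by (simp add: ennreal_mult'[symmetric] powr_add[symmetric] mult.assoc)
      also have "\<dots> \<le> ennreal (C * r powr (- (a - \<theta>) / 2)) * (ennreal (2 powr \<theta>) * sing \<theta> d)"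
        using C by (intro mult_mono 2 ennreal_leI mult_left_mono 1) auto
      also have "\<dots> = ennreal (C * 2 powr \<theta> * r powr (- (a - \<theta>) / 2)) * sing \<theta> d"
        using C by (simp add: ennreal_mult' mult_ac)
      finally show ?thesis .
    qed
    finally show "(\<integral>\<^sup>+ x. ennreal (pk ?n r (tnorm (y - x))) * sing a (tnorm (x - z)) * indicator cube x \<partial>(lborel :: (real ^ 'n) measure))
      \<le> ennreal (C * 2 powr \<theta> * r powr (- (a - \<theta>) / 2)) * sing \<theta> (tnorm (y - z))"
      by (simp add: d_def)
  qed
qed

section \<open>Integrating out one vertex\<close>

lemma borel_measurable_powr_const [measurable (raw)]:
  fixes f :: "'a \<Rightarrow> real"
  assumes "f \<in> borel_measurable M"
  shows "(\<lambda>x. f x powr c) \<in> borel_measurable M"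
  using assms by (intro powr_real_measurable) auto

text \<open>The substitution \<open>t = \<tau> * s\<close> turns this into a Beta integral. Its two
  conditions are what the hypotheses of the theorem are for: (a) yields the one on the kernel
  exponent \<open>c\<close>, (b) the one on the weight \<open>\<beta>\<close> of a vertex whose
  descendants have been integrated out.\<close>

lemma nn_integral_Beta_le:
  fixes \<beta> c :: real
  assumes "\<beta> > -1" "c > -1"
  shows "\<exists>C>0. \<forall>\<tau>>0. (\<integral>\<^sup>+ t. ennreal (t powr \<beta>) * ennreal ((\<tau> - t) powr c) * indicator {0<..<\<tau>} t \<partial>lborel)
    \<le> ennreal (C * \<tau> powr (\<beta> + c + 1))"
proof (intro exI conjI allI impI)
  have pos: "\<beta> + 1 > 0" "c + 1 > 0" using assms by simp_all
  show "0 < Beta (\<beta> + 1) (c + 1)"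
    using pos by (simp add: Beta_def add_pos_pos)
  fix \<tau> :: real assume tau: "\<tau> > 0"
  have m: "(\<lambda>s. ennreal (indicator {0..1} s * (s powr \<beta> * (1 - s) powr c))) \<in> borel_measurable lborel"
    by (intro measurable_compose[OF _ measurable_ennreal] borel_measurable_times borel_measurable_powr_const
        borel_measurable_indicator borel_measurable_diff borel_measurable_const) auto
  let ?f = "\<lambda>t. ennreal (t powr \<beta>) * ennreal ((\<tau> - t) powr c) * indicator {0<..<\<tau>} t"
  have 1: "(\<integral>\<^sup>+ t. ?f t \<partial>lborel) = ennreal \<tau> * (\<integral>\<^sup>+ s. ?f (\<tau> * s) \<partial>lborel)"
    using nn_integral_real_affine[of ?f \<tau> 0] tau by simp
  have "(\<integral>\<^sup>+ s. ?f (\<tau> * s) \<partial>lborel)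
      \<le> (\<integral>\<^sup>+ s. ennreal (\<tau> powr (\<beta> + c)) * ennreal (indicator {0..1} s * (s powr \<beta> * (1 - s) powr c)) \<partial>lborel)"
  proof (rule nn_integral_mono)
    fix s :: real
    show "?f (\<tau> * s) \<le> ennreal (\<tau> powr (\<beta> + c)) * ennreal (indicator {0..1} s * (s powr \<beta> * (1 - s) powr c))"
    proof (cases "0 < s \<and> s < 1")
      case True
      then have "\<tau> * s < \<tau>" using tau by simp
      moreover have "(\<tau> * s) powr \<beta> * (\<tau> - \<tau> * s) powr c = \<tau> powr (\<beta> + c) * (s powr \<beta> * (1 - s) powr c)"
      proof -
        have "\<tau> - \<tau> * s = \<tau> * (1 - s)" by (simp add: algebra_simps)
        then show ?thesis using True tau by (simp add: powr_mult powr_add)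
      qed
      ultimately show ?thesis using True tau
        by (simp add: ennreal_mult'[symmetric])
    next
      case False
      then have "\<not> (0 < \<tau> * s \<and> \<tau> * s < \<tau>)"
        using tau by (auto simp: zero_less_mult_iff)
      then show ?thesis by auto
    qed
  qed
  also have "\<dots> = ennreal (\<tau> powr (\<beta> + c)) * (\<integral>\<^sup>+ s. ennreal (indicator {0..1} s * (s powr \<beta> * (1 - s) powr c)) \<partial>lborel)"
    by (rule nn_integral_cmult[OF m])
  also have "(\<integral>\<^sup>+ s. ennreal (indicator {0..1} s * (s powr \<beta> * (1 - s) powr c)) \<partial>lborel) = ennreal (Beta (\<beta> + 1) (c + 1))"
    using nn_integral_has_integral_lebesgue[OF _ has_integral_Beta_real[OF pos]] by simp
  finally have 2: "ennreal \<tau> * (\<integral>\<^sup>+ s. ?f (\<tau> * s) \<partial>lborel)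
      \<le> ennreal \<tau> * (ennreal (\<tau> powr (\<beta> + c)) * ennreal (Beta (\<beta> + 1) (c + 1)))"
    by (rule mult_left_mono) simp
  have 3: "ennreal \<tau> * (ennreal (\<tau> powr (\<beta> + c)) * ennreal (Beta (\<beta> + 1) (c + 1)))
      = ennreal (Beta (\<beta> + 1) (c + 1) * \<tau> powr (\<beta> + c + 1))"
  proof -
    have "Beta (\<beta> + 1) (c + 1) * \<tau> powr (\<beta> + c + 1) = \<tau> * (\<tau> powr (\<beta> + c) * Beta (\<beta> + 1) (c + 1))"
      using tau by (simp add: powr_add)
    then show ?thesis using tau by (simp only: ennreal_mult' powr_ge_zero less_imp_le)
  qed
  show "(\<integral>\<^sup>+ t. ?f t \<partial>lborel) \<le> ennreal (Beta (\<beta> + 1) (c + 1) * \<tau> powr (\<beta> + c + 1))"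
    using 2 unfolding 1 3 .
qed

text \<open>Bound for the kernel \<open>r\<^sup>\<gamma> G\<^sup>(\<^sup>k\<^sup>)\<^sub>r\<close>, with \<open>c = \<gamma> - |k| / 2\<close>.\<close>

definition kb :: "real \<Rightarrow> real \<Rightarrow> real ^ 'n::finite \<Rightarrow> real" where
  "kb c r y = (if r \<le> 0 then 0 else r powr c * pk CARD('n) r (tnorm y))"

lemma kb_nonneg [simp]: "0 \<le> kb c r y"
  by (simp add: kb_def)

lemma borel_measurable_kb [measurable (raw)]:
  assumes [measurable]: "f \<in> borel_measurable M" "g \<in> borel_measurable M"
  shows "(\<lambda>x. kb c (f x) (g x)) \<in> borel_measurable M"
proof -
  have 1: "(\<lambda>x. tnorm (g x)) \<in> borel_measurable M" by measurable
  have 2: "(\<lambda>x. f x powr c) \<in> borel_measurable M" by (intro powr_real_measurable) auto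
  have 3: "(\<lambda>x. pk CARD('b) (f x) (tnorm (g x))) \<in> borel_measurable M" by (rule borel_measurable_pk[OF assms(1) 1])
  show ?thesis unfolding kb_def using 1 2 3 by (intro measurable_If borel_measurable_times) auto
qed

definition tw :: "bool \<Rightarrow> real \<Rightarrow> real \<Rightarrow> ennreal" where
  "tw d \<beta> t = (if d then 1 else ennreal (t powr \<beta>))"

lemma borel_measurable_tw [measurable (raw)]:
  assumes [measurable]: "f \<in> borel_measurable M"
  shows "(\<lambda>x. tw d \<beta> (f x)) \<in> borel_measurable M"
  by (cases d) (simp_all add: tw_def)

lemma borel_measurable_fst_borel [measurable]: "fst \<in> borel_measurable borel"
  by (intro borel_measurable_continuous_onI continuous_intros)

lemma borel_measurable_snd_borel [measurable]: "snd \<in> borel_measurable borel"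
  by (intro borel_measurable_continuous_onI continuous_intros)

lemma measurable_vmeas [measurable (raw)]:
  "f \<in> borel_measurable borel \<Longrightarrow> f \<in> borel_measurable (vmeas d)"
  unfolding vmeas_def
  by (cases d) (auto intro: measurable_restrict_space1)

lemma nn_integral_vmeas_True:
  fixes f :: "real \<times> (real ^ 'n::finite) \<Rightarrow> ennreal"
  assumes [measurable]: "f \<in> borel_measurable borel"
  shows "(\<integral>\<^sup>+ p. f p \<partial>vmeas True) = (\<integral>\<^sup>+ x. f (0, x) * indicator cube x \<partial>lborel)"
proof -
  have "(\<lambda>x. (0::real, x :: real ^ 'n)) \<in> restrict_space lborel cube \<rightarrow>\<^sub>M borel"
    by (intro measurable_restrict_space1) measurable
  then show ?thesis
    by (simp add: vmeas_def nn_integral_distr nn_integral_restrict_space)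
qed

lemma nn_integral_vmeas_False:
  fixes f :: "real \<times> (real ^ 'n::finite) \<Rightarrow> ennreal"
  assumes [measurable]: "f \<in> borel_measurable borel"
  shows "(\<integral>\<^sup>+ p. f p \<partial>vmeas False)
    = (\<integral>\<^sup>+ t. (\<integral>\<^sup>+ x. f (t, x) * indicator cube x \<partial>lborel) * indicator {0<..<1} t \<partial>lborel)"
proof -
  have f: "f \<in> borel_measurable (borel \<Otimes>\<^sub>M borel)" by (simp add: borel_prod)
  have m: "({0<..<1} \<times> cube :: (real \<times> (real ^ 'n)) set) \<in> sets borel"
    by (subst borel_prod[symmetric]) auto
  have "(\<integral>\<^sup>+ p. f p \<partial>vmeas False) = (\<integral>\<^sup>+ p. f p * indicator ({0<..<1} \<times> cube) p \<partial>(lborel \<Otimes>\<^sub>M lborel))"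
    using m by (simp add: vmeas_def nn_integral_restrict_space lborel_prod)
  also have "\<dots> = (\<integral>\<^sup>+ t. (\<integral>\<^sup>+ x. f (t, x) * indicator ({0<..<1} \<times> cube) (t, x) \<partial>lborel) \<partial>lborel)"
    using f by (intro lborel.nn_integral_fst[symmetric]) auto
  also have "\<dots> = (\<integral>\<^sup>+ t. (\<integral>\<^sup>+ x. f (t, x) * indicator cube x \<partial>lborel) * indicator {0<..<1} t \<partial>lborel)"
    using f by (intro nn_integral_cong) (auto simp: indicator_times split: split_indicator)
  finally show ?thesis .
qed

text \<open>A Dirac vertex has no time integral and gives the exponent
  \<open>c - (a - \<theta>) / 2\<close>. With \<open>\<beta> = -1\<close> this equals the exponent
  of the general case, so one formula serves both kinds of vertices.\<close>

lemma nn_integral_vertex_le_aux: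
  fixes a \<theta> \<beta> c :: real
  assumes th: "0 \<le> \<theta>" "\<theta> \<le> a" "a < CARD('n::finite)"
    and b: "if d then \<beta> = -1 else \<beta> > -1 \<and> c - (a - \<theta>) / 2 > -1"
  shows "\<exists>C>0. \<forall>\<tau> y (z :: real ^ 'n). 0 < \<tau> \<longrightarrow>
    (\<integral>\<^sup>+ p. tw d \<beta> (fst p) * ennreal (kb c (\<tau> - fst p) (y - snd p)) * sing a (tnorm (snd p - z)) \<partial>vmeas d)
      \<le> ennreal (C * \<tau> powr (\<beta> + c + 1 - (a - \<theta>) / 2)) * sing \<theta> (tnorm (y - z))"
proof -
  obtain C where C: "C > 0" and le: "\<And>r y z. 0 < r \<Longrightarrow>
     (\<integral>\<^sup>+ x. ennreal (pk CARD('n) r (tnorm (y - x))) * sing a (tnorm (x - z)) * indicator cube x \<partial>(lborel :: (real ^ 'n) measure))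
      \<le> ennreal (C * r powr (- (a - \<theta>) / 2)) * sing \<theta> (tnorm (y - z))"
    using nn_integral_cube_pk_sing_le[OF th] by blast
  have le': "(\<integral>\<^sup>+ x. ennreal (kb c r (y - x)) * sing a (tnorm (x - z)) * indicator cube x \<partial>(lborel :: (real ^ 'n) measure))
      \<le> ennreal (C * r powr (c - (a - \<theta>) / 2)) * sing \<theta> (tnorm (y - z)) * indicator {0<..} r" for r and y z :: "real ^ 'n"
  proof (cases "0 < r")
    case True
    have "(\<integral>\<^sup>+ x. ennreal (kb c r (y - x)) * sing a (tnorm (x - z)) * indicator cube x \<partial>(lborel :: (real ^ 'n) measure))
      = (\<integral>\<^sup>+ x. ennreal (r powr c) * (ennreal (pk CARD('n) r (tnorm (y - x))) * sing a (tnorm (x - z)) * indicator cube x) \<partial>(lborel :: (real ^ 'n) measure))"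
      using True by (simp add: kb_def ennreal_mult' mult.assoc)
    also have "\<dots> = ennreal (r powr c) * (\<integral>\<^sup>+ x. ennreal (pk CARD('n) r (tnorm (y - x))) * sing a (tnorm (x - z)) * indicator cube x \<partial>(lborel :: (real ^ 'n) measure))"
      by (rule nn_integral_cmult) measurable
    also have "\<dots> \<le> ennreal (r powr c) * (ennreal (C * r powr (- (a - \<theta>) / 2)) * sing \<theta> (tnorm (y - z)))"
      by (intro mult_left_mono le True) auto
    also have "\<dots> = ennreal (C * r powr (c - (a - \<theta>) / 2)) * sing \<theta> (tnorm (y - z))"
    proof -
      have "C * r powr (c - (a - \<theta>) / 2) = r powr c * (C * r powr (- (a - \<theta>) / 2))"
        using powr_add[of r c "- (a - \<theta>) / 2"] by (simp add: diff_divide_distrib algebra_simps)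
      then show ?thesis using C by (simp only: ennreal_mult' powr_ge_zero mult.assoc)
    qed
    finally show ?thesis using True by simp
  qed (simp add: kb_def)
  show ?thesis
  proof (cases d)
    case True
    show ?thesis
    proof (intro exI[of _ C] conjI allI impI C)
      fix \<tau> :: real and y z :: "real ^ 'n" assume tau: "0 < \<tau>"
      have "(\<integral>\<^sup>+ p. tw d \<beta> (fst p) * ennreal (kb c (\<tau> - fst p) (y - snd p)) * sing a (tnorm (snd p - z)) \<partial>vmeas d)
        = (\<integral>\<^sup>+ x. ennreal (kb c \<tau> (y - x)) * sing a (tnorm (x - z)) * indicator cube x \<partial>lborel)"
        using True nn_integral_vmeas_True[of "\<lambda>p. ennreal (kb c (\<tau> - fst p) (y - snd p)) * sing a (tnorm (snd p - z))"]
        by (simp add: tw_def)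
      also have "\<dots> \<le> ennreal (C * \<tau> powr (c - (a - \<theta>) / 2)) * sing \<theta> (tnorm (y - z))"
        using le'[of \<tau> y z] tau by simp
      finally show "(\<integral>\<^sup>+ p. tw d \<beta> (fst p) * ennreal (kb c (\<tau> - fst p) (y - snd p)) * sing a (tnorm (snd p - z)) \<partial>vmeas d)
        \<le> ennreal (C * \<tau> powr (\<beta> + c + 1 - (a - \<theta>) / 2)) * sing \<theta> (tnorm (y - z))"
        using b True by simp
    qed
  next
    case False
    define e where "e = c - (a - \<theta>) / 2"
    have "\<beta> > -1" "e > -1" using b False by (auto simp: e_def)
    from nn_integral_Beta_le[OF this] obtain B where B: "B > 0" and Ble: "\<And>\<tau>. \<tau> > 0 \<Longrightarrow>
      (\<integral>\<^sup>+ t. ennreal (t powr \<beta>) * ennreal ((\<tau> - t) powr e) * indicator {0<..<\<tau>} t \<partial>lborel)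
        \<le> ennreal (B * \<tau> powr (\<beta> + e + 1))" by blast
    show ?thesis
    proof (intro exI[of _ "C * B"] conjI allI impI)
      show "0 < C * B" using C B by simp
      fix \<tau> :: real and y z :: "real ^ 'n" assume tau: "0 < \<tau>"
      let ?I = "\<lambda>t. (\<integral>\<^sup>+ x. tw d \<beta> t * ennreal (kb c (\<tau> - t) (y - x)) * sing a (tnorm (x - z)) * indicator cube x \<partial>lborel)"
      have "(\<integral>\<^sup>+ p. tw d \<beta> (fst p) * ennreal (kb c (\<tau> - fst p) (y - snd p)) * sing a (tnorm (snd p - z)) \<partial>vmeas d)
        = (\<integral>\<^sup>+ t. ?I t * indicator {0<..<1} t \<partial>lborel)"
        using False nn_integral_vmeas_False[of "\<lambda>p. tw d \<beta> (fst p) * ennreal (kb c (\<tau> - fst p) (y - snd p)) * sing a (tnorm (snd p - z))"]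
        by simp
      also have "\<dots> \<le> (\<integral>\<^sup>+ t. ennreal C * sing \<theta> (tnorm (y - z)) * (ennreal (t powr \<beta>) * ennreal ((\<tau> - t) powr e) * indicator {0<..<\<tau>} t) \<partial>lborel)"
      proof (rule nn_integral_mono)
        fix t :: real
        have "?I t = tw d \<beta> t * (\<integral>\<^sup>+ x. ennreal (kb c (\<tau> - t) (y - x)) * sing a (tnorm (x - z)) * indicator cube x \<partial>lborel)"
          by (subst nn_integral_cmult[symmetric]) (simp_all add: mult.assoc)
        also have "\<dots> \<le> ennreal (t powr \<beta>) * (ennreal (C * (\<tau> - t) powr e) * sing \<theta> (tnorm (y - z)) * indicator {0<..} (\<tau> - t))"
          using False by (intro mult_mono) (auto simp: tw_def e_def le')
        finally have "?I t * indicator {0<..<1} t \<le> ennreal (t powr \<beta>) * (ennreal (C * (\<tau> - t) powr e) * sing \<theta> (tnorm (y - z)) * indicator {0<..} (\<tau> - t)) * indicator {0<..<1} t"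
          by (rule mult_right_mono) simp
        also have "\<dots> \<le> ennreal C * sing \<theta> (tnorm (y - z)) * (ennreal (t powr \<beta>) * ennreal ((\<tau> - t) powr e) * indicator {0<..<\<tau>} t)"
          using C by (auto simp: ennreal_mult' mult_ac split: split_indicator)
        finally show "?I t * indicator {0<..<1} t \<le> ennreal C * sing \<theta> (tnorm (y - z)) * (ennreal (t powr \<beta>) * ennreal ((\<tau> - t) powr e) * indicator {0<..<\<tau>} t)" .
      qed
      also have "\<dots> = ennreal C * sing \<theta> (tnorm (y - z)) * (\<integral>\<^sup>+ t. ennreal (t powr \<beta>) * ennreal ((\<tau> - t) powr e) * indicator {0<..<\<tau>} t \<partial>lborel)"
        by (rule nn_integral_cmult) measurable
      also have "\<dots> \<le> ennreal C * sing \<theta> (tnorm (y - z)) * ennreal (B * \<tau> powr (\<beta> + e + 1))"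
        by (intro mult_left_mono Ble tau) auto
      also have "\<dots> = ennreal (C * B * \<tau> powr (\<beta> + c + 1 - (a - \<theta>) / 2)) * sing \<theta> (tnorm (y - z))"
      proof -
        have e: "\<beta> + c + 1 - (a - \<theta>) / 2 = \<beta> + e + 1" by (simp add: e_def)
        show ?thesis unfolding e using C B by (simp add: ennreal_mult' mult_ac)
      qed
      finally show "(\<integral>\<^sup>+ p. tw d \<beta> (fst p) * ennreal (kb c (\<tau> - fst p) (y - snd p)) * sing a (tnorm (snd p - z)) \<partial>vmeas d)
        \<le> ennreal (C * B * \<tau> powr (\<beta> + c + 1 - (a - \<theta>) / 2)) * sing \<theta> (tnorm (y - z))" .
    qed
  qed
qed

lemma powr_comparable:
  fixes \<sigma> \<tau> e :: real
  assumes "0 < \<tau>" "\<tau> / 2 \<le> \<sigma>" "\<sigma> \<le> \<tau>"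
  shows "\<sigma> powr e \<le> 2 powr \<bar>e\<bar> * \<tau> powr e"
proof (cases "0 \<le> e")
  case True
  have "\<sigma> powr e \<le> 1 * \<tau> powr e" using assms True by (simp add: powr_mono2)
  also have "\<dots> \<le> 2 powr \<bar>e\<bar> * \<tau> powr e" by (intro mult_right_mono ge_one_powr_ge_zero) auto
  finally show ?thesis .
next
  case False
  have "\<sigma> powr e \<le> (\<tau> / 2) powr e" using assms False by (intro powr_mono2') auto
  also have "\<dots> = 2 powr \<bar>e\<bar> * \<tau> powr e"
    using assms False by (simp add: powr_divide powr_minus field_simps)
  finally show ?thesis .
qed

text \<open>The argument \<open>q\<close> lists two times and the position of the upper endpoint. At
  a vertex other than a root both times agree and the sum is twice the kernel.\<close>

definition kb2 :: "real \<Rightarrow> real \<times> real \<times> (real ^ 'n::finite) \<Rightarrow> real \<times> (real ^ 'n) \<Rightarrow> ennreal" where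
  "kb2 c q p = ennreal (kb c (fst q - fst p) (snd (snd q) - snd p))
             + ennreal (kb c (fst (snd q) - fst p) (snd (snd q) - snd p))"

lemma borel_measurable_kb2_const [measurable]: "kb2 c q \<in> borel_measurable borel"
proof -
  have "(\<lambda>p. kb c (r - fst p) (snd (snd q) - snd p)) \<in> borel_measurable borel" for r
    by (intro borel_measurable_kb borel_measurable_diff borel_measurable_const
        borel_measurable_fst_borel borel_measurable_snd_borel)
  then show ?thesis
    unfolding kb2_def[abs_def] by (intro borel_measurable_add measurable_compose[OF _ measurable_ennreal])
qed

lemma nn_integral_vertex_le:
  fixes a \<theta> \<beta> c :: real
  assumes th: "0 \<le> \<theta>" "\<theta> \<le> a" "a < CARD('n::finite)"
    and b: "if d then \<beta> = -1 else \<beta> > -1 \<and> c - (a - \<theta>) / 2 > -1"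
  shows "\<exists>C>0. \<forall>\<tau> \<sigma> y (z :: real ^ 'n). 0 < \<tau> \<longrightarrow> \<tau> / 2 \<le> \<sigma> \<longrightarrow> \<sigma> \<le> \<tau> \<longrightarrow>
    (\<integral>\<^sup>+ p. tw d \<beta> (fst p) * kb2 c (\<tau>, \<sigma>, y) p * sing a (tnorm (snd p - z)) \<partial>vmeas d)
      \<le> ennreal (C * \<tau> powr (\<beta> + c + 1 - (a - \<theta>) / 2)) * sing \<theta> (tnorm (y - z))"
proof -
  define e where "e = \<beta> + c + 1 - (a - \<theta>) / 2"
  let ?f = "\<lambda>\<tau> y z p. tw d \<beta> (fst p) * ennreal (kb c (\<tau> - fst p) (y - snd p)) * sing a (tnorm (snd p - z))"
  obtain C where C: "C > 0" and le: "\<And>\<tau> y (z :: real ^ 'n). 0 < \<tau> \<Longrightarrow>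
    (\<integral>\<^sup>+ p. ?f \<tau> y z p \<partial>vmeas d) \<le> ennreal (C * \<tau> powr e) * sing \<theta> (tnorm (y - z))"
    using nn_integral_vertex_le_aux[OF assms] unfolding e_def by blast
  show ?thesis
  \<comment> \<open>The summand at time \<open>\<sigma>\<close> is converted to a power of
    \<open>\<tau>\<close> at the cost given by \<open>powr_comparable\<close>.\<close>
  proof (intro exI[of _ "C * (1 + 2 powr \<bar>e\<bar>)"] conjI allI impI)
    show "0 < C * (1 + 2 powr \<bar>e\<bar>)" using C by (simp add: add_pos_pos)
    fix \<tau> \<sigma> :: real and y z :: "real ^ 'n" assume tau: "0 < \<tau>" and s: "\<tau> / 2 \<le> \<sigma>" "\<sigma> \<le> \<tau>"
    have m: "?f \<tau> y z \<in> borel_measurable (vmeas d)" for \<tau>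
      by (rule measurable_vmeas) measurable
    have "(\<integral>\<^sup>+ p. tw d \<beta> (fst p) * kb2 c (\<tau>, \<sigma>, y) p * sing a (tnorm (snd p - z)) \<partial>vmeas d)
      = (\<integral>\<^sup>+ p. ?f \<tau> y z p + ?f \<sigma> y z p \<partial>vmeas d)"
      by (intro nn_integral_cong) (simp add: kb2_def algebra_simps)
    also have "\<dots> = (\<integral>\<^sup>+ p. ?f \<tau> y z p \<partial>vmeas d) + (\<integral>\<^sup>+ p. ?f \<sigma> y z p \<partial>vmeas d)"
      by (intro nn_integral_add m)
    also have "\<dots> \<le> ennreal (C * \<tau> powr e) * sing \<theta> (tnorm (y - z)) + ennreal (C * \<sigma> powr e) * sing \<theta> (tnorm (y - z))"
      using tau s by (intro add_mono le) auto
    also have "\<dots> \<le> ennreal (C * \<tau> powr e) * sing \<theta> (tnorm (y - z)) + ennreal (C * (2 powr \<bar>e\<bar> * \<tau> powr e)) * sing \<theta> (tnorm (y - z))"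
      using tau s C by (intro add_mono mult_right_mono ennreal_leI mult_left_mono powr_comparable order_refl) auto
    also have "\<dots> = ennreal (C * (1 + 2 powr \<bar>e\<bar>) * \<tau> powr e) * sing \<theta> (tnorm (y - z))"
      using C by (simp add: distrib_right[symmetric] ennreal_plus[symmetric] del: ennreal_plus) (simp add: algebra_simps)
    finally show "(\<integral>\<^sup>+ p. tw d \<beta> (fst p) * kb2 c (\<tau>, \<sigma>, y) p * sing a (tnorm (snd p - z)) \<partial>vmeas d)
      \<le> ennreal (C * (1 + 2 powr \<bar>e\<bar>) * \<tau> powr (\<beta> + c + 1 - (a - \<theta>) / 2)) * sing \<theta> (tnorm (y - z))"
      by (simp add: e_def)
  qed
qed

section \<open>Peeling a contracted forest\<close>

lemma finite_has_max_nat: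
  fixes f :: "'a \<Rightarrow> nat"
  assumes "finite A" "A \<noteq> {}"
  shows "\<exists>x\<in>A. \<forall>y\<in>A. f y \<le> f x"
proof -
  obtain x where "x \<in> A" "Max (f ` A) = f x" using obtains_MAX[OF assms, of f] .
  then show ?thesis using Max_ge[of "f ` A"] assms by (metis finite_imageI imageI)
qed

text \<open>\<open>V0\<close> are the vertices other than the two roots, \<open>B w\<close> the branch at \<open>w\<close>, \<open>D\<close> the Dirac vertices
  and \<open>c u\<close> stands for \<open>\<gamma> - |k| / 2\<close> on the edge above \<open>u\<close>; the value \<open>-1\<close> at the roots makes
  \<open>1 + c\<close> vanish there.\<close>

locale rooted_forest =
  fixes V0 :: "'v set" and par :: "'v \<Rightarrow> 'v" and r1 r2 :: 'v and B :: "'v \<Rightarrow> 'v set"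
    and dep :: "'v \<Rightarrow> nat" and D :: "'v set" and c :: "'v \<Rightarrow> real"
  assumes finite_V0: "finite V0" and r12: "r1 \<noteq> r2" and r1_V0: "r1 \<notin> V0" and r2_V0: "r2 \<notin> V0"
    and par_in: "v \<in> V0 \<Longrightarrow> par v \<in> V0 \<union> {r1, r2}"
    and dep_par: "v \<in> V0 \<Longrightarrow> dep (par v) < dep v"
    and B_self: "w \<in> V0 \<union> {r1, r2} \<Longrightarrow> w \<in> B w"
    and B_par: "u \<in> V0 \<Longrightarrow> w \<in> V0 \<union> {r1, r2} \<Longrightarrow> u \<noteq> w \<Longrightarrow> u \<in> B w \<longleftrightarrow> par u \<in> B w"
    and B_root: "r \<in> {r1, r2} \<Longrightarrow> w \<in> V0 \<union> {r1, r2} \<Longrightarrow> r \<in> B w \<longleftrightarrow> r = w"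
    and c_root: "c r1 = -1" "c r2 = -1"
    and D_V0: "D \<subseteq> V0"
begin

abbreviation "R \<equiv> {r1, r2}"
abbreviation "V \<equiv> V0 \<union> R"

lemma up_induct [consumes 1, case_names root vertex]:
  assumes "u \<in> V" "\<And>r. r \<in> R \<Longrightarrow> P r" "\<And>u. u \<in> V0 \<Longrightarrow> P (par u) \<Longrightarrow> P u"
  shows "P u"
  using assms(1)
proof (induction "dep u" arbitrary: u rule: less_induct)
  case less
  then show ?case
    using assms(2,3) dep_par[of u] par_in[of u] by (cases "u \<in> V0") auto
qed

lemma B_trans: "u \<in> V \<Longrightarrow> u \<in> B w \<Longrightarrow> w \<in> B w' \<Longrightarrow> w \<in> V \<Longrightarrow> w' \<in> V \<Longrightarrow> u \<in> B w'"
proof (induction u rule: up_induct)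
  case (root r)
  then show ?case using B_root[of r w] by auto
next
  case (vertex u)
  then show ?case
    using B_par[of u w] B_par[of u w'] B_self[of u] by (cases "u = w"; cases "u = w'") auto
qed

lemma B_dep: "u \<in> V \<Longrightarrow> u \<in> B w \<Longrightarrow> w \<in> V \<Longrightarrow> u \<noteq> w \<Longrightarrow> dep w < dep u"
proof (induction u rule: up_induct)
  case (root r)
  then show ?case using B_root[of r w] by auto
next
  case (vertex u)
  then show ?case using B_par[of u w] dep_par[of u] by (cases "par u = w") auto
qed

lemma B_comparable: "u \<in> V \<Longrightarrow> u \<in> B w \<Longrightarrow> u \<in> B w' \<Longrightarrow> w \<in> V \<Longrightarrow> w' \<in> V \<Longrightarrow> w \<in> B w' \<or> w' \<in> B w"
proof (induction u rule: up_induct)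
  case (root r)
  then show ?case using B_root[of r w] B_root[of r w'] by auto
next
  case (vertex u)
  then show ?case using B_par[of u w] B_par[of u w'] by (cases "u = w"; cases "u = w'") auto
qed

lemma B_some_root: "u \<in> V \<Longrightarrow> u \<in> B r1 \<or> u \<in> B r2"
proof (induction u rule: up_induct)
  case (root r)
  then show ?case using B_self by auto
next
  case (vertex u)
  then show ?case using B_par[of u r1] B_par[of u r2] r1_V0 r2_V0 by blast
qed

lemma B_one_root: "u \<in> V \<Longrightarrow> u \<in> B r1 \<Longrightarrow> u \<in> B r2 \<Longrightarrow> False"
  using B_comparable[of u r1 r2] B_root[of r1 r2] B_root[of r2 r1] r12 by auto

text \<open>A state of the peeling: \<open>S\<close> are the remaining vertices, \<open>M\<close> the contracted leaves, \<open>m\<close> the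
  involution pairing them and \<open>b u\<close> the exponent \<open>a\<^sub>e\<close> of the contracting edge at \<open>u\<close>.\<close>

definition leafS :: "'v set \<Rightarrow> 'v \<Rightarrow> bool" where
  "leafS S v \<longleftrightarrow> v \<in> S \<and> (\<forall>u\<in>S. par u \<noteq> v)"

text \<open>This is the exponent of the branch regrouped by vertices: each \<open>u\<close> carries
  its weight, the contribution \<open>1 + c u\<close> of the edge above it and a quarter of its
  contracting exponent, which is 0 off the contracted leaves. The edge above \<open>w\<close> lies
  outside the branch and is subtracted again; at a root that correction is 0.\<close>

definition Lam :: "'v set \<Rightarrow> ('v \<Rightarrow> real) \<Rightarrow> ('v \<Rightarrow> real) \<Rightarrow> 'v \<Rightarrow> real" where
  "Lam S b \<beta> w = (\<Sum>u\<in>(S \<union> R) \<inter> B w. \<beta> u + 1 + c u - b u / 4) - 1 - c w"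

text \<open>The contracting edges that leave the branch, each represented by its endpoint
  inside.\<close>

definition ext :: "'v set \<Rightarrow> ('v \<Rightarrow> 'v) \<Rightarrow> 'v \<Rightarrow> 'v set" where
  "ext M m w = {u \<in> M \<inter> B w. m u \<notin> B w}"

definition pairing :: "real \<Rightarrow> 'v set \<Rightarrow> 'v set \<Rightarrow> ('v \<Rightarrow> 'v) \<Rightarrow> ('v \<Rightarrow> real) \<Rightarrow> bool" where
  "pairing N S M m b \<longleftrightarrow> M \<subseteq> S \<and>
     (\<forall>u\<in>M. leafS S u \<and> m u \<in> M \<and> m u \<noteq> u \<and> m (m u) = u \<and> b (m u) = b u \<and> 0 < b u \<and> b u < N) \<and>
     (\<forall>u. u \<notin> M \<longrightarrow> b u = 0)"

text \<open>The last two conjuncts are conditions (a) and (b), demanded edge by edge instead of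
  through a maximum and a minimum. In this form they are inherited by every nonempty subset of the
  separating edges; only the loss of the last such edge makes the demand on \<open>Lam\<close>
  stronger.\<close>

definition state :: "real \<Rightarrow> 'v set \<Rightarrow> 'v set \<Rightarrow> ('v \<Rightarrow> 'v) \<Rightarrow> ('v \<Rightarrow> real) \<Rightarrow> ('v \<Rightarrow> real) \<Rightarrow> bool" where
  "state N S M m b \<beta> \<longleftrightarrow> S \<subseteq> V0 \<and> (\<forall>u\<in>S. par u \<in> S \<union> R) \<and> pairing N S M m b \<and>
     (\<forall>u\<in>S \<inter> D. leafS S u \<and> \<beta> u = -1) \<and>
     (\<forall>w\<in>S - D. c w > -1 \<and> (\<forall>u\<in>ext M m w. c w - b u / 4 > -1)) \<and>
     (\<forall>w\<in>S - D. (\<forall>u\<in>ext M m w. Lam S b \<beta> w + b u / 4 > -1) \<and> (ext M m w = {} \<longrightarrow> Lam S b \<beta> w > -1))"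

text \<open>An edge that leaves the branch of \<open>r1\<close> ends in the other tree, so the
  second alternative provides an edge between the trees that is singular enough to give the exponent
  \<open>\<theta>\<close>.\<close>

definition cross :: "real \<Rightarrow> 'v set \<Rightarrow> ('v \<Rightarrow> 'v) \<Rightarrow> ('v \<Rightarrow> real) \<Rightarrow> bool" where
  "cross \<theta> M m b \<longleftrightarrow> 0 \<le> \<theta> \<and> (\<theta> = 0 \<or> (\<exists>u\<in>ext M m r1. \<theta> \<le> b u))"

lemma stateD:
  assumes "state N S M m b \<beta>"
  shows "S \<subseteq> V0" "finite S" "u \<in> S \<Longrightarrow> par u \<in> S \<union> R" "pairing N S M m b"
    "u \<in> S \<Longrightarrow> u \<in> D \<Longrightarrow> leafS S u" "u \<in> S \<Longrightarrow> u \<in> D \<Longrightarrow> \<beta> u = -1"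
    "w \<in> S \<Longrightarrow> w \<notin> D \<Longrightarrow> c w > -1" "w \<in> S \<Longrightarrow> w \<notin> D \<Longrightarrow> u \<in> ext M m w \<Longrightarrow> c w - b u / 4 > -1"
    "w \<in> S \<Longrightarrow> w \<notin> D \<Longrightarrow> u \<in> ext M m w \<Longrightarrow> Lam S b \<beta> w + b u / 4 > -1"
    "w \<in> S \<Longrightarrow> w \<notin> D \<Longrightarrow> ext M m w = {} \<Longrightarrow> Lam S b \<beta> w > -1"
  using assms finite_subset[OF _ finite_V0] unfolding state_def by auto

lemma pairingD:
  assumes "pairing N S M m b"
  shows "M \<subseteq> S" "u \<in> M \<Longrightarrow> leafS S u" "u \<in> M \<Longrightarrow> m u \<in> M" "u \<in> M \<Longrightarrow> m u \<noteq> u"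
    "u \<in> M \<Longrightarrow> m (m u) = u" "u \<in> M \<Longrightarrow> b (m u) = b u" "u \<in> M \<Longrightarrow> 0 < b u" "u \<in> M \<Longrightarrow> b u < N"
    "u \<notin> M \<Longrightarrow> b u = 0" "0 \<le> b u"
  using assms unfolding pairing_def by (blast, blast, blast, blast, blast, blast, blast, blast, blast, metis less_imp_le order_refl)

lemma root_notin_B: "w \<in> V0 \<Longrightarrow> r \<in> R \<Longrightarrow> r \<notin> B w"
  using B_root[of r w] r1_V0 r2_V0 by auto

text \<open>\<open>S\<close> is closed under taking parents below the roots. The path from a further
  vertex of the branch up to \<open>v\<close> would therefore stay in \<open>S\<close> and reach
  \<open>v\<close> through a child in \<open>S\<close>.\<close>

lemma leaf_branch:
  assumes S: "S \<subseteq> V0" "\<And>u. u \<in> S \<Longrightarrow> par u \<in> S \<union> R" and v: "leafS S v"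
  shows "u \<in> S \<Longrightarrow> u \<in> B v \<longleftrightarrow> u = v"
proof -
  have v': "v \<in> V0" using v S by (auto simp: leafS_def)
  have "u \<in> S \<longrightarrow> u \<in> B v \<longrightarrow> u = v" if "u \<in> V" for u
    using that
  proof (induction u rule: up_induct)
    case (root r)
    then show ?case using S r1_V0 r2_V0 by auto
  next
    case (vertex u)
    show ?case
    proof (intro impI, rule ccontr)
      assume u: "u \<in> S" "u \<in> B v" "u \<noteq> v"
      then have p: "par u \<in> B v" using B_par[of u v] vertex v' by auto
      then have "par u \<in> S" using S(2)[OF u(1)] root_notin_B[OF v'] by auto
      then have "par u = v" using vertex p by simp
      then show False using v u by (auto simp: leafS_def)
    qed
  qed
  moreover assume "u \<in> S"
  ultimately show ?thesis using S B_self[of v] v' by blast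
qed

lemma leaf_below:
  assumes "finite S" "S \<subseteq> V0" "w \<in> S"
  shows "\<exists>u\<in>S. leafS S u \<and> u \<in> B w"
proof -
  let ?A = "S \<inter> B w"
  have "finite ?A" "?A \<noteq> {}" using assms B_self[of w] by auto
  then obtain u where u: "u \<in> ?A" and max: "\<And>x. x \<in> ?A \<Longrightarrow> dep x \<le> dep u"
    using finite_has_max_nat[of ?A dep] by blast
  have "par x \<noteq> u" if "x \<in> S" for x
  proof
    assume p: "par x = u"
    have "dep u < dep x" using dep_par[of x] that assms p by auto
    moreover have "x \<in> B w" using B_par[of x w] B_self[of w] that assms u p by (cases "x = w") auto
    ultimately show False using max[of x] that by auto
  qed
  then show ?thesis using u by (auto simp: leafS_def)
qed

lemma Lam_leaf:
  assumes "state N S M m b \<beta>" "leafS S v"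
  shows "Lam S b \<beta> v = \<beta> v - b v / 4"
proof -
  note S = stateD(1,3)[OF assms(1)]
  have v: "v \<in> S" "v \<in> V0" using assms S by (auto simp: leafS_def)
  have "(S \<union> R) \<inter> B v = {v}"
    using leaf_branch[OF S assms(2)] v root_notin_B[OF v(2)] by auto
  then show ?thesis by (simp add: Lam_def)
qed

text \<open>Here condition (b) pays off. The branch of a leaf is the leaf alone and
  \<open>Lam\<close> is \<open>\<beta> - b / 4\<close>. A contracting edge at the leaf separates
  that branch, which adds \<open>b / 4\<close> back; without such an edge \<open>b\<close> is 0.
  Both forms of the condition thus read \<open>\<beta> > -1\<close>.\<close>

lemma leaf_beta:
  assumes "state N S M m b \<beta>" "leafS S v" "v \<notin> D"
  shows "\<beta> v > -1"
proof -
  note S = stateD(1,3)[OF assms(1)] and P = pairingD[OF stateD(4)[OF assms(1)]]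
  have v: "v \<in> S" using assms by (auto simp: leafS_def)
  show ?thesis
  proof (cases "v \<in> M")
    case True
    then have "v \<in> ext M m v"
      using leaf_branch[OF S assms(2), of v] leaf_branch[OF S assms(2), of "m v"] v P(1) P(3,4)[of v]
      by (auto simp: ext_def)
    then show ?thesis using stateD(9)[OF assms(1) v assms(3)] Lam_leaf[OF assms(1,2)] by fastforce
  next
    case False
    then have "ext M m v = {}" using leaf_branch[OF S assms(2)] P(1) by (auto simp: ext_def)
    then show ?thesis using stateD(10)[OF assms(1) v assms(3)] Lam_leaf[OF assms(1,2)] P(9)[OF False] by simp
  qed
qed

section \<open>How a peeling step changes the exponents of a state\<close>

lemma peel_sum:
  fixes f g :: "'v \<Rightarrow> real"
  assumes S: "finite S" "S \<subseteq> V0" "v \<in> S" "par v \<in> S \<union> R" and w: "w \<in> S \<union> R" "w \<noteq> v"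
    and g: "g (par v) = f (par v) + f v" "\<And>u. u \<in> S \<union> R \<Longrightarrow> u \<noteq> v \<Longrightarrow> u \<noteq> par v \<Longrightarrow> g u = f u"
  shows "(\<Sum>u\<in>((S - {v}) \<union> R) \<inter> B w. g u) = (\<Sum>u\<in>(S \<union> R) \<inter> B w. f u)"
proof -
  let ?A = "((S - {v}) \<union> R) \<inter> B w"
  have v: "v \<in> V0" "v \<notin> R" using S r1_V0 r2_V0 by auto
  have pv: "par v \<noteq> v" using dep_par[of v] v by auto
  \<comment> \<open>A vertex and its parent lie in the same branches, apart from the branch of the
    vertex itself. A charge passed from \<open>v\<close> to its parent therefore stays inside every
    sum that contained it.\<close>
  have iff: "v \<in> B w \<longleftrightarrow> par v \<in> B w" using B_par[of v w] v w S by auto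
  have fin: "finite ?A" using S by auto
  show ?thesis
  proof (cases "v \<in> B w")
    case True
    then have p: "par v \<in> ?A" using iff S pv by auto
    have "(S \<union> R) \<inter> B w = insert v ?A" using True S by auto
    then have "(\<Sum>u\<in>(S \<union> R) \<inter> B w. f u) = f v + (\<Sum>u\<in>?A. f u)"
      using fin v by simp
    also have "(\<Sum>u\<in>?A. f u) = f (par v) + (\<Sum>u\<in>?A - {par v}. f u)"
      by (rule sum.remove[OF fin p])
    also have "(\<Sum>u\<in>?A - {par v}. f u) = (\<Sum>u\<in>?A - {par v}. g u)"
      using g v by (intro sum.cong) auto
    finally show ?thesis using sum.remove[OF fin p, of g] g by simp
  next
    case False
    then have "?A = (S \<union> R) \<inter> B w" by auto
    then show ?thesis using g False iff by (intro sum.cong) auto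
  qed
qed

text \<open>This is the conservation law of the peeling: the parent takes over the whole
  contribution of \<open>v\<close>. The assumption concerns only the combination of weight and
  contracting exponent at the parent, so it covers both a converted singularity and one that moves
  up unchanged.\<close>

lemma Lam_peel:
  assumes S: "finite S" "S \<subseteq> V0" "v \<in> S" "par v \<in> S \<union> R" and w: "w \<in> S \<union> R" "w \<noteq> v"
    and p: "\<beta>' (par v) - b' (par v) / 4 = \<beta> (par v) - b (par v) / 4 + (1 + c v + \<beta> v - b v / 4)"
    and oth: "\<And>u. u \<in> S \<union> R \<Longrightarrow> u \<noteq> v \<Longrightarrow> u \<noteq> par v \<Longrightarrow> \<beta>' u = \<beta> u \<and> b' u = b u"
  shows "Lam (S - {v}) b' \<beta>' w = Lam S b \<beta> w"
  unfolding Lam_def using p oth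
  by (subst peel_sum[OF S w, of _ "\<lambda>u. \<beta> u + 1 + c u - b u / 4"]) auto

lemma leafS_remove: "leafS S u \<Longrightarrow> u \<noteq> v \<Longrightarrow> leafS (S - {v}) u"
  by (auto simp: leafS_def)

lemma state_drop_free_leaf:
  assumes st: "state N S M m b \<beta>" and v: "leafS S v" "v \<notin> M"
  defines "\<beta>' \<equiv> \<beta>(par v := \<beta> (par v) + (1 + c v + \<beta> v))"
  shows "state N (S - {v}) M m b \<beta>'"
    and "w \<in> S \<union> R \<Longrightarrow> w \<noteq> v \<Longrightarrow> Lam (S - {v}) b \<beta>' w = Lam S b \<beta> w"
proof -
  note S = stateD(1,2,3)[OF st] and P = pairingD[OF stateD(4)[OF st]]
  have vS: "v \<in> S" using v by (simp add: leafS_def)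
  show L: "Lam (S - {v}) b \<beta>' w = Lam S b \<beta> w" if "w \<in> S \<union> R" "w \<noteq> v" for w
    using S vS that P(9)[OF v(2)] by (intro Lam_peel) (auto simp: \<beta>'_def)
  \<comment> \<open>Dirac vertices are leaves, so a vertex that still has a child is not Dirac and
    its weight may change.\<close>
  have pD: "par v \<in> S \<Longrightarrow> par v \<notin> D" using stateD(5)[OF st, of "par v"] vS by (auto simp: leafS_def)
  show "state N (S - {v}) M m b \<beta>'"
    unfolding state_def
  proof (intro conjI ballI impI)
    show "S - {v} \<subseteq> V0" using S by auto
    show "par u \<in> S - {v} \<union> R" if "u \<in> S - {v}" for u using S(3)[of u] that v by (auto simp: leafS_def)
    show "pairing N (S - {v}) M m b"
    proof -
      have "leafS (S - {v}) u" if "u \<in> M" for u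
        using leafS_remove P(2)[OF that] that v(2) by metis
      moreover have "M \<subseteq> S - {v}" using P(1) v(2) by auto
      ultimately show ?thesis using stateD(4)[OF st] by (simp add: pairing_def)
    qed
    fix u assume u: "u \<in> (S - {v}) \<inter> D"
    then show "leafS (S - {v}) u" using stateD(5)[OF st] leafS_remove by auto
    show "\<beta>' u = -1" using stateD(6)[OF st] u pD by (auto simp: \<beta>'_def)
  qed (use stateD(7-10)[OF st] L in auto)
qed

text \<open>Being the only child, \<open>v\<close> leaves its parent behind as a leaf, which can
  inherit the partner of \<open>v\<close>. As \<open>v\<close> and its parent lie in the same other
  branches, every remaining branch is separated by the same edges as before, with the same
  exponents.\<close>

lemma state_move_up:
  assumes st: "state N S M m b \<beta>" and v: "v \<in> M" and p: "par v \<in> S"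
    and only: "\<And>u. u \<in> S \<Longrightarrow> par u = par v \<Longrightarrow> u = v"
  defines "\<beta>' \<equiv> \<beta>(par v := \<beta> (par v) + (1 + c v + \<beta> v))"
    and "b' \<equiv> b(v := 0, par v := b v)" and "m' \<equiv> m(par v := m v, m v := par v)"
    and "M' \<equiv> insert (par v) (M - {v})"
  shows "state N (S - {v}) M' m' b' \<beta>'"
    and "w \<in> S \<union> R \<Longrightarrow> w \<noteq> v \<Longrightarrow> Lam (S - {v}) b' \<beta>' w = Lam S b \<beta> w"
    and "u \<in> ext M m r1 \<Longrightarrow> \<exists>u'\<in>ext M' m' r1. b' u' = b u"
proof -
  note S = stateD(1,2,3)[OF st] and P = pairingD[OF stateD(4)[OF st]]
  define q where "q = m v"
  have vS: "v \<in> S" using v P by auto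
  have q: "q \<in> M" "q \<noteq> v" "m q = v" "b q = b v" "leafS S q" using v P by (auto simp: q_def)
  have pM: "par v \<notin> M" using P(2)[of "par v"] vS by (auto simp: leafS_def)
  have pv: "par v \<noteq> v" using dep_par[of v] vS S by auto
  have pq: "par v \<noteq> q" using q pM by auto
  have bp: "b (par v) = 0" using P(9) pM by auto
  have pD: "par v \<notin> D" using stateD(5)[OF st, of "par v"] vS p by (auto simp: leafS_def)
  have vleaf: "leafS S v" using P v by auto
  show L: "Lam (S - {v}) b' \<beta>' w = Lam S b \<beta> w" if "w \<in> S \<union> R" "w \<noteq> v" for w
    using S vS that bp pv by (intro Lam_peel) (auto simp: \<beta>'_def b'_def)
  have Bv: "v \<in> B w \<longleftrightarrow> par v \<in> B w" if "w \<in> S \<union> R" "w \<noteq> v" for w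
    using B_par[of v w] vS S that by auto
  \<comment> \<open>Only a renaming takes place: the endpoint \<open>v\<close> is now called
    \<open>par v\<close>. The partner needs its own case because its image under the involution
    changes.\<close>
  have E: "u \<in> ext M' m' w \<longleftrightarrow> (if u = par v then v \<in> ext M m w else u \<noteq> v \<and> u \<in> ext M m w)"
    if "w \<in> S \<union> R" "w \<noteq> v" for u w
  proof -
    have m': "m' (par v) = q" "m' q = par v" "x \<noteq> par v \<Longrightarrow> x \<noteq> q \<Longrightarrow> m' x = m x" for x
      using pq by (auto simp: m'_def q_def[symmetric])
    have M': "par v \<in> M'" "v \<notin> M'" "q \<in> M'" "x \<noteq> par v \<Longrightarrow> x \<noteq> v \<Longrightarrow> x \<in> M' \<longleftrightarrow> x \<in> M" for x
      using pv q by (auto simp: M'_def)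
    note B = Bv[OF that]
    consider "u = par v" | "u = v" | "u = q" | "u \<noteq> par v" "u \<noteq> v" "u \<noteq> q" by blast
    then show ?thesis
    proof cases
      case 1
      then show ?thesis using m'(1) M'(1) v B by (simp add: ext_def q_def)
    next
      case 2
      then show ?thesis using M'(2) pv by (simp add: ext_def)
    next
      case 3
      then show ?thesis using m'(2) M'(3) q(1,2,3) B pq by (simp add: ext_def)
    next
      case 4
      then show ?thesis using m'(3)[of u] M'(4)[of u] by (simp add: ext_def)
    qed
  qed
  have E1: "\<exists>u'\<in>ext M m w. b' u = b u'" if "w \<in> S \<union> R" "w \<noteq> v" "u \<in> ext M' m' w" for u w
    using E[OF that(1,2), of u] that(3) by (auto simp: b'_def split: if_splits)
  have E2: "\<exists>u'\<in>ext M' m' w. b' u' = b u" if "w \<in> S \<union> R" "w \<noteq> v" "u \<in> ext M m w" for u w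
  proof (cases "u = v")
    case True
    then have "par v \<in> ext M' m' w" using E[OF that(1,2), of "par v"] that(3) by simp
    moreover have "b' (par v) = b u" using True by (simp add: b'_def)
    ultimately show ?thesis by blast
  next
    case False
    then have "u \<noteq> par v" using that(3) pM by (auto simp: ext_def)
    then have "u \<in> ext M' m' w" "b' u = b u" using E[OF that(1,2), of u] that(3) False by (auto simp: b'_def)
    then show ?thesis by blast
  qed
  show "u \<in> ext M m r1 \<Longrightarrow> \<exists>u'\<in>ext M' m' r1. b' u' = b u"
    using E2[of r1 u] vS S r1_V0 by auto
  show "state N (S - {v}) M' m' b' \<beta>'"
    unfolding state_def
  proof (intro conjI ballI impI)
    show "S - {v} \<subseteq> V0" using S by auto
    show "par u \<in> S - {v} \<union> R" if "u \<in> S - {v}" for u using S(3)[of u] that vleaf by (auto simp: leafS_def)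
    have lp: "leafS (S - {v}) (par v)" using p pv only by (auto simp: leafS_def)
    show "pairing N (S - {v}) M' m' b'"
      unfolding pairing_def
    proof (intro conjI ballI allI impI)
      show "M' \<subseteq> S - {v}" using P(1) p pv by (auto simp: M'_def)
      fix u
      show "b' u = 0" if "u \<notin> M'" using that P(9)[of u] by (auto simp: M'_def b'_def)
      assume u: "u \<in> M'"
      have other: "m u \<in> M - {v, q}" if "u \<noteq> par v" "u \<noteq> q"
      proof -
        have uM: "u \<in> M" "u \<noteq> v" using u that by (auto simp: M'_def)
        then have "m u \<noteq> v" "m u \<noteq> q" using P(5)[OF uM(1)] P(5)[OF v] q that(2) q_def by metis+
        then show ?thesis using P(3)[OF uM(1)] by simp
      qed
      show "leafS (S - {v}) u" using u lp P(2)[of u] leafS_remove by (auto simp: M'_def)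
      show "m' u \<in> M'" using other q pq by (auto simp: m'_def M'_def q_def[symmetric])
      show "m' u \<noteq> u" using u pq P(4)[of u] by (auto simp: m'_def M'_def q_def[symmetric])
      show "m' (m' u) = u" using u other pq pM P(5)[of u] by (auto simp: m'_def M'_def q_def[symmetric])
      show "b' (m' u) = b' u" using u other pq q pM P(6)[of u] pv by (auto simp: m'_def M'_def b'_def q_def[symmetric])
      show "0 < b' u" "b' u < N" using u P(7,8)[of u] P(7,8)[OF v] by (auto simp: M'_def b'_def)
    qed
    fix u assume u: "u \<in> (S - {v}) \<inter> D"
    then show "leafS (S - {v}) u" using stateD(5)[OF st] leafS_remove by auto
    show "\<beta>' u = -1" using stateD(6)[OF st] u pD by (auto simp: \<beta>'_def)
  next
    fix w assume w: "w \<in> S - {v} - D"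
    show "c w > -1" using w stateD(7)[OF st] by auto
    show "c w - b' u / 4 > -1" if "u \<in> ext M' m' w" for u
      using E1[of w u] stateD(8)[OF st, of w] w that by fastforce
    show "Lam (S - {v}) b' \<beta>' w + b' u / 4 > -1" if "u \<in> ext M' m' w" for u
      using E1[of w u] stateD(9)[OF st, of w] w that L[of w] by fastforce
    show "Lam (S - {v}) b' \<beta>' w > -1" if "ext M' m' w = {}"
    proof -
      have "ext M m w = {}" using E2[of w] w that by auto
      then show ?thesis using stateD(10)[OF st, of w] w L[of w] by auto
    qed
  qed
qed

lemma state_drop_pair:
  assumes st: "state N S M m b \<beta>" and v: "v \<in> M"
    and keep: "\<And>w. w \<in> S - {v, m v} \<Longrightarrow> ext M m w \<inter> {v, m v} \<noteq> {} \<Longrightarrow> ext M m w - {v, m v} \<noteq> {}"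
  defines "b' \<equiv> b(v := 0, m v := 0)"
    and "\<beta>1 \<equiv> \<beta>(par v := \<beta> (par v) + (1 + c v + \<beta> v - b v / 4))"
  defines "\<beta>' \<equiv> \<beta>1(par (m v) := \<beta>1 (par (m v)) + (1 + c (m v) + \<beta> (m v) - b v / 4))"
  shows "state N (S - {v} - {m v}) (M - {v, m v}) m b' \<beta>'"
    and "w \<in> S \<union> R \<Longrightarrow> w \<noteq> v \<Longrightarrow> w \<noteq> m v \<Longrightarrow> Lam (S - {v} - {m v}) b' \<beta>' w = Lam S b \<beta> w"
    and "w \<in> V \<Longrightarrow> ext (M - {v, m v}) m w = ext M m w - {v, m v}"
proof -
  note S = stateD(1,2,3)[OF st] and P = pairingD[OF stateD(4)[OF st]]
  define q where "q = m v"
  have vS: "v \<in> S" using v P by auto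
  have q: "q \<in> M" "q \<noteq> v" "m q = v" "b q = b v" "leafS S q" "q \<in> S" using v P by (auto simp: q_def)
  have vleaf: "leafS S v" using P v by auto
  have pq: "par v \<noteq> q" "par q \<noteq> v" "par q \<noteq> q" "par v \<noteq> v" using q vleaf vS by (auto simp: leafS_def)
  have pqM: "par v \<notin> M" "par q \<notin> M" using P(2) vS q by (auto simp: leafS_def)
  have pD: "par v \<notin> D \<or> par v \<notin> S" "par q \<notin> D \<or> par q \<notin> S"
    using stateD(5)[OF st, of "par v"] stateD(5)[OF st, of "par q"] vS q by (auto simp: leafS_def)
  have L1: "Lam (S - {v}) (b(v := 0)) \<beta>1 w = Lam S b \<beta> w" if "w \<in> S \<union> R" "w \<noteq> v" for w
    using S vS that pq by (intro Lam_peel) (auto simp: \<beta>1_def)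
  \<comment> \<open>In the intermediate state \<open>v\<close> has gone while its partner still
    carries its exponent, so \<open>Lam_peel\<close> applies to each vertex in turn.\<close>
  have L2: "Lam (S - {v} - {q}) b' \<beta>' w = Lam (S - {v}) (b(v := 0)) \<beta>1 w" if "w \<in> S \<union> R" "w \<noteq> v" "w \<noteq> q" for w
  proof (rule Lam_peel)
    have "r \<noteq> v" if "r \<in> R" for r using that vS S r1_V0 r2_V0 by auto
    then show "w \<in> S - {v} \<union> R" using that by auto
    show "par q \<in> S - {v} \<union> R" using S(3)[of q] q pq by auto
    show "\<beta>' (par q) - b' (par q) / 4 = \<beta>1 (par q) - (b(v := 0)) (par q) / 4 + (1 + c q + \<beta>1 q - (b(v := 0)) q / 4)"
      using pq q by (simp add: \<beta>'_def b'_def q_def[symmetric] \<beta>1_def)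
  qed (use S q that in \<open>auto simp: \<beta>'_def b'_def q_def[symmetric]\<close>)
  show L: "Lam (S - {v} - {m v}) b' \<beta>' w = Lam S b \<beta> w" if "w \<in> S \<union> R" "w \<noteq> v" "w \<noteq> m v" for w
    using L1[of w] L2[of w] that by (simp add: q_def)
  show E: "ext (M - {v, m v}) m w = ext M m w - {v, m v}" for w
    by (auto simp: ext_def)
  have b'_eq: "b' u = b u" if "u \<in> ext M m w - {v, m v}" for u w using that by (auto simp: b'_def)
  show "state N (S - {v} - {m v}) (M - {v, m v}) m b' \<beta>'"
    unfolding state_def
  proof (intro conjI ballI impI)
    show "S - {v} - {m v} \<subseteq> V0" using S by auto
    show "par u \<in> S - {v} - {m v} \<union> R" if "u \<in> S - {v} - {m v}" for u
      using S(3)[of u] that vleaf q by (auto simp: leafS_def q_def)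
    show "pairing N (S - {v} - {m v}) (M - {v, m v}) m b'"
      unfolding pairing_def
    proof (intro conjI ballI allI impI)
      show "M - {v, m v} \<subseteq> S - {v} - {m v}" using P(1) by auto
      fix u
      show "b' u = 0" if "u \<notin> M - {v, m v}" using that P(9)[of u] by (auto simp: b'_def)
      assume u: "u \<in> M - {v, m v}"
      show "leafS (S - {v} - {m v}) u" using u P(2)[of u] leafS_remove by auto
      show mu: "m u \<in> M - {v, m v}" using u P(3,5)[of u] P(5)[OF v] by auto
      show "m u \<noteq> u" "m (m u) = u" using u P(4,5)[of u] by auto
      show "b' (m u) = b' u" using u mu P(6)[of u] by (auto simp: b'_def)
      show "0 < b' u" "b' u < N" using u P(7,8)[of u] by (auto simp: b'_def)
    qed
    fix u assume u: "u \<in> (S - {v} - {m v}) \<inter> D"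
    then show "leafS (S - {v} - {m v}) u" using stateD(5)[OF st] leafS_remove by auto
    show "\<beta>' u = -1" using stateD(6)[OF st] u pD by (auto simp: \<beta>'_def \<beta>1_def q_def)
  next
    fix w assume w: "w \<in> S - {v} - {m v} - D"
    show "c w > -1" using w stateD(7)[OF st] by auto
    show "c w - b' u / 4 > -1" if "u \<in> ext (M - {v, m v}) m w" for u
      using b'_eq[of u w] stateD(8)[OF st, of w u] w that E[of w] by auto
    show "Lam (S - {v} - {m v}) b' \<beta>' w + b' u / 4 > -1" if "u \<in> ext (M - {v, m v}) m w" for u
      using b'_eq[of u w] stateD(9)[OF st, of w u] w that L[of w] E[of w] by auto
    show "Lam (S - {v} - {m v}) b' \<beta>' w > -1" if "ext (M - {v, m v}) m w = {}"
    proof -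
      have "ext M m w = {}" using keep[of w] w that E[of w] by auto
      then show ?thesis using stateD(10)[OF st, of w] w L[of w] by auto
    qed
  qed
qed

text \<open>The pair to be removed is one contained in a branch as small as possible; then every branch
  separating it contains a further contracted leaf, which leads out of that branch as well.\<close>

lemma exists_peel:
  assumes st: "state N S M m b \<beta>" and ne: "S \<noteq> {}" and cr: "cross \<theta> M m b"
  shows "(\<exists>v. leafS S v \<and> v \<notin> M)
    \<or> (\<exists>v\<in>M. par v \<in> S \<and> (\<forall>u\<in>S. par u = par v \<longrightarrow> u = v))
    \<or> (\<exists>v\<in>M. (\<forall>w\<in>S - {v, m v}. ext M m w \<inter> {v, m v} \<noteq> {} \<longrightarrow> ext M m w - {v, m v} \<noteq> {}) \<and>
          (\<theta> = 0 \<or> (\<exists>u\<in>ext M m r1 - {v, m v}. \<theta> \<le> b u)))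
    \<or> (\<exists>v\<in>M. S = {v, m v} \<and> par v = r1 \<and> par (m v) = r2 \<and> \<theta> \<le> b v)"
proof (rule ccontr)
  assume "\<not> ?thesis"
  then have n1: "\<And>v. leafS S v \<Longrightarrow> v \<in> M"
    and n2: "\<And>v. v \<in> M \<Longrightarrow> par v \<in> S \<Longrightarrow> \<exists>u\<in>S. par u = par v \<and> u \<noteq> v"
    and n3: "\<And>v. v \<in> M \<Longrightarrow> (\<And>w. w \<in> S - {v, m v} \<Longrightarrow> ext M m w \<inter> {v, m v} \<noteq> {} \<Longrightarrow> ext M m w - {v, m v} \<noteq> {})
           \<Longrightarrow> \<not> (\<theta> = 0 \<or> (\<exists>u\<in>ext M m r1 - {v, m v}. \<theta> \<le> b u))"
    and n4: "\<And>v. v \<in> M \<Longrightarrow> S = {v, m v} \<Longrightarrow> par v = r1 \<Longrightarrow> par (m v) = r2 \<Longrightarrow> \<not> \<theta> \<le> b v"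
    by blast+
  note S = stateD(1,2,3)[OF st] and P = pairingD[OF stateD(4)[OF st]]
  have MV: "u \<in> M \<Longrightarrow> u \<in> S \<and> u \<in> V0 \<and> u \<in> V" for u using P S by auto
  \<comment> \<open>In a branch without a complete pair a second separating edge is found as
    follows. The vertex \<open>v\<close> is not an only child, by \<open>n2\<close>, so it has a
    sibling inside the branch. A leaf below this sibling is contracted by \<open>n1\<close>, and its
    partner must lie outside.\<close>
  have sib: "\<exists>u'\<in>M. u' \<in> B w \<and> m u' \<notin> B w \<and> u' \<noteq> v \<and> u' \<noteq> m v"
    if v: "v \<in> M" and w: "w \<in> S" "v \<in> B w" "v \<noteq> w" "m v \<notin> B w"
      and nofull: "\<And>u. u \<in> M \<Longrightarrow> u \<in> B w \<Longrightarrow> m u \<notin> B w" for v w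
  proof -
    have wV: "w \<in> V0" "w \<in> V" using w S by auto
    have vV: "v \<in> V0" "v \<in> S" using MV v by auto
    have p: "par v \<in> B w" using B_par[of v w] vV wV w by auto
    then have pS: "par v \<in> S" using S(3)[of v] vV root_notin_B[OF wV(1)] by auto
    obtain d where d: "d \<in> S" "par d = par v" "d \<noteq> v" using n2[OF v pS] by auto
    have dw: "d \<in> B w" using B_par[of d w] d S wV p B_self[of w] by (cases "d = w") auto
    obtain u' where u': "leafS S u'" "u' \<in> B d" using leaf_below[OF S(2,1) d(1)] by auto
    then have u'M: "u' \<in> M" using n1 by auto
    have dV: "d \<in> V" using d S by auto
    have "u' \<in> B w" using B_trans[of u' d w] u' dw wV MV[OF u'M] dV by auto
    moreover have "u' \<noteq> v"
    proof
      assume "u' = v"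
      then have "par v \<in> B d" using u' B_par[of v d] vV dV d by auto
      then have "par v = d \<or> dep d < dep (par v)" using B_dep[of "par v" d] pS S dV by auto
      then show False using dep_par[of d] d S by auto
    qed
    ultimately show ?thesis using u'M nofull w by blast
  qed
  have rest: "ext M m w - {v, m v} \<noteq> {}"
    if v: "v \<in> M" and w: "w \<in> S - {v, m v}" "ext M m w \<inter> {v, m v} \<noteq> {}"
      and nofull: "\<And>u. u \<in> M \<Longrightarrow> u \<in> B w \<Longrightarrow> m u \<notin> B w" for v w
  proof -
    have m: "m (m v) = v" "m v \<in> M" using P v by auto
    have "v \<in> B w \<and> m v \<notin> B w \<or> m v \<in> B w \<and> v \<notin> B w" using w m by (auto simp: ext_def)
    then show ?thesis
    proof
      assume "v \<in> B w \<and> m v \<notin> B w"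
      then show ?thesis using sib[of v w] v w nofull by (auto simp: ext_def)
    next
      assume "m v \<in> B w \<and> v \<notin> B w"
      then show ?thesis using sib[of "m v" w] m w nofull by (auto simp: ext_def)
    qed
  qed
  \<comment> \<open>The vertices, roots included, whose branch contains a complete pair. If there
    are any, a deepest one supplies the pair to be removed; if there are none, every pair joins the
    two trees.\<close>
  let ?A = "{w \<in> S \<union> R. \<exists>u\<in>M. u \<in> B w \<and> m u \<in> B w}"
  show False
  proof (cases "?A = {}")
    case False
    have "finite ?A" using S by auto
    then obtain w where w: "w \<in> ?A" and max: "\<And>x. x \<in> ?A \<Longrightarrow> dep x \<le> dep w"
      using finite_has_max_nat[of ?A dep] False by blast
    then obtain v where v: "v \<in> M" "v \<in> B w" "m v \<in> B w" by auto
    have wV: "w \<in> V" using w S by auto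
    have m: "m (m v) = v" "m v \<in> M" using P v by auto
    \<comment> \<open>A branch separating the pair meets the branch of \<open>w\<close> without
      containing \<open>w\<close>, hence lies strictly inside it. Its top is deeper than
      \<open>w\<close>, so by maximality it contains no complete pair.\<close>
    have key: "ext M m x - {v, m v} \<noteq> {}" if x: "x \<in> S - {v, m v}" "ext M m x \<inter> {v, m v} \<noteq> {}" for x
    proof (rule rest[OF v(1) x])
      fix u assume u: "u \<in> M" "u \<in> B x"
      have xV: "x \<in> V" using x S by auto
      have sep: "(v \<in> B x \<or> m v \<in> B x) \<and> \<not> (v \<in> B x \<and> m v \<in> B x)" using x m by (auto simp: ext_def)
      then have "x \<in> B w \<or> w \<in> B x"
        using B_comparable[of v x w] B_comparable[of "m v" x w] v m MV xV wV by blast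
      moreover have "w \<notin> B x" using sep B_trans[of v w x] B_trans[of "m v" w x] v m MV xV wV by blast
      ultimately have xw: "x \<in> B w" by auto
      have "x \<noteq> w" using \<open>w \<notin> B x\<close> B_self[OF wV] by auto
      then have "dep w < dep x" using B_dep[of x w] xw xV wV by auto
      then show "m u \<notin> B x" using max[of x] u x by auto
    qed
    have "\<theta> = 0 \<or> (\<exists>u\<in>ext M m r1 - {v, m v}. \<theta> \<le> b u)"
    proof (cases "\<theta> = 0")
      case False
      then obtain u where u: "u \<in> ext M m r1" "\<theta> \<le> b u" using cr by (auto simp: cross_def)
      \<comment> \<open>Both ends of the chosen pair lie in one tree, so the edge between the trees
        is a different one and survives.\<close>
      have "u \<noteq> v \<and> u \<noteq> m v"
      proof -
        have r: "r1 \<in> V" by auto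
        have "v \<in> B r1 \<longleftrightarrow> w \<in> B r1" "m v \<in> B r1 \<longleftrightarrow> w \<in> B r1"
          using B_trans[of _ w r1] B_trans[of _ w r2] B_one_root B_some_root[OF wV] v m MV wV
          by blast+
        then show ?thesis using u m by (auto simp: ext_def)
      qed
      then show ?thesis using u by auto
    qed simp
    then show False using n3[OF v(1) key] by blast
  next
    case True
    then have nofull: "u \<in> M \<Longrightarrow> w \<in> S \<union> R \<Longrightarrow> u \<in> B w \<Longrightarrow> m u \<notin> B w" for u w by auto
    have key: "ext M m x - {v, m v} \<noteq> {}" if "v \<in> M" "x \<in> S - {v, m v}" "ext M m x \<inter> {v, m v} \<noteq> {}" for x v
      using rest[OF that] nofull that by blast
    have n3': "\<not> (\<theta> = 0 \<or> (\<exists>u\<in>ext M m r1 - {v, m v}. \<theta> \<le> b u))" if "v \<in> M" for v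
      using n3[OF that key[OF that]] .
    obtain l where "leafS S l" using leaf_below[OF S(2,1)] ne by blast
    then have "l \<in> M" using n1 by auto
    then have "\<theta> \<noteq> 0" using n3' by blast
    then obtain u where u: "u \<in> ext M m r1" "\<theta> \<le> b u" using cr by (auto simp: cross_def)
    then have uM: "u \<in> M" "u \<in> B r1" "m u \<notin> B r1" by (auto simp: ext_def)
    have m: "m (m u) = u" "m u \<in> M" "m u \<noteq> u" using P uM by auto
    \<comment> \<open>Removing any other pair would leave the edge \<open>{u, m u}\<close> with its
      exponent at least \<open>\<theta>\<close>, contrary to \<open>n3'\<close>. So only one pair is
      left.\<close>
    have Meq: "x = u \<or> x = m u" if "x \<in> M" for x
    proof (rule ccontr)
      assume x: "\<not> (x = u \<or> x = m u)"
      then have "u \<noteq> x" "u \<noteq> m x" using P(5)[OF that] m by auto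
      then show False using n3'[OF that] u by auto
    qed
    \<comment> \<open>A contracted leaf below a vertex of \<open>S\<close> would have a sibling, and
      the leaf under that sibling would have to be its partner. Then a branch would contain a
      complete pair.\<close>
    have par_root: "par x \<in> R" if x: "x \<in> M" for x
    proof (rule ccontr)
      assume "par x \<notin> R"
      then have pS: "par x \<in> S" using S(3)[of x] MV[OF x] by auto
      obtain d where d: "d \<in> S" "par d = par x" "d \<noteq> x" using n2[OF x pS] by auto
      obtain y where y: "leafS S y" "y \<in> B d" using leaf_below[OF S(2,1) d(1)] by auto
      have yM: "y \<in> M" using n1 y by auto
      have V: "d \<in> V" "par x \<in> V" "d \<in> V0" "x \<in> V0" using d pS S MV[OF x] by auto
      have "d \<in> B (par x)" using B_par[of d "par x"] V d dep_par[of d] B_self[of "par x"] by force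
      then have yp: "y \<in> B (par x)" using B_trans[of y d "par x"] y yM MV V by blast
      have xp: "x \<in> B (par x)" using B_par[of x "par x"] V dep_par[of x] B_self[of "par x"] by force
      have "y \<noteq> x"
      proof
        assume "y = x"
        then have "par x \<in> B d" using y B_par[of x d] V d by auto
        then have "par x = d \<or> dep d < dep (par x)" using B_dep[of "par x" d] V by auto
        then show False using dep_par[of d] d S by auto
      qed
      then have "y = m x" using Meq[OF x] Meq[OF yM] m by auto
      then show False using nofull[OF x, of "par x"] xp yp pS by auto
    qed
    have pu: "par u = r1"
      using par_root[OF uM(1)] B_par[of u r1] B_root[of "par u" r1] MV[OF uM(1)] uM r1_V0 by auto
    have mu2: "m u \<in> B r2" using B_some_root[of "m u"] uM MV[OF m(2)] by auto
    have pmu: "par (m u) = r2"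
      using par_root[OF m(2)] B_par[of "m u" r2] B_root[of "par (m u)" r2] MV[OF m(2)] mu2 r2_V0 by auto
    have "S = {u, m u}"
    proof
      show "{u, m u} \<subseteq> S" using MV uM m by auto
      show "S \<subseteq> {u, m u}"
      proof
        fix s assume s: "s \<in> S"
        obtain y where y: "leafS S y" "y \<in> B s" using leaf_below[OF S(2,1) s] by auto
        have yM: "y \<in> M" using n1 y by auto
        have "y = s"
        proof (rule ccontr)
          assume "y \<noteq> s"
          then have "par y \<in> B s" using B_par[of y s] y s S MV[OF yM] by auto
          then show False using root_notin_B[of s "par y"] par_root[OF yM] s S by auto
        qed
        then show "s \<in> {u, m u}" using Meq[OF yM] by auto
      qed
    qed
    then show False using n4[OF uM(1)] pu pmu u(2) by auto
  qed
qed

end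

section \<open>The measure of one vertex and the vertex estimate in terms of positions\<close>

lemma finite_measure_vmeas: "finite_measure (vmeas d :: (real \<times> (real ^ 'n::finite)) measure)"
proof -
  have "cube \<subseteq> cbox 0 (1 :: real ^ 'n)"
    by (auto simp: cube_def mem_box_cart less_imp_le)
  then have "emeasure lborel (cube :: (real ^ 'n) set) \<le> emeasure lborel (cbox 0 (1 :: real ^ 'n))"
    by (intro emeasure_mono) auto
  then have fin: "emeasure lborel (cube :: (real ^ 'n) set) < \<infinity>"
    using emeasure_lborel_cbox_finite[of "0 :: real ^ 'n" 1] by (rule le_less_trans)
  show ?thesis
  proof (cases d)
    case True
    have "finite_measure (restrict_space lborel (cube :: (real ^ 'n) set))"
      using fin by (intro finite_measureI) (simp add: space_restrict_space emeasure_restrict_space)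
    moreover have "(\<lambda>x. (0::real, x :: real ^ 'n)) \<in> restrict_space lborel cube \<rightarrow>\<^sub>M borel"
      by (intro measurable_restrict_space1) measurable
    ultimately show ?thesis
      using True by (simp add: vmeas_def finite_measure.finite_measure_distr)
  next
    case False
    have m: "({0<..<1} \<times> cube :: (real \<times> (real ^ 'n)) set) \<in> sets (lborel \<Otimes>\<^sub>M lborel)"
      by auto
    have "emeasure lborel ({0<..<1} \<times> cube :: (real \<times> (real ^ 'n)) set)
        = emeasure lborel {0<..<1::real} * emeasure lborel (cube :: (real ^ 'n) set)"
      unfolding lborel_prod[symmetric] by (rule lborel.emeasure_pair_measure_Times) auto
    also have "\<dots> < \<infinity>" using fin by (simp add: ennreal_mult_less_top)
    finally show ?thesis
      using False m unfolding lborel_prod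
      by (intro finite_measureI) (simp add: vmeas_def space_restrict_space emeasure_restrict_space)
  qed
qed

lemma sigma_finite_vmeas: "sigma_finite_measure (vmeas d)"
  using finite_measure_vmeas by (rule finite_measure.axioms)

lemma fst_vmeas_False: "p \<in> space (vmeas False) \<Longrightarrow> 0 < fst p \<and> fst p < 1"
  by (auto simp: vmeas_def space_restrict_space)

lemma borel_measurable_kb2:
  assumes "(\<lambda>x. fst (f x)) \<in> borel_measurable M" "(\<lambda>x. fst (snd (f x))) \<in> borel_measurable M"
    "(\<lambda>x. snd (snd (f x))) \<in> borel_measurable M" "(\<lambda>x. fst (g x)) \<in> borel_measurable M"
    "(\<lambda>x. snd (g x)) \<in> borel_measurable M"
  shows "(\<lambda>x. kb2 c (f x) (g x)) \<in> borel_measurable M"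
  unfolding kb2_def using assms
  by (intro borel_measurable_add measurable_compose[OF _ measurable_ennreal] borel_measurable_kb borel_measurable_diff)

text \<open>A position consists of the two times at which the kernels below a vertex are evaluated, and
  a point.\<close>

definition adm :: "real \<times> real \<times> (real ^ 'n::finite) \<Rightarrow> bool" where
  "adm q \<longleftrightarrow> 0 < fst q \<and> fst q / 2 \<le> fst (snd q) \<and> fst (snd q) \<le> fst q"

lemma nn_integral_vertex_adm_le:
  fixes a \<theta> \<beta> c :: real
  assumes "0 \<le> \<theta>" "\<theta> \<le> a" "a < CARD('n::finite)"
    and "if d then \<beta> = -1 else \<beta> > -1 \<and> c - (a - \<theta>) / 2 > -1"
  shows "\<exists>C>0. \<forall>q (z :: real ^ 'n). adm q \<longrightarrow>
    (\<integral>\<^sup>+ p. tw d \<beta> (fst p) * kb2 c q p * sing a (tnorm (snd p - z)) \<partial>vmeas d)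
      \<le> ennreal C * ennreal (fst q powr (1 + c + \<beta> - (a - \<theta>) / 2)) * sing \<theta> (tnorm (snd (snd q) - z))"
proof -
  obtain C where C: "C > 0" and le: "\<And>\<tau> \<sigma> y (z :: real ^ 'n). 0 < \<tau> \<Longrightarrow> \<tau> / 2 \<le> \<sigma> \<Longrightarrow> \<sigma> \<le> \<tau> \<Longrightarrow>
    (\<integral>\<^sup>+ p. tw d \<beta> (fst p) * kb2 c (\<tau>, \<sigma>, y) p * sing a (tnorm (snd p - z)) \<partial>vmeas d)
      \<le> ennreal (C * \<tau> powr (\<beta> + c + 1 - (a - \<theta>) / 2)) * sing \<theta> (tnorm (y - z))"
    using nn_integral_vertex_le[OF assms] by blast
  have e: "\<beta> + c + 1 - (a - \<theta>) / 2 = 1 + c + \<beta> - (a - \<theta>) / 2" by simp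
  show ?thesis
  proof (intro exI[of _ C] conjI allI impI C)
    fix q :: "real \<times> real \<times> (real ^ 'n)" and z :: "real ^ 'n" assume q: "adm q"
    show "(\<integral>\<^sup>+ p. tw d \<beta> (fst p) * kb2 c q p * sing a (tnorm (snd p - z)) \<partial>vmeas d)
      \<le> ennreal C * ennreal (fst q powr (1 + c + \<beta> - (a - \<theta>) / 2)) * sing \<theta> (tnorm (snd (snd q) - z))"
      using le[of "fst q" "fst (snd q)" "snd (snd q)" z] q C unfolding e
      by (simp add: adm_def ennreal_mult')
  qed
qed

section \<open>The integrand attached to a state and the estimates for single peeling steps\<close>

context rooted_forest
begin

text \<open>Only the roots can have two different times. Every other vertex lists its own time
  twice, which lets the same kernel stand on all edges.\<close>

definition pos :: "real \<times> real \<times> (real ^ 'n) \<Rightarrow> real \<times> real \<times> (real ^ 'n) \<Rightarrow> ('v \<Rightarrow> real \<times> (real ^ 'n)) \<Rightarrow> 'v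
    \<Rightarrow> real \<times> real \<times> (real ^ 'n)" where
  "pos q1 q2 X w = (if w = r1 then q1 else if w = r2 then q2 else (fst (X w), fst (X w), snd (X w)))"

abbreviation vm :: "'v \<Rightarrow> (real \<times> (real ^ 'n::finite)) measure" where
  "vm u \<equiv> vmeas (u \<in> D)"

text \<open>The roots are included, so that the powers of their times produced by the peeling can be
  recorded in the weights as well.\<close>

definition PA where
  "PA q1 q2 S \<beta> X = (\<Prod>u\<in>S \<union> R. tw (u \<in> D) (\<beta> u) (fst (pos q1 q2 X u)))"

definition PK where
  "PK q1 q2 S X = (\<Prod>u\<in>S. kb2 (c u) (pos q1 q2 X (par u)) (X u))"

text \<open>Every pair contributes twice to this product, hence the exponent \<open>b u / 2\<close>.\<close>

definition PH :: "'v set \<Rightarrow> ('v \<Rightarrow> 'v) \<Rightarrow> ('v \<Rightarrow> real) \<Rightarrow> ('v \<Rightarrow> real \<times> (real ^ 'n::finite)) \<Rightarrow> ennreal" where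
  "PH M m b X = (\<Prod>u\<in>M. sing (b u / 2) (tnorm (snd (X u) - snd (X (m u)))))"

definition Phi where
  "Phi q1 q2 S M m b \<beta> X = PA q1 q2 S \<beta> X * PK q1 q2 S X * PH M m b X"

lemma pos_upd: "u \<noteq> v \<Longrightarrow> pos q1 q2 (X(v := y)) u = pos q1 q2 X u"
  by (simp add: pos_def)

lemma pos_V0: "v \<in> V0 \<Longrightarrow> pos q1 q2 X v = (fst (X v), fst (X v), snd (X v))"
  using r1_V0 r2_V0 by (auto simp: pos_def)

lemma adm_pos:
  assumes "X \<in> space (PiM S vm)" "adm q1" "adm q2" "p \<in> S \<union> R" "p \<notin> D" "S \<subseteq> V0"
  shows "adm (pos q1 q2 X p)"
proof (cases "p \<in> S")
  case True
  have "X p \<in> space (vm p)" using assms(1) True by (auto simp: space_PiM)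
  then have "0 < fst (X p)" using assms(5) fst_vmeas_False[of "X p"] by simp
  moreover have "p \<in> V0" using True assms by auto
  ultimately show ?thesis by (simp add: pos_V0 adm_def)
next
  case False
  then show ?thesis using assms by (auto simp: pos_def)
qed

lemma borel_measurable_PiM_comp:
  assumes "u \<in> S" "f \<in> borel_measurable borel"
  shows "(\<lambda>X. f (X u)) \<in> borel_measurable (PiM S vm)"
  by (rule measurable_compose[OF measurable_component_singleton[OF assms(1)] measurable_vmeas[OF assms(2)]])

lemma borel_measurable_pos:
  assumes "w \<in> S \<union> R"
  shows "(\<lambda>X. fst (pos q1 q2 X w)) \<in> borel_measurable (PiM S vm)"
    "(\<lambda>X. fst (snd (pos q1 q2 X w))) \<in> borel_measurable (PiM S vm)"
    "(\<lambda>X. snd (snd (pos q1 q2 X w))) \<in> borel_measurable (PiM S vm)"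
proof -
  consider "w = r1" | "w = r2" "w \<noteq> r1" | "w \<in> S" "w \<noteq> r1" "w \<noteq> r2" using assms by blast
  then have "(\<lambda>X. fst (pos q1 q2 X w)) \<in> borel_measurable (PiM S vm) \<and>
    (\<lambda>X. fst (snd (pos q1 q2 X w))) \<in> borel_measurable (PiM S vm) \<and>
    (\<lambda>X. snd (snd (pos q1 q2 X w))) \<in> borel_measurable (PiM S vm)"
    using borel_measurable_PiM_comp[of w S fst] borel_measurable_PiM_comp[of w S snd]
    by cases (simp_all add: pos_def)
  then show "(\<lambda>X. fst (pos q1 q2 X w)) \<in> borel_measurable (PiM S vm)"
    "(\<lambda>X. fst (snd (pos q1 q2 X w))) \<in> borel_measurable (PiM S vm)"
    "(\<lambda>X. snd (snd (pos q1 q2 X w))) \<in> borel_measurable (PiM S vm)"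
    by auto
qed

lemma borel_measurable_Phi:
  assumes "M \<subseteq> S" "\<And>u. u \<in> M \<Longrightarrow> m u \<in> M" "\<And>u. u \<in> S \<Longrightarrow> par u \<in> S \<union> R"
  shows "Phi q1 q2 S M m b \<beta> \<in> borel_measurable (PiM S vm)"
proof -
  have [measurable]: "(\<lambda>X. PA q1 q2 S \<beta> X) \<in> borel_measurable (PiM S vm)"
    unfolding PA_def by (intro borel_measurable_prod_ennreal borel_measurable_tw borel_measurable_pos)
  have [measurable]: "(\<lambda>X. PK q1 q2 S X) \<in> borel_measurable (PiM S vm)"
    unfolding PK_def using assms(3)
    by (intro borel_measurable_prod_ennreal borel_measurable_kb2 borel_measurable_pos borel_measurable_PiM_comp
        borel_measurable_fst_borel borel_measurable_snd_borel)
  have [measurable]: "(\<lambda>X. PH M m b X) \<in> borel_measurable (PiM S vm)"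
  proof -
    have "(\<lambda>X. snd (X u) - snd (X (m u))) \<in> borel_measurable (PiM S vm)" if "u \<in> M" for u
      using assms(1,2) that
      by (intro borel_measurable_diff borel_measurable_PiM_comp borel_measurable_snd_borel) auto
    then show ?thesis unfolding PH_def
      by (intro borel_measurable_prod_ennreal measurable_compose[OF _ borel_measurable_sing]
          measurable_compose[OF _ borel_measurable_tnorm])
  qed
  show ?thesis unfolding Phi_def[abs_def] by measurable
qed

text \<open>Absorbs the time power left by an integration into the weight of the parent. The factor
  of a Dirac vertex is constantly 1 and could not take it up, hence
  \<open>p \<notin> D\<close>.\<close>

lemma PA_merge:
  assumes "finite S" "p \<in> S \<union> R" "p \<notin> D" "0 < fst (pos q1 q2 X p)"
  shows "PA q1 q2 S \<beta> X * ennreal (fst (pos q1 q2 X p) powr e) = PA q1 q2 S (\<beta>(p := \<beta> p + e)) X"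
proof -
  let ?f = "\<lambda>\<beta> u. tw (u \<in> D) (\<beta> u) (fst (pos q1 q2 X u))"
  have fin: "finite (S \<union> R)" using assms by simp
  have *: "PA q1 q2 S \<beta> X = ?f \<beta> p * (\<Prod>u\<in>S \<union> R - {p}. ?f \<beta> u)" for \<beta>
    unfolding PA_def by (rule prod.remove[OF fin assms(2)])
  have "(\<Prod>u\<in>S \<union> R - {p}. ?f (\<beta>(p := \<beta> p + e)) u) = (\<Prod>u\<in>S \<union> R - {p}. ?f \<beta> u)"
    by (intro prod.cong) auto
  moreover have "?f (\<beta>(p := \<beta> p + e)) p = ?f \<beta> p * ennreal (fst (pos q1 q2 X p) powr e)"
    using assms by (simp add: tw_def powr_add ennreal_mult')
  ultimately show ?thesis by (simp add: * mult_ac)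
qed

text \<open>No kernel has a leaf as its upper endpoint, so the variable of \<open>v\<close> occurs
  only in its own weight and in the kernel on the edge above it.\<close>

lemma PA_PK_upd:
  assumes "finite S" "leafS S v" "S \<subseteq> V0"
  shows "PA q1 q2 S \<beta> (X(v := y)) * PK q1 q2 S (X(v := y))
    = PA q1 q2 (S - {v}) \<beta> X * PK q1 q2 (S - {v}) X
      * (tw (v \<in> D) (\<beta> v) (fst y) * kb2 (c v) (pos q1 q2 X (par v)) y)"
proof -
  have v: "v \<in> S" "v \<in> V0" "v \<notin> R" using assms r1_V0 r2_V0 by (auto simp: leafS_def)
  have p: "par u \<noteq> v" if "u \<in> S" for u using assms(2) that by (auto simp: leafS_def)
  have R: "S \<union> R - {v} = (S - {v}) \<union> R" using v by auto
  have "PA q1 q2 S \<beta> (X(v := y)) = tw (v \<in> D) (\<beta> v) (fst y) * (\<Prod>u\<in>S \<union> R - {v}. tw (u \<in> D) (\<beta> u) (fst (pos q1 q2 (X(v := y)) u)))"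
    unfolding PA_def using assms(1) v by (subst prod.remove[of _ v]) (auto simp: pos_V0)
  also have "(\<Prod>u\<in>S \<union> R - {v}. tw (u \<in> D) (\<beta> u) (fst (pos q1 q2 (X(v := y)) u))) = PA q1 q2 (S - {v}) \<beta> X"
    unfolding R PA_def using v by (intro prod.cong refl) (auto simp: pos_upd)
  finally have 1: "PA q1 q2 S \<beta> (X(v := y)) = tw (v \<in> D) (\<beta> v) (fst y) * PA q1 q2 (S - {v}) \<beta> X" .
  have "PK q1 q2 S (X(v := y)) = kb2 (c v) (pos q1 q2 X (par v)) y
      * (\<Prod>u\<in>S - {v}. kb2 (c u) (pos q1 q2 (X(v := y)) (par u)) ((X(v := y)) u))"
    unfolding PK_def using assms(1) v p by (subst prod.remove[of _ v]) (auto simp: pos_upd)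
  also have "(\<Prod>u\<in>S - {v}. kb2 (c u) (pos q1 q2 (X(v := y)) (par u)) ((X(v := y)) u)) = PK q1 q2 (S - {v}) X"
    unfolding PK_def using p by (intro prod.cong refl) (auto simp: pos_upd)
  finally have 2: "PK q1 q2 S (X(v := y)) = kb2 (c v) (pos q1 q2 X (par v)) y * PK q1 q2 (S - {v}) X" .
  show ?thesis unfolding 1 2 by (simp add: mult_ac)
qed

lemma PH_upd: "v \<notin> M \<Longrightarrow> (\<And>u. u \<in> M \<Longrightarrow> m u \<noteq> v) \<Longrightarrow> PH M m b (X(v := y)) = PH M m b X"
  unfolding PH_def by (intro prod.cong) auto

lemma PH_cong: "(\<And>u. u \<in> M \<Longrightarrow> m u = m' u) \<Longrightarrow> (\<And>u. u \<in> M \<Longrightarrow> b u = b' u) \<Longrightarrow> PH M m b X = PH M m' b' X"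
  unfolding PH_def by (intro prod.cong) auto

lemma PH_pair:
  assumes "finite M" "v \<in> M" "m v \<in> M" "m (m v) = v" "m v \<noteq> v" "b (m v) = b v" "0 \<le> b v"
  shows "PH M m b X = sing (b v) (tnorm (snd (X v) - snd (X (m v)))) * PH (M - {v, m v}) m b X"
proof -
  let ?f = "\<lambda>u. sing (b u / 2) (tnorm (snd (X u) - snd (X (m u))))"
  have "PH M m b X = ?f v * (\<Prod>u\<in>M - {v}. ?f u)"
    unfolding PH_def using assms by (intro prod.remove) auto
  also have "(\<Prod>u\<in>M - {v}. ?f u) = ?f (m v) * (\<Prod>u\<in>M - {v} - {m v}. ?f u)"
    using assms by (intro prod.remove) auto
  also have "M - {v} - {m v} = M - {v, m v}" by auto
  also have "?f v * (?f (m v) * (\<Prod>u\<in>M - {v, m v}. ?f u)) = (?f v * ?f (m v)) * PH (M - {v, m v}) m b X"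
    by (simp add: PH_def mult.assoc)
  also have "?f v * ?f (m v) = sing (b v) (tnorm (snd (X v) - snd (X (m v))))"
    using assms sing_mult[of "b v / 2" "b v / 2"] tnorm_commute[of "snd (X (m v))" "snd (X v)"] by simp
  finally show ?thesis .
qed

lemma leaf_ext:
  assumes "state N S M m b \<beta>" "v \<in> M"
  shows "v \<in> ext M m v"
proof -
  note S = stateD(1,3)[OF assms(1)] and P = pairingD[OF stateD(4)[OF assms(1)]]
  have v: "v \<in> S" "m v \<in> S" "leafS S v" "m v \<noteq> v" using P(1) P(2-4)[OF assms(2)] assms by auto
  show ?thesis using leaf_branch[OF S v(3)] v assms by (auto simp: ext_def)
qed

lemma borel_measurable_vertex:
  "(\<lambda>y. tw d \<beta> (fst y) * kb2 e q y * sing a (tnorm (snd y - z))) \<in> borel_measurable (vmeas d)"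
  by (rule measurable_vmeas) measurable

text \<open>The vertex estimate with \<open>a = \<theta> = 0\<close>: there is no singularity, and
  only a power of the parent's time remains.\<close>

lemma integral_free_leaf:
  assumes st: "state N S M m b \<beta>" and v: "leafS S v" "v \<notin> M"
  defines "\<beta>' \<equiv> \<beta>(par v := \<beta> (par v) + (1 + c v + \<beta> v))"
  shows "\<exists>C>0. \<forall>q1 q2 (X :: 'v \<Rightarrow> real \<times> (real ^ 'n::finite)). adm q1 \<longrightarrow> adm q2 \<longrightarrow> X \<in> space (PiM (S - {v}) vm) \<longrightarrow>
    (\<integral>\<^sup>+ y. Phi q1 q2 S M m b \<beta> (X(v := y)) \<partial>vm v) \<le> ennreal C * Phi q1 q2 (S - {v}) M m b \<beta>' X"
proof -
  note S = stateD(1,2,3)[OF st] and P = pairingD[OF stateD(4)[OF st]]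
  have vS: "v \<in> S" using v by (simp add: leafS_def)
  have pD: "par v \<notin> D" using stateD(5)[OF st, of "par v"] vS S(3)[of v] D_V0 r1_V0 r2_V0 by (auto simp: leafS_def)
  have pS: "par v \<in> (S - {v}) \<union> R" using S(3)[of v] vS v by (auto simp: leafS_def)
  have cond: "if v \<in> D then \<beta> v = -1 else \<beta> v > -1 \<and> c v - (0 - 0) / 2 > -1"
    using stateD(6,7)[OF st] leaf_beta[OF st v(1)] vS by auto
  obtain C where C: "C > 0" and le: "\<And>q (z :: real ^ 'n). adm q \<Longrightarrow>
    (\<integral>\<^sup>+ p. tw (v \<in> D) (\<beta> v) (fst p) * kb2 (c v) q p * sing 0 (tnorm (snd p - z)) \<partial>vm v)
      \<le> ennreal C * ennreal (fst q powr (1 + c v + \<beta> v - (0 - 0) / 2)) * sing 0 (tnorm (snd (snd q) - z))"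
    using nn_integral_vertex_adm_le[where 'n = 'n, OF _ _ _ cond] by auto
  show ?thesis
  proof (intro exI[of _ C] conjI allI impI C)
    fix q1 q2 :: "real \<times> real \<times> (real ^ 'n)" and X :: "'v \<Rightarrow> real \<times> (real ^ 'n)"
    assume q: "adm q1" "adm q2" and X: "X \<in> space (PiM (S - {v}) vm)"
    let ?q = "pos q1 q2 X (par v)"
    have aq: "adm ?q" using adm_pos[OF X q pS pD] S by auto
    have H: "PH M m b (X(v := y)) = PH M m b X" for y
      using P(3) v(2) by (intro PH_upd) metis+
    let ?K = "PA q1 q2 (S - {v}) \<beta> X * PK q1 q2 (S - {v}) X * PH M m b X"
    have "(\<integral>\<^sup>+ y. Phi q1 q2 S M m b \<beta> (X(v := y)) \<partial>vm v)
      = (\<integral>\<^sup>+ y. ?K * (tw (v \<in> D) (\<beta> v) (fst y) * kb2 (c v) ?q y * sing 0 (tnorm (snd y - 0))) \<partial>vm v)"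
      unfolding Phi_def PA_PK_upd[OF S(2) v(1) S(1)] H by (intro nn_integral_cong) (simp add: mult_ac)
    also have "\<dots> = ?K * (\<integral>\<^sup>+ y. tw (v \<in> D) (\<beta> v) (fst y) * kb2 (c v) ?q y * sing 0 (tnorm (snd y - 0)) \<partial>vm v)"
      by (rule nn_integral_cmult[OF borel_measurable_vertex])
    also have "\<dots> \<le> ?K * (ennreal C * ennreal (fst ?q powr (1 + c v + \<beta> v - (0 - 0) / 2)) * sing 0 (tnorm (snd (snd ?q) - 0)))"
      by (intro mult_left_mono le aq) auto
    also have "\<dots> = ennreal C * (PA q1 q2 (S - {v}) \<beta> X * ennreal (fst ?q powr (1 + c v + \<beta> v))) * PK q1 q2 (S - {v}) X * PH M m b X"
      by (simp add: mult_ac)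
    also have "PA q1 q2 (S - {v}) \<beta> X * ennreal (fst ?q powr (1 + c v + \<beta> v)) = PA q1 q2 (S - {v}) \<beta>' X"
      unfolding \<beta>'_def using aq S pS pD by (intro PA_merge) (auto simp: adm_def)
    finally show "(\<integral>\<^sup>+ y. Phi q1 q2 S M m b \<beta> (X(v := y)) \<partial>vm v) \<le> ennreal C * Phi q1 q2 (S - {v}) M m b \<beta>' X"
      unfolding Phi_def by (simp only: mult.assoc)
  qed
qed

text \<open>The vertex estimate with \<open>\<theta> = a\<close>: the singularity passes to the
  position of the parent, and the tree edge is charged nothing.\<close>

lemma integral_move_up:
  assumes st: "state CARD('n::finite) S M m b \<beta>" and v: "v \<in> M" and p: "par v \<in> S"
  defines "\<beta>' \<equiv> \<beta>(par v := \<beta> (par v) + (1 + c v + \<beta> v))"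
    and "b' \<equiv> b(v := 0, par v := b v)" and "m' \<equiv> m(par v := m v, m v := par v)"
    and "M' \<equiv> insert (par v) (M - {v})"
  shows "\<exists>C>0. \<forall>q1 q2 (X :: 'v \<Rightarrow> real \<times> (real ^ 'n)). adm q1 \<longrightarrow> adm q2 \<longrightarrow> X \<in> space (PiM (S - {v}) vm) \<longrightarrow>
    (\<integral>\<^sup>+ y. Phi q1 q2 S M m b \<beta> (X(v := y)) \<partial>vm v) \<le> ennreal C * Phi q1 q2 (S - {v}) M' m' b' \<beta>' X"
proof -
  note S = stateD(1,2,3)[OF st] and P = pairingD[OF stateD(4)[OF st]]
  define q where "q = m v"
  have vS: "v \<in> S" and vleaf: "leafS S v" using P v by auto
  have q: "q \<in> M" "q \<noteq> v" "m q = v" "b q = b v" using P(3-6)[OF v] by (auto simp: q_def)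
  have pM: "par v \<notin> M" using P(2)[of "par v"] vS by (auto simp: leafS_def)
  have pv: "par v \<noteq> v" using dep_par[of v] vS S by auto
  have pq: "par v \<noteq> q" using q pM by auto
  have fM: "finite M" using P(1) S finite_subset by auto
  have pD: "par v \<notin> D" using stateD(5)[OF st, of "par v"] vS p by (auto simp: leafS_def)
  have pS: "par v \<in> (S - {v}) \<union> R" using p pv by auto
  let ?M0 = "M - {v, q}"
  have M0: "PH ?M0 m' b' X = PH ?M0 m b X" for X :: "'v \<Rightarrow> real \<times> (real ^ 'n)"
    using pM by (intro PH_cong) (auto simp: m'_def b'_def q_def)
  have H1: "PH M m b (X(v := y)) = sing (b v) (tnorm (snd y - snd (X q))) * PH ?M0 m b X" for X :: "'v \<Rightarrow> real \<times> (real ^ 'n)" and y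
  proof -
    have "PH ?M0 m b (X(v := y)) = PH ?M0 m b X"
    proof (rule PH_upd)
      show "m u \<noteq> v" if "u \<in> ?M0" for u using that P(5)[of u] by (auto simp: q_def)
    qed simp
    then show ?thesis using PH_pair[OF fM v, of m b "X(v := y)"] P(10)[of v] q by (simp add: q_def[symmetric])
  qed
  have H2: "PH M' m' b' X = sing (b v) (tnorm (snd (X (par v)) - snd (X q))) * PH ?M0 m b X" for X :: "'v \<Rightarrow> real \<times> (real ^ 'n)"
  proof -
    have e: "m' (par v) = q" "m' q = par v" "b' (par v) = b v" "b' q = b v"
      using pq q pv by (auto simp: m'_def b'_def q_def[symmetric])
    have "PH M' m' b' X = sing (b' (par v)) (tnorm (snd (X (par v)) - snd (X (m' (par v))))) * PH (M' - {par v, m' (par v)}) m' b' X"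
      by (rule PH_pair) (use e q fM pq P(10)[of v] in \<open>auto simp: M'_def\<close>)
    also have "M' - {par v, m' (par v)} = ?M0" using pM by (auto simp: M'_def e)
    finally show ?thesis by (simp add: e M0)
  qed
  have cond: "if v \<in> D then \<beta> v = -1 else \<beta> v > -1 \<and> c v - (b v - b v) / 2 > -1"
    using stateD(6,7)[OF st] leaf_beta[OF st vleaf] vS by auto
  obtain C where C: "C > 0" and le: "\<And>q (z :: real ^ 'n). adm q \<Longrightarrow>
    (\<integral>\<^sup>+ p. tw (v \<in> D) (\<beta> v) (fst p) * kb2 (c v) q p * sing (b v) (tnorm (snd p - z)) \<partial>vm v)
      \<le> ennreal C * ennreal (fst q powr (1 + c v + \<beta> v - (b v - b v) / 2)) * sing (b v) (tnorm (snd (snd q) - z))"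
    using nn_integral_vertex_adm_le[where 'n = 'n, OF _ _ _ cond] P(8)[OF v] P(10)[of v] by auto
  show ?thesis
  proof (intro exI[of _ C] conjI allI impI C)
    fix q1 q2 :: "real \<times> real \<times> (real ^ 'n)" and X :: "'v \<Rightarrow> real \<times> (real ^ 'n)"
    assume qa: "adm q1" "adm q2" and X: "X \<in> space (PiM (S - {v}) vm)"
    let ?q = "pos q1 q2 X (par v)"
    have aq: "adm ?q" using adm_pos[OF X qa pS pD] S by auto
    have xq: "snd (snd ?q) = snd (X (par v))" using p S by (simp add: pos_V0 subset_iff)
    let ?K = "PA q1 q2 (S - {v}) \<beta> X * PK q1 q2 (S - {v}) X * PH ?M0 m b X"
    have "(\<integral>\<^sup>+ y. Phi q1 q2 S M m b \<beta> (X(v := y)) \<partial>vm v)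
      = (\<integral>\<^sup>+ y. ?K * (tw (v \<in> D) (\<beta> v) (fst y) * kb2 (c v) ?q y * sing (b v) (tnorm (snd y - snd (X q)))) \<partial>vm v)"
      unfolding Phi_def PA_PK_upd[OF S(2) vleaf S(1)] H1 by (intro nn_integral_cong) (simp add: mult_ac)
    also have "\<dots> = ?K * (\<integral>\<^sup>+ y. tw (v \<in> D) (\<beta> v) (fst y) * kb2 (c v) ?q y * sing (b v) (tnorm (snd y - snd (X q))) \<partial>vm v)"
      by (rule nn_integral_cmult[OF borel_measurable_vertex])
    also have "\<dots> \<le> ?K * (ennreal C * ennreal (fst ?q powr (1 + c v + \<beta> v - (b v - b v) / 2)) * sing (b v) (tnorm (snd (snd ?q) - snd (X q))))"
      by (intro mult_left_mono le aq) auto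
    also have "\<dots> = ennreal C * (PA q1 q2 (S - {v}) \<beta> X * ennreal (fst ?q powr (1 + c v + \<beta> v))) * PK q1 q2 (S - {v}) X * PH M' m' b' X"
      unfolding H2 xq by (simp add: mult_ac)
    also have "PA q1 q2 (S - {v}) \<beta> X * ennreal (fst ?q powr (1 + c v + \<beta> v)) = PA q1 q2 (S - {v}) \<beta>' X"
      unfolding \<beta>'_def using aq S pS pD by (intro PA_merge) (auto simp: adm_def)
    finally show "(\<integral>\<^sup>+ y. Phi q1 q2 S M m b \<beta> (X(v := y)) \<partial>vm v) \<le> ennreal C * Phi q1 q2 (S - {v}) M' m' b' \<beta>' X"
      unfolding Phi_def by (simp only: mult.assoc)
  qed
qed

text \<open>The singularity is lowered twice by the same amount, at \<open>v\<close> from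
  \<open>b v\<close> to the midpoint and at its partner from there to \<open>\<theta>\<close>. Each
  tree edge loses \<open>(b v - \<theta>) / 4\<close>, at most the charge that a state permits. A
  target \<open>\<theta> > 0\<close> is wanted only for the last pair, whose two parents are the
  roots.\<close>

lemma integral_drop_pair:
  assumes st: "state CARD('n::finite) S M m b \<beta>" and v: "v \<in> M" and th: "0 \<le> \<theta>" "\<theta> \<le> b v"
  defines "b' \<equiv> b(v := 0, m v := 0)"
    and "\<beta>1 \<equiv> \<beta>(par v := \<beta> (par v) + (1 + c v + \<beta> v - (b v - \<theta>) / 4))"
  defines "\<beta>' \<equiv> \<beta>1(par (m v) := \<beta>1 (par (m v)) + (1 + c (m v) + \<beta> (m v) - (b v - \<theta>) / 4))"
  shows "\<exists>C>0. \<forall>q1 q2 (X :: 'v \<Rightarrow> real \<times> (real ^ 'n)). adm q1 \<longrightarrow> adm q2 \<longrightarrow> X \<in> space (PiM (S - {v} - {m v}) vm) \<longrightarrow>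
    (\<integral>\<^sup>+ y'. (\<integral>\<^sup>+ y. Phi q1 q2 S M m b \<beta> (X(m v := y', v := y)) \<partial>vm v) \<partial>vm (m v))
      \<le> ennreal C * sing \<theta> (tnorm (snd (snd (pos q1 q2 X (par v))) - snd (snd (pos q1 q2 X (par (m v))))))
        * Phi q1 q2 (S - {v} - {m v}) (M - {v, m v}) m b' \<beta>' X"
proof -
  note S = stateD(1,2,3)[OF st] and P = pairingD[OF stateD(4)[OF st]]
  define q where "q = m v"
  \<comment> \<open>The midpoint of \<open>b v\<close> and \<open>\<theta>\<close>, since a drop of
    the exponent by \<open>h\<close> costs the time power \<open>h / 2\<close>.\<close>
  define a where "a = (b v + \<theta>) / 2"
  define ev where "ev = 1 + c v + \<beta> v - (b v - \<theta>) / 4"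
  define eq where "eq = 1 + c q + \<beta> q - (b v - \<theta>) / 4"
  have a: "0 \<le> a" "\<theta> \<le> a" "a \<le> b v" "a < CARD('n)" "(b v - a) / 2 = (b v - \<theta>) / 4" "(a - \<theta>) / 2 = (b v - \<theta>) / 4"
    using th P(8)[OF v] by (auto simp: a_def field_simps)
  have q: "q \<in> M" "q \<noteq> v" "m q = v" "b q = b v" "leafS S q" "q \<in> S" using P v by (auto simp: q_def)
  have vS: "v \<in> S" and vleaf: "leafS S v" using P v by auto
  have qleaf: "leafS (S - {v}) q" using q leafS_remove by auto
  have pv: "par v \<noteq> v" "par q \<noteq> q" "par v \<noteq> q" "par q \<noteq> v" using vleaf q vS by (auto simp: leafS_def)
  have fM: "finite M" using P(1) S finite_subset by auto
  let ?S = "S - {v} - {q}"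
  have pD: "par v \<notin> D" "par q \<notin> D"
    using stateD(5)[OF st, of "par v"] stateD(5)[OF st, of "par q"] vS q S(3)[of v] S(3)[of q] D_V0 r1_V0 r2_V0
    by (auto simp: leafS_def)
  have pS: "par v \<in> ?S \<union> R" "par q \<in> ?S \<union> R" using S(3)[of v] S(3)[of q] vS q pv by auto
  let ?M0 = "M - {v, q}"
  have M0: "PH ?M0 m b' X = PH ?M0 m b X" for X :: "'v \<Rightarrow> real \<times> (real ^ 'n)"
    by (intro PH_cong) (auto simp: b'_def q_def)
  have H1: "PH M m b (X(q := y', v := y)) = sing (b v) (tnorm (snd y - snd y')) * PH ?M0 m b' X"
    for X :: "'v \<Rightarrow> real \<times> (real ^ 'n)" and y y'
  proof -
    have mu: "m u \<noteq> v \<and> m u \<noteq> q" if "u \<in> ?M0" for u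
      using that P(5)[of u] q(3) by (auto simp: q_def)
    have "PH ?M0 m b (X(q := y', v := y)) = PH ?M0 m b (X(q := y'))"
      using mu by (intro PH_upd) auto
    also have "\<dots> = PH ?M0 m b X"
      using mu by (intro PH_upd) auto
    finally show ?thesis
      using PH_pair[OF fM v, of m b "X(q := y', v := y)"] P(10)[of v] q M0[of X] by (simp add: q_def[symmetric])
  qed
  have cv: "if v \<in> D then \<beta> v = -1 else \<beta> v > -1 \<and> c v - (b v - a) / 2 > -1"
    using stateD(6)[OF st, of v] stateD(8)[OF st, of v v] leaf_ext[OF st v] leaf_beta[OF st vleaf] vS th
    unfolding a by (auto simp: field_simps)
  have cq: "if q \<in> D then \<beta> q = -1 else \<beta> q > -1 \<and> c q - (a - \<theta>) / 2 > -1"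
    using stateD(6)[OF st, of q] stateD(8)[OF st, of q q] leaf_ext[OF st q(1)] leaf_beta[OF st q(5)] q th
    unfolding a by (auto simp: field_simps)
  obtain C1 where C1: "C1 > 0" and le1: "\<And>q (z :: real ^ 'n). adm q \<Longrightarrow>
    (\<integral>\<^sup>+ p. tw (v \<in> D) (\<beta> v) (fst p) * kb2 (c v) q p * sing (b v) (tnorm (snd p - z)) \<partial>vm v)
      \<le> ennreal C1 * ennreal (fst q powr ev) * sing a (tnorm (snd (snd q) - z))"
    using nn_integral_vertex_adm_le[where 'n = 'n, OF a(1,3) P(8)[OF v] cv] unfolding a ev_def by auto
  obtain C2 where C2: "C2 > 0" and le2: "\<And>r (z :: real ^ 'n). adm r \<Longrightarrow>
    (\<integral>\<^sup>+ p. tw (q \<in> D) (\<beta> q) (fst p) * kb2 (c q) r p * sing a (tnorm (snd p - z)) \<partial>vm q)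
      \<le> ennreal C2 * ennreal (fst r powr eq) * sing \<theta> (tnorm (snd (snd r) - z))"
    using nn_integral_vertex_adm_le[where 'n = 'n, OF th(1) a(2,4) cq] unfolding a eq_def by auto
  show ?thesis
  proof (intro exI[of _ "C1 * C2"] conjI allI impI)
    show "0 < C1 * C2" using C1 C2 by simp
    fix q1 q2 :: "real \<times> real \<times> (real ^ 'n)" and X :: "'v \<Rightarrow> real \<times> (real ^ 'n)"
    assume qa: "adm q1" "adm q2" and X: "X \<in> space (PiM (S - {v} - {m v}) vm)"
    let ?qv = "pos q1 q2 X (par v)" and ?qq = "pos q1 q2 X (par q)"
    have aq: "adm ?qv" "adm ?qq"
      using adm_pos[OF X qa, of "par v"] adm_pos[OF X qa, of "par q"] pS pD S by (auto simp: q_def)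
    let ?K = "PA q1 q2 ?S \<beta> X * PK q1 q2 ?S X * PH ?M0 m b' X"
    let ?w = "\<lambda>y'. tw (q \<in> D) (\<beta> q) (fst y') * kb2 (c q) ?qq y'"
    let ?wv = "\<lambda>y. tw (v \<in> D) (\<beta> v) (fst y) * kb2 (c v) ?qv y"
    have Eq: "PA q1 q2 (S - {v}) \<beta> (X(q := y')) * PK q1 q2 (S - {v}) (X(q := y'))
      = PA q1 q2 ?S \<beta> X * PK q1 q2 ?S X * ?w y'" for y'
      by (rule PA_PK_upd[OF _ qleaf]) (use S in auto)
    \<comment> \<open>After the first integration the lowered singularity lies between the partner
      and the parent of \<open>v\<close>. This is the form in which the second integration meets
      it.\<close>
    have inner: "(\<integral>\<^sup>+ y. Phi q1 q2 S M m b \<beta> (X(q := y', v := y)) \<partial>vm v)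
        \<le> ?K * (ennreal C1 * ennreal (fst ?qv powr ev)) * (?w y' * sing a (tnorm (snd y' - snd (snd ?qv))))" for y'
    proof -
      have "(\<integral>\<^sup>+ y. Phi q1 q2 S M m b \<beta> (X(q := y', v := y)) \<partial>vm v)
         = (\<integral>\<^sup>+ y. ?K * ?w y' * (?wv y * sing (b v) (tnorm (snd y - snd y'))) \<partial>vm v)"
        unfolding Phi_def PA_PK_upd[OF S(2) vleaf S(1)] H1 Eq pos_upd[OF pv(3)]
        by (intro nn_integral_cong) (simp add: mult_ac)
      also have "\<dots> = ?K * ?w y' * (\<integral>\<^sup>+ y. ?wv y * sing (b v) (tnorm (snd y - snd y')) \<partial>vm v)"
        by (rule nn_integral_cmult[OF borel_measurable_vertex])
      also have "\<dots> \<le> ?K * ?w y' * (ennreal C1 * ennreal (fst ?qv powr ev) * sing a (tnorm (snd (snd ?qv) - snd y')))"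
        by (intro mult_left_mono le1 aq) auto
      finally show ?thesis
        unfolding tnorm_commute[of "snd (snd ?qv)" "snd y'"] by (simp add: mult_ac)
    qed
    have "(\<integral>\<^sup>+ y'. (\<integral>\<^sup>+ y. Phi q1 q2 S M m b \<beta> (X(q := y', v := y)) \<partial>vm v) \<partial>vm q)
        \<le> (\<integral>\<^sup>+ y'. ?K * (ennreal C1 * ennreal (fst ?qv powr ev)) * (?w y' * sing a (tnorm (snd y' - snd (snd ?qv)))) \<partial>vm q)"
      by (intro nn_integral_mono inner)
    also have "\<dots> = ?K * (ennreal C1 * ennreal (fst ?qv powr ev)) * (\<integral>\<^sup>+ y'. ?w y' * sing a (tnorm (snd y' - snd (snd ?qv))) \<partial>vm q)"
      by (rule nn_integral_cmult[OF borel_measurable_vertex])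
    also have "\<dots> \<le> ?K * (ennreal C1 * ennreal (fst ?qv powr ev))
        * (ennreal C2 * ennreal (fst ?qq powr eq) * sing \<theta> (tnorm (snd (snd ?qq) - snd (snd ?qv))))"
      by (intro mult_left_mono le2 aq) auto
    also have "\<dots> = ennreal (C1 * C2) * sing \<theta> (tnorm (snd (snd ?qq) - snd (snd ?qv)))
        * ((PA q1 q2 ?S \<beta> X * ennreal (fst ?qv powr ev)) * ennreal (fst ?qq powr eq) * PK q1 q2 ?S X * PH ?M0 m b' X)"
      using C1 C2 by (simp add: ennreal_mult' mult_ac)
    also have "PA q1 q2 ?S \<beta> X * ennreal (fst ?qv powr ev) = PA q1 q2 ?S \<beta>1 X"
      unfolding \<beta>1_def ev_def[symmetric] using aq S pS pD by (intro PA_merge) (auto simp: adm_def)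
    also have "PA q1 q2 ?S \<beta>1 X * ennreal (fst ?qq powr eq) = PA q1 q2 ?S \<beta>' X"
      unfolding \<beta>'_def q_def[symmetric] eq_def[symmetric] using aq S pS pD by (intro PA_merge) (auto simp: adm_def)
    finally show "(\<integral>\<^sup>+ y'. (\<integral>\<^sup>+ y. Phi q1 q2 S M m b \<beta> (X(m v := y', v := y)) \<partial>vm v) \<partial>vm (m v))
      \<le> ennreal (C1 * C2) * sing \<theta> (tnorm (snd (snd (pos q1 q2 X (par v))) - snd (snd (pos q1 q2 X (par (m v))))))
        * Phi q1 q2 (S - {v} - {m v}) (M - {v, m v}) m b' \<beta>' X"
      unfolding q_def[symmetric] Phi_def tnorm_commute[of "snd (snd ?qv)" "snd (snd ?qq)"] .
  qed
qed

end

section \<open>Iterating the peeling steps\<close>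

context rooted_forest begin

lemma borel_measurable_Phi_state:
  "state N S M m b \<beta> \<Longrightarrow> Phi q1 q2 S M m b \<beta> \<in> borel_measurable (PiM S vm)"
  using stateD(3) pairingD(1,3)[OF stateD(4)] by (intro borel_measurable_Phi) metis+

lemma product_sigma_finite_vm: "product_sigma_finite vm"
  by (intro product_sigma_finite.intro sigma_finite_vmeas)

text \<open>\<open>Lam\<close> charges a quarter of every contracting exponent to each side, but the
  last pair between the trees is charged only \<open>(b - \<theta>) / 4\<close>. The difference
  \<open>\<theta> / 4\<close> is returned to both roots.\<close>

definition bnd :: "'v set \<Rightarrow> ('v \<Rightarrow> real) \<Rightarrow> ('v \<Rightarrow> real) \<Rightarrow> real
    \<Rightarrow> real \<times> real \<times> (real ^ 'n::finite) \<Rightarrow> real \<times> real \<times> (real ^ 'n) \<Rightarrow> ennreal" where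
  "bnd S b \<beta> \<theta> q1 q2 = ennreal (fst q1 powr (Lam S b \<beta> r1 + \<theta> / 4))
     * ennreal (fst q2 powr (Lam S b \<beta> r2 + \<theta> / 4)) * sing \<theta> (tnorm (snd (snd q1) - snd (snd q2)))"

lemma nn_integral_Phi_empty:
  "(\<integral>\<^sup>+ X. Phi q1 q2 {} {} m b \<beta> X \<partial>PiM {} vm)
    = ennreal (fst q1 powr \<beta> r1) * ennreal (fst q2 powr \<beta> r2)"
proof -
  have D: "r1 \<notin> D" "r2 \<notin> D" using D_V0 r1_V0 r2_V0 by auto
  have "Phi q1 q2 {} {} m b \<beta> X = ennreal (fst q1 powr \<beta> r1) * ennreal (fst q2 powr \<beta> r2)" for X
    using r12 by (simp add: Phi_def PA_def PK_def PH_def tw_def D pos_def)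
  then show ?thesis
    by (subst product_sigma_finite.nn_integral_empty[OF product_sigma_finite_vm]) simp_all
qed

lemma integral_peel_step:
  fixes q1 q2 :: "real \<times> real \<times> (real ^ 'n::finite)"
  assumes st: "state N S M m b \<beta>" "state N' (S - {v}) M' m' b' \<beta>'" and v: "v \<in> S"
    and le: "\<And>X :: 'v \<Rightarrow> real \<times> (real ^ 'n). X \<in> space (PiM (S - {v}) vm) \<Longrightarrow>
      (\<integral>\<^sup>+ y. Phi q1 q2 S M m b \<beta> (X(v := y)) \<partial>vm v) \<le> ennreal C * Phi q1 q2 (S - {v}) M' m' b' \<beta>' X"
  shows "(\<integral>\<^sup>+ X. Phi q1 q2 S M m b \<beta> X \<partial>PiM S vm)
    \<le> ennreal C * (\<integral>\<^sup>+ X. Phi q1 q2 (S - {v}) M' m' b' \<beta>' X \<partial>PiM (S - {v}) vm)"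
proof -
  have S: "insert v (S - {v}) = S" "finite (S - {v})" using v stateD(2)[OF st(1)] by auto
  have "(\<integral>\<^sup>+ X. Phi q1 q2 S M m b \<beta> X \<partial>PiM S vm)
    = (\<integral>\<^sup>+ X. (\<integral>\<^sup>+ y. Phi q1 q2 S M m b \<beta> (X(v := y)) \<partial>vm v) \<partial>PiM (S - {v}) vm)"
    using product_sigma_finite.product_nn_integral_insert[OF product_sigma_finite_vm S(2), of v "Phi q1 q2 S M m b \<beta>"]
      borel_measurable_Phi_state[OF st(1), of q1 q2] unfolding S(1) by simp
  also have "\<dots> \<le> (\<integral>\<^sup>+ X. ennreal C * Phi q1 q2 (S - {v}) M' m' b' \<beta>' X \<partial>PiM (S - {v}) vm)"
    by (intro nn_integral_mono le)
  also have "\<dots> = ennreal C * (\<integral>\<^sup>+ X. Phi q1 q2 (S - {v}) M' m' b' \<beta>' X \<partial>PiM (S - {v}) vm)"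
    by (rule nn_integral_cmult[OF borel_measurable_Phi_state[OF st(2)]])
  finally show ?thesis .
qed

text \<open>The second state certifies the shape of the remaining forest; the exponents
  \<open>b'\<close> and \<open>\<beta>'\<close> of the bound are separate variables. This freedom is
  used in the final step.\<close>

lemma integral_peel_pair_step:
  fixes q1 q2 :: "real \<times> real \<times> (real ^ 'n::finite)"
  assumes st: "state N S M m b \<beta>" "state N' (S - {v} - {w}) M' m b1 \<beta>1" and v: "v \<in> S" "w \<in> S" "v \<noteq> w"
    and le: "\<And>X :: 'v \<Rightarrow> real \<times> (real ^ 'n). X \<in> space (PiM (S - {v} - {w}) vm) \<Longrightarrow>
      (\<integral>\<^sup>+ y'. (\<integral>\<^sup>+ y. Phi q1 q2 S M m b \<beta> (X(w := y', v := y)) \<partial>vm v) \<partial>vm w)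
        \<le> K * Phi q1 q2 (S - {v} - {w}) M' m b' \<beta>' X"
  shows "(\<integral>\<^sup>+ X. Phi q1 q2 S M m b \<beta> X \<partial>PiM S vm)
    \<le> K * (\<integral>\<^sup>+ X. Phi q1 q2 (S - {v} - {w}) M' m b' \<beta>' X \<partial>PiM (S - {v} - {w}) vm)"
proof -
  have S: "insert v (S - {v}) = S" "finite (S - {v})" "insert w (S - {v} - {w}) = S - {v}" "finite (S - {v} - {w})"
    using v stateD(2)[OF st(1)] by auto
  have m: "Phi q1 q2 S M m b \<beta> \<in> borel_measurable (PiM S vm)" by (rule borel_measurable_Phi_state[OF st(1)])
  have "(\<integral>\<^sup>+ X. Phi q1 q2 S M m b \<beta> X \<partial>PiM S vm)
    = (\<integral>\<^sup>+ X. (\<integral>\<^sup>+ y. Phi q1 q2 S M m b \<beta> (X(v := y)) \<partial>vm v) \<partial>PiM (S - {v}) vm)"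
    using product_sigma_finite.product_nn_integral_insert[OF product_sigma_finite_vm S(2), of v "Phi q1 q2 S M m b \<beta>"] m unfolding S(1) by simp
  also have "\<dots> = (\<integral>\<^sup>+ X. (\<integral>\<^sup>+ y'. (\<integral>\<^sup>+ y. Phi q1 q2 S M m b \<beta> (X(w := y', v := y)) \<partial>vm v) \<partial>vm w) \<partial>PiM (S - {v} - {w}) vm)"
  proof -
    have m': "Phi q1 q2 S M m b \<beta> \<in> borel_measurable (PiM (insert v (S - {v})) vm)"
      unfolding S(1) by (rule m)
    have "(\<lambda>(X, y). Phi q1 q2 S M m b \<beta> (X(v := y))) \<in> borel_measurable (PiM (S - {v}) vm \<Otimes>\<^sub>M vm v)"
      using measurable_comp[OF measurable_add_dim m'] by (simp add: comp_def case_prod_unfold)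
    then have "(\<lambda>X. \<integral>\<^sup>+ y. Phi q1 q2 S M m b \<beta> (X(v := y)) \<partial>vm v) \<in> borel_measurable (PiM (S - {v}) vm)"
      by (rule sigma_finite_measure.borel_measurable_nn_integral[OF sigma_finite_vmeas])
    then show ?thesis
      using product_sigma_finite.product_nn_integral_insert[OF product_sigma_finite_vm S(4), of w "\<lambda>X. \<integral>\<^sup>+ y. Phi q1 q2 S M m b \<beta> (X(v := y)) \<partial>vm v"]
      unfolding S(3) by simp
  qed
  also have "\<dots> \<le> (\<integral>\<^sup>+ X. K * Phi q1 q2 (S - {v} - {w}) M' m b' \<beta>' X \<partial>PiM (S - {v} - {w}) vm)"
    by (intro nn_integral_mono le)
  also have "\<dots> = K * (\<integral>\<^sup>+ X. Phi q1 q2 (S - {v} - {w}) M' m b' \<beta>' X \<partial>PiM (S - {v} - {w}) vm)"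
  proof (rule nn_integral_cmult[OF borel_measurable_Phi])
    note P = pairingD[OF stateD(4)[OF st(2)]]
    show "M' \<subseteq> S - {v} - {w}" "\<And>u. u \<in> M' \<Longrightarrow> m u \<in> M'" using P(1,3) by auto
    show "\<And>u. u \<in> S - {v} - {w} \<Longrightarrow> par u \<in> S - {v} - {w} \<union> R" using stateD(3)[OF st(2)] by auto
  qed
  finally show ?thesis .
qed

text \<open>Every step except the last preserves \<open>Lam\<close> at the roots and hence
  \<open>bnd\<close>, so along the induction only the constants multiply. The last step extracts the
  distance of the two roots.\<close>

theorem nn_integral_Phi_le:
  assumes "state CARD('n::finite) S M m b \<beta>" "cross \<theta> M m b"
  shows "\<exists>C>0. \<forall>q1 q2 :: real \<times> real \<times> (real ^ 'n). adm q1 \<longrightarrow> adm q2 \<longrightarrow>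
    (\<integral>\<^sup>+ X. Phi q1 q2 S M m b \<beta> X \<partial>PiM S vm) \<le> ennreal C * bnd S b \<beta> \<theta> q1 q2"
  using assms
proof (induction "card S" arbitrary: S M m b \<beta> rule: less_induct)
  case less
  note st = less.prems(1)
  note S = stateD(1,2,3)[OF st] and P = pairingD[OF stateD(4)[OF st]]
  have R: "r1 \<notin> S" "r2 \<notin> S" "b r1 = 0" "b r2 = 0" using S r1_V0 r2_V0 P(1,9) by auto
  have B12: "r2 \<notin> B r1" "r1 \<notin> B r2" "r1 \<in> B r1" "r2 \<in> B r2"
    using B_root[of r2 r1] B_root[of r1 r2] r12 B_self by auto
  \<comment> \<open>Common to the two kinds of steps that remove a single vertex.\<close>
  have step: ?case
    if "v \<in> S" and st': "state CARD('n) (S - {v}) M' m' b' \<beta>'" and cr: "cross \<theta> M' m' b'"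
      and L: "\<And>w. w \<in> R \<Longrightarrow> Lam (S - {v}) b' \<beta>' w = Lam S b \<beta> w"
      and le: "\<exists>C>0. \<forall>q1 q2 (X :: 'v \<Rightarrow> real \<times> (real ^ 'n)). adm q1 \<longrightarrow> adm q2 \<longrightarrow> X \<in> space (PiM (S - {v}) vm) \<longrightarrow>
        (\<integral>\<^sup>+ y. Phi q1 q2 S M m b \<beta> (X(v := y)) \<partial>vm v) \<le> ennreal C * Phi q1 q2 (S - {v}) M' m' b' \<beta>' X"
    for v M' m' b' \<beta>'
  proof -
    obtain C1 where C1: "C1 > 0" "\<And>q1 q2 (X :: 'v \<Rightarrow> real \<times> (real ^ 'n)). adm q1 \<Longrightarrow> adm q2 \<Longrightarrow> X \<in> space (PiM (S - {v}) vm) \<Longrightarrow>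
        (\<integral>\<^sup>+ y. Phi q1 q2 S M m b \<beta> (X(v := y)) \<partial>vm v) \<le> ennreal C1 * Phi q1 q2 (S - {v}) M' m' b' \<beta>' X"
      using le by blast
    have "card (S - {v}) < card S" using that(1) S by (intro psubset_card_mono) auto
    from less.hyps[OF this st' cr] obtain C2 where C2: "C2 > 0" "\<And>q1 q2 :: real \<times> real \<times> (real ^ 'n). adm q1 \<Longrightarrow> adm q2 \<Longrightarrow>
      (\<integral>\<^sup>+ X. Phi q1 q2 (S - {v}) M' m' b' \<beta>' X \<partial>PiM (S - {v}) vm) \<le> ennreal C2 * bnd (S - {v}) b' \<beta>' \<theta> q1 q2"
      by blast
    have "bnd (S - {v}) b' \<beta>' \<theta> q1 q2 = bnd S b \<beta> \<theta> q1 q2" for q1 q2 :: "real \<times> real \<times> (real ^ 'n)"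
      using L by (simp add: bnd_def)
    note C2' = C2(2)[unfolded this]
    show ?case
    proof (intro exI[of _ "C1 * C2"] conjI allI impI)
      show "0 < C1 * C2" using C1 C2 by simp
      fix q1 q2 :: "real \<times> real \<times> (real ^ 'n)" assume q: "adm q1" "adm q2"
      have "(\<integral>\<^sup>+ X. Phi q1 q2 S M m b \<beta> X \<partial>PiM S vm)
        \<le> ennreal C1 * (\<integral>\<^sup>+ X. Phi q1 q2 (S - {v}) M' m' b' \<beta>' X \<partial>PiM (S - {v}) vm)"
        by (rule integral_peel_step[OF st st' that(1) C1(2)[OF q]])
      also have "\<dots> \<le> ennreal C1 * (ennreal C2 * bnd S b \<beta> \<theta> q1 q2)"
        by (intro mult_left_mono C2' q) simp
      finally show "(\<integral>\<^sup>+ X. Phi q1 q2 S M m b \<beta> X \<partial>PiM S vm) \<le> ennreal (C1 * C2) * bnd S b \<beta> \<theta> q1 q2"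
        using C1 by (simp add: ennreal_mult' mult.assoc)
    qed
  qed
  show ?case
  proof (cases "S = {}")
    case True
    then have M: "M = {}" using P by auto
    \<comment> \<open>Without contracted leaves no edge joins the two trees, so \<open>cross\<close>
      leaves only the exponent 0.\<close>
    then have th: "\<theta> = 0" using less.prems(2) by (auto simp: cross_def ext_def)
    have "R \<inter> B r1 = {r1}" "R \<inter> B r2 = {r2}" using B12 by auto
    then have "Lam S b \<beta> r1 = \<beta> r1" "Lam S b \<beta> r2 = \<beta> r2" using True R by (simp_all add: Lam_def)
    then have "(\<integral>\<^sup>+ X. Phi q1 q2 S M m b \<beta> X \<partial>PiM S vm) \<le> ennreal 1 * bnd S b \<beta> \<theta> q1 q2"
      for q1 q2 :: "real \<times> real \<times> (real ^ 'n)"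
      using nn_integral_Phi_empty[of q1 q2 m b \<beta>] by (simp add: True M th bnd_def)
    then show ?thesis using zero_less_one by blast
  next
    case False
    consider
      (1) v where "leafS S v" "v \<notin> M"
    | (2) v where "v \<in> M" "par v \<in> S" "\<And>u. u \<in> S \<Longrightarrow> par u = par v \<Longrightarrow> u = v"
    | (3) v where "v \<in> M" "\<And>w. w \<in> S - {v, m v} \<Longrightarrow> ext M m w \<inter> {v, m v} \<noteq> {} \<Longrightarrow> ext M m w - {v, m v} \<noteq> {}"
        "\<theta> = 0 \<or> (\<exists>u\<in>ext M m r1 - {v, m v}. \<theta> \<le> b u)"
    | (4) v where "v \<in> M" "S = {v, m v}" "par v = r1" "par (m v) = r2" "\<theta> \<le> b v"
      using exists_peel[OF st False less.prems(2)]
    proof (elim disjE, goal_cases)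
      case 1
      then show ?case using that(1) by blast
    next
      case 2
      then obtain v where "v \<in> M" "par v \<in> S" "\<forall>u\<in>S. par u = par v \<longrightarrow> u = v" by blast
      then show ?case by (intro that(2)[of v]) simp_all
    next
      case 3
      then obtain v where "v \<in> M" "\<forall>w\<in>S - {v, m v}. ext M m w \<inter> {v, m v} \<noteq> {} \<longrightarrow> ext M m w - {v, m v} \<noteq> {}"
        "\<theta> = 0 \<or> (\<exists>u\<in>ext M m r1 - {v, m v}. \<theta> \<le> b u)" by blast
      then show ?case by (intro that(3)[of v]) (assumption | blast)+
    next
      case 4
      then show ?case using that(4) by blast
    qed
    then show ?thesis
    proof cases
      case (1 v)
      have vS: "v \<in> S" using 1 by (simp add: leafS_def)
      show ?thesis
      proof (rule step[OF vS state_drop_free_leaf(1)[OF st 1] less.prems(2) _ integral_free_leaf[OF st 1]])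
        fix w assume "w \<in> R"
        then show "Lam (S - {v}) b (\<beta>(par v := \<beta> (par v) + (1 + c v + \<beta> v))) w = Lam S b \<beta> w"
          using R vS by (intro state_drop_free_leaf(2)[OF st 1]) auto
      qed
    next
      case (2 v)
      have vS: "v \<in> S" using 2 P by auto
      show ?thesis
      proof (rule step[OF vS state_move_up(1)[OF st 2] _ _ integral_move_up[OF st 2(1,2)]])
        show "cross \<theta> (insert (par v) (M - {v})) (m(par v := m v, m v := par v)) (b(v := 0, par v := b v))"
          using less.prems(2) state_move_up(3)[OF st 2] unfolding cross_def by metis
        fix w assume "w \<in> R"
        then show "Lam (S - {v}) (b(v := 0, par v := b v)) (\<beta>(par v := \<beta> (par v) + (1 + c v + \<beta> v))) w = Lam S b \<beta> w"
          using R vS by (intro state_move_up(2)[OF st 2]) auto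
      qed
    next
      case (3 v)
      define b' where "b' = b(v := 0, m v := 0)"
      define \<beta>1 where "\<beta>1 = \<beta>(par v := \<beta> (par v) + (1 + c v + \<beta> v - b v / 4))"
      define \<beta>' where "\<beta>' = \<beta>1(par (m v) := \<beta>1 (par (m v)) + (1 + c (m v) + \<beta> (m v) - b v / 4))"
      let ?S = "S - {v} - {m v}" and ?M = "M - {v, m v}"
      note sd = state_drop_pair[OF st 3(1,2), folded b'_def \<beta>1_def, folded \<beta>'_def]
      have vS: "v \<in> S" "m v \<in> S" "v \<noteq> m v" using P(1) P(3,4)[OF 3(1)] 3(1) by auto
      \<comment> \<open>Target exponent 0: the singularity of the pair is converted completely into
        powers of time, and no weight between the two parents is left.\<close>
      obtain C1 where C1: "C1 > 0" and le1: "\<And>q1 q2 (X :: 'v \<Rightarrow> real \<times> (real ^ 'n)). adm q1 \<Longrightarrow> adm q2 \<Longrightarrow> X \<in> space (PiM ?S vm) \<Longrightarrow>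
        (\<integral>\<^sup>+ y'. (\<integral>\<^sup>+ y. Phi q1 q2 S M m b \<beta> (X(m v := y', v := y)) \<partial>vm v) \<partial>vm (m v)) \<le> ennreal C1 * Phi q1 q2 ?S ?M m b' \<beta>' X"
        using integral_drop_pair[where 'n = 'n, OF st 3(1) order_refl P(10)]
        unfolding diff_zero b'_def[symmetric] \<beta>1_def[symmetric] \<beta>'_def[symmetric] by auto
      have cr: "cross \<theta> ?M m b'"
        using less.prems(2) 3(3) sd(3)[of r1] by (auto simp: cross_def b'_def)
      have "card ?S < card S" using vS S by (intro psubset_card_mono) auto
      from less.hyps[OF this sd(1) cr] obtain C2 where C2: "C2 > 0" "\<And>q1 q2 :: real \<times> real \<times> (real ^ 'n). adm q1 \<Longrightarrow> adm q2 \<Longrightarrow>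
        (\<integral>\<^sup>+ X. Phi q1 q2 ?S ?M m b' \<beta>' X \<partial>PiM ?S vm) \<le> ennreal C2 * bnd ?S b' \<beta>' \<theta> q1 q2"
        by blast
      have L: "Lam ?S b' \<beta>' w = Lam S b \<beta> w" if "w \<in> R" for w
        using that R vS by (intro sd(2)) auto
      have "bnd ?S b' \<beta>' \<theta> q1 q2 = bnd S b \<beta> \<theta> q1 q2" for q1 q2 :: "real \<times> real \<times> (real ^ 'n)"
        using L by (simp add: bnd_def)
      note C2' = C2(2)[unfolded this]
      show ?thesis
      proof (intro exI[of _ "C1 * C2"] conjI allI impI)
        show "0 < C1 * C2" using C1 C2 by simp
        fix q1 q2 :: "real \<times> real \<times> (real ^ 'n)" assume q: "adm q1" "adm q2"
        have "(\<integral>\<^sup>+ X. Phi q1 q2 S M m b \<beta> X \<partial>PiM S vm) \<le> ennreal C1 * (\<integral>\<^sup>+ X. Phi q1 q2 ?S ?M m b' \<beta>' X \<partial>PiM ?S vm)"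
          by (rule integral_peel_pair_step[OF st sd(1) vS le1[OF q]])
        also have "\<dots> \<le> ennreal C1 * (ennreal C2 * bnd S b \<beta> \<theta> q1 q2)"
          by (intro mult_left_mono C2' q) simp
        finally show "(\<integral>\<^sup>+ X. Phi q1 q2 S M m b \<beta> X \<partial>PiM S vm) \<le> ennreal (C1 * C2) * bnd S b \<beta> \<theta> q1 q2"
          using C1 by (simp add: ennreal_mult' mult.assoc)
      qed
    next
      case (4 v)
      have th: "0 \<le> \<theta>" using less.prems(2) by (simp add: cross_def)
      define b' where "b' = b(v := 0, m v := 0)"
      define \<beta>1 where "\<beta>1 = \<beta>(par v := \<beta> (par v) + (1 + c v + \<beta> v - (b v - \<theta>) / 4))"
      define \<beta>' where "\<beta>' = \<beta>1(par (m v) := \<beta>1 (par (m v)) + (1 + c (m v) + \<beta> (m v) - (b v - \<theta>) / 4))"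
      let ?S = "S - {v} - {m v}" and ?M = "M - {v, m v}"
      have E: "?S = {}" "?M = {}" using 4 P(1) by auto
      have q: "m v \<in> M" "m v \<noteq> v" "b (m v) = b v" using P(3,4,6)[OF 4(1)] by auto
      have vS: "v \<in> S" "m v \<in> S" "v \<noteq> m v" using P(1) q 4(1) by auto
      have V0: "v \<in> V0" "m v \<in> V0" using vS S by auto
      \<comment> \<open>Each tree is now a root with one leaf. \<open>Lam\<close> at the root is the
        sum of both contributions with the full charge \<open>b v / 4\<close>, while the integration
        took only \<open>(b v - \<theta>) / 4\<close>.\<close>
      have \<beta>': "\<beta>' r1 = Lam S b \<beta> r1 + \<theta> / 4" "\<beta>' r2 = Lam S b \<beta> r2 + \<theta> / 4"
      proof -
        have nr: "v \<noteq> r1" "v \<noteq> r2" "m v \<noteq> r1" "m v \<noteq> r2" using vS R by auto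
        have "v \<in> B r1" "m v \<notin> B r1" "v \<notin> B r2" "m v \<in> B r2"
          using B_par[of v r1] B_par[of v r2] B_par[of "m v" r1] B_par[of "m v" r2] V0 nr 4(3,4) B12 by auto
        then have I: "(S \<union> R) \<inter> B r1 = {v, r1}" "(S \<union> R) \<inter> B r2 = {m v, r2}" using 4(2) B12 by auto
        show "\<beta>' r1 = Lam S b \<beta> r1 + \<theta> / 4" "\<beta>' r2 = Lam S b \<beta> r2 + \<theta> / 4"
          unfolding Lam_def I using nr r12 q(3) R by (simp_all add: \<beta>'_def \<beta>1_def 4(3,4) field_simps)
      qed
      obtain C1 where C1: "C1 > 0" and le1: "\<And>q1 q2 (X :: 'v \<Rightarrow> real \<times> (real ^ 'n)). adm q1 \<Longrightarrow> adm q2 \<Longrightarrow> X \<in> space (PiM ?S vm) \<Longrightarrow>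
        (\<integral>\<^sup>+ y'. (\<integral>\<^sup>+ y. Phi q1 q2 S M m b \<beta> (X(m v := y', v := y)) \<partial>vm v) \<partial>vm (m v))
          \<le> ennreal C1 * sing \<theta> (tnorm (snd (snd (pos q1 q2 X (par v))) - snd (snd (pos q1 q2 X (par (m v))))))
            * Phi q1 q2 ?S ?M m b' \<beta>' X"
        using integral_drop_pair[where 'n = 'n, OF st 4(1) th 4(5)]
        unfolding b'_def[symmetric] \<beta>1_def[symmetric] \<beta>'_def[symmetric] by auto
      have posr: "pos q1 q2 X (par v) = q1" "pos q1 q2 X (par (m v)) = q2" for q1 q2 and X :: "'v \<Rightarrow> real \<times> (real ^ 'n)"
        using r12 by (auto simp: pos_def 4(3,4))
      \<comment> \<open>Nothing is left, so the conditions of a state hold trivially and the zero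
        exponent may stand in for \<open>b'\<close>.\<close>
      have st': "state CARD('n) ?S ?M m (\<lambda>_. 0) \<beta>'"
        unfolding E by (simp add: state_def pairing_def)
      show ?thesis
      proof (intro exI[of _ C1] conjI allI impI C1)
        fix q1 q2 :: "real \<times> real \<times> (real ^ 'n)" assume q: "adm q1" "adm q2"
        have "(\<integral>\<^sup>+ X. Phi q1 q2 S M m b \<beta> X \<partial>PiM S vm)
          \<le> ennreal C1 * sing \<theta> (tnorm (snd (snd q1) - snd (snd q2))) * (\<integral>\<^sup>+ X. Phi q1 q2 ?S ?M m b' \<beta>' X \<partial>PiM ?S vm)"
          by (rule integral_peel_pair_step[OF st st' vS le1[OF q, unfolded posr]])
        also have "(\<integral>\<^sup>+ X. Phi q1 q2 ?S ?M m b' \<beta>' X \<partial>PiM ?S vm) = ennreal (fst q1 powr \<beta>' r1) * ennreal (fst q2 powr \<beta>' r2)"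
          unfolding E by (rule nn_integral_Phi_empty)
        finally show "(\<integral>\<^sup>+ X. Phi q1 q2 S M m b \<beta> X \<partial>PiM S vm) \<le> ennreal C1 * bnd S b \<beta> \<theta> q1 q2"
          unfolding bnd_def \<beta>' by (simp add: mult_ac)
      qed
    qed
  qed
qed

end

section \<open>Bounds for the heat kernel\<close>

text \<open>From \<open>(y / N) ^ N \<le> exp y\<close> with \<open>y = 1 + \<bar>z\<bar>\<close>,
  the power is at most \<open>N ^ N\<close> times an exponential. The constant \<open>exp 2\<close>
  arises because \<open>1 + \<bar>z\<bar> - z\<^sup>2 / 4\<close> is at most 2, by completing the
  square.\<close>

lemma power_mult_exp_le:
  fixes z :: real
  shows "(1 + \<bar>z\<bar>) ^ N * exp (- z\<^sup>2 / 4) \<le> exp 2 * real N ^ N"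
proof -
  have "(1 + \<bar>z\<bar>) ^ N \<le> real N ^ N * exp (1 + \<bar>z\<bar>)"
  proof (cases "N = 0")
    case False
    have "((1 + \<bar>z\<bar>) / real N) ^ N \<le> (1 + (1 + \<bar>z\<bar>) / real N) ^ N"
      by (intro power_mono) auto
    also have "\<dots> \<le> exp (1 + \<bar>z\<bar>)"
      using False by (intro exp_ge_one_plus_x_over_n_power_n) auto
    finally show ?thesis using False by (simp add: power_divide field_simps)
  qed simp
  then have "(1 + \<bar>z\<bar>) ^ N * exp (- z\<^sup>2 / 4) \<le> real N ^ N * exp (1 + \<bar>z\<bar>) * exp (- z\<^sup>2 / 4)"
    by (intro mult_right_mono) auto
  also have "\<dots> = real N ^ N * exp (1 + \<bar>z\<bar> - z\<^sup>2 / 4)"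
    by (simp add: exp_add[symmetric] mult.assoc)
  also have "\<dots> \<le> real N ^ N * exp 2"
  proof -
    have "0 \<le> (\<bar>z\<bar> / 2 - 1)\<^sup>2" by simp
    then have "1 + \<bar>z\<bar> - z\<^sup>2 / 4 \<le> 2" by (simp add: power2_eq_square algebra_simps abs_mult_self_eq)
    then show ?thesis by (intro mult_left_mono) auto
  qed
  finally show ?thesis by (simp add: mult.commute)
qed

text \<open>In the induction on the coefficients, multiplication by \<open>z\<close> costs one order
  of decay; the order \<open>N\<close> therefore has to remain arbitrary.\<close>

lemma poly_gauss_bound:
  fixes p :: "real poly"
  shows "\<exists>C\<ge>0. \<forall>z. \<bar>poly p z * exp (- z\<^sup>2 / 4)\<bar> \<le> C / (1 + \<bar>z\<bar>) ^ N"
proof (induction p arbitrary: N)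
  case 0
  show ?case by (intro exI[of _ 0]) simp
next
  case (pCons a p)
  obtain C where C: "C \<ge> 0" "\<And>z. \<bar>poly p z * exp (- z\<^sup>2 / 4)\<bar> \<le> C / (1 + \<bar>z\<bar>) ^ Suc N"
    using pCons.IH[of "Suc N"] by blast
  show ?case
  proof (intro exI[of _ "\<bar>a\<bar> * (exp 2 * real N ^ N) + C"] conjI allI)
    show "0 \<le> \<bar>a\<bar> * (exp 2 * real N ^ N) + C" using C by simp
    fix z :: real
    have w: "0 < 1 + \<bar>z\<bar>" by simp
    have "\<bar>a * exp (- z\<^sup>2 / 4)\<bar> = \<bar>a\<bar> * exp (- z\<^sup>2 / 4)" by (simp add: abs_mult)
    also have "\<dots> \<le> \<bar>a\<bar> * (exp 2 * real N ^ N / (1 + \<bar>z\<bar>) ^ N)"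
      using power_mult_exp_le[of z N] w by (intro mult_left_mono) (auto simp: pos_le_divide_eq mult.commute)
    finally have 1: "\<bar>a * exp (- z\<^sup>2 / 4)\<bar> \<le> \<bar>a\<bar> * (exp 2 * real N ^ N) / (1 + \<bar>z\<bar>) ^ N" by simp
    have "\<bar>z * (poly p z * exp (- z\<^sup>2 / 4))\<bar> \<le> (1 + \<bar>z\<bar>) * (C / (1 + \<bar>z\<bar>) ^ Suc N)"
      unfolding abs_mult[of z] using C(2)[of z] by (intro mult_mono) auto
    also have "\<dots> = C / (1 + \<bar>z\<bar>) ^ N" using w by simp
    finally have 2: "\<bar>z * (poly p z * exp (- z\<^sup>2 / 4))\<bar> \<le> C / (1 + \<bar>z\<bar>) ^ N" .
    have "poly (pCons a p) z * exp (- z\<^sup>2 / 4) = a * exp (- z\<^sup>2 / 4) + z * (poly p z * exp (- z\<^sup>2 / 4))"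
      by (simp add: algebra_simps)
    then show "\<bar>poly (pCons a p) z * exp (- z\<^sup>2 / 4)\<bar> \<le> (\<bar>a\<bar> * (exp 2 * real N ^ N) + C) / (1 + \<bar>z\<bar>) ^ N"
      using 1 2 by (simp add: add_divide_distrib)
  qed
qed

text \<open>Hermite polynomials up to scaling. In the variable \<open>z = y / sqrt t\<close> every
  spatial derivative of the Gaussian is a polynomial times \<open>exp (- z\<^sup>2 / 4)\<close>, and
  the recursion is the derivative of such a product.\<close>

primrec hpoly :: "nat \<Rightarrow> real poly" where
  "hpoly 0 = [:(4 * pi) powr (- 1 / 2):]"
| "hpoly (Suc k) = pderiv (hpoly k) - [:0, 1 / 2:] * hpoly k"

text \<open>The self-similar profiles with arbitrary polynomial and time exponent. Unlike the family
  \<open>hk\<close> by itself, they are visibly closed under derivatives in space and in time, and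
  one bound covers both.\<close>

definition gk :: "real poly \<Rightarrow> real \<Rightarrow> real \<Rightarrow> real \<Rightarrow> real" where
  "gk p e t y = t powr e * (poly p (y / sqrt t) * exp (- (y / sqrt t)\<^sup>2 / 4))"

text \<open>\<open>hk k t\<close> is the \<open>k\<close>-th derivative of the one-dimensional Gaussian heat kernel at time \<open>t\<close>.\<close>

definition hk :: "nat \<Rightarrow> real \<Rightarrow> real \<Rightarrow> real" where
  "hk k = gk (hpoly k) (- real (k + 1) / 2)"

lemma gk_bound: "\<exists>C\<ge>0. \<forall>t y. 0 < t \<longrightarrow> \<bar>gk p e t y\<bar> \<le> C * t powr e / (1 + \<bar>y\<bar> / sqrt t) ^ N"
proof -
  obtain C where C: "C \<ge> 0" "\<And>z. \<bar>poly p z * exp (- z\<^sup>2 / 4)\<bar> \<le> C / (1 + \<bar>z\<bar>) ^ N"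
    using poly_gauss_bound by blast
  have "\<bar>gk p e t y\<bar> \<le> C * t powr e / (1 + \<bar>y\<bar> / sqrt t) ^ N" if "0 < t" for t y
  proof -
    have "\<bar>gk p e t y\<bar> = t powr e * \<bar>poly p (y / sqrt t) * exp (- (y / sqrt t)\<^sup>2 / 4)\<bar>"
      by (simp add: gk_def abs_mult)
    also have "\<dots> \<le> t powr e * (C / (1 + \<bar>y / sqrt t\<bar>) ^ N)"
      by (intro mult_left_mono C) auto
    finally show ?thesis using that by (simp add: abs_divide mult.commute)
  qed
  then show ?thesis using C(1) by blast
qed

lemma poly_gauss_deriv:
  fixes p :: "real poly"
  shows "((\<lambda>z. poly p z * exp (- z\<^sup>2 / 4)) has_real_derivative
    poly (pderiv p - [:0, 1 / 2:] * p) z * exp (- z\<^sup>2 / 4)) (at z)"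
proof -
  have "((\<lambda>z. exp (- z\<^sup>2 / 4)) has_real_derivative exp (- z\<^sup>2 / 4) * (- z / 2)) (at z)"
    by (rule derivative_eq_intros refl | simp)+
  from DERIV_mult[OF poly_DERIV this]
  show ?thesis by (rule DERIV_cong) (simp add: algebra_simps)
qed

lemma gk_deriv_space:
  assumes "0 < t"
  shows "(gk p e t has_real_derivative gk (pderiv p - [:0, 1 / 2:] * p) (e - 1 / 2) t y) (at y)"
proof -
  let ?q = "pderiv p - [:0, 1 / 2:] * p" and ?z = "y / sqrt t"
  have "((\<lambda>y. t powr e * (poly p (y / sqrt t) * exp (- (y / sqrt t)\<^sup>2 / 4))) has_real_derivative
      t powr e * (poly ?q ?z * exp (- ?z\<^sup>2 / 4) * (1 / sqrt t))) (at y)"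
    by (intro DERIV_cmult DERIV_chain2[OF poly_gauss_deriv] DERIV_cdivide DERIV_ident)
  also have "t powr e * (poly ?q ?z * exp (- ?z\<^sup>2 / 4) * (1 / sqrt t)) = (t powr e / sqrt t) * (poly ?q ?z * exp (- ?z\<^sup>2 / 4))"
    by simp
  also have "t powr e / sqrt t = t powr (e - 1 / 2)"
    using assms by (simp add: powr_diff powr_half_sqrt)
  finally show ?thesis by (simp add: gk_def[abs_def])
qed

lemma hk_deriv:
  assumes "0 < t"
  shows "(hk k t has_real_derivative hk (Suc k) t y) (at y)"
proof -
  have e: "- real (Suc k + 1) / 2 = - real (k + 1) / 2 - 1 / 2" by (simp add: field_simps)
  show ?thesis unfolding hk_def hpoly.simps e by (rule gk_deriv_space[OF assms])
qed

text \<open>At fixed \<open>y\<close> the variable \<open>z = y / sqrt t\<close> has time derivative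
  \<open>- z / (2 * t)\<close>. Hence the derivatives of the prefactor and of the profile both carry
  the power \<open>e - 1\<close> of time.\<close>

lemma gk_deriv_time:
  assumes "0 < t"
  shows "((\<lambda>t. gk p e t y) has_real_derivative
    gk (smult e p - [:0, 1 / 2:] * (pderiv p - [:0, 1 / 2:] * p)) (e - 1) t y) (at t)"
proof -
  let ?q = "pderiv p - [:0, 1 / 2:] * p" and ?z = "y / sqrt t"
  have z: "((\<lambda>t. y / sqrt t) has_real_derivative - ?z / (2 * t)) (at t)"
  proof -
    have "sqrt t \<noteq> 0" using assms by simp
    note d = DERIV_divide[OF DERIV_const[of y] DERIV_real_sqrt[OF assms] this]
    have "(0 * s - y * (inverse s / 2)) / (s * s) = - (y / s) / (2 * (s * s))" if "s \<noteq> 0" for s :: real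
      using that by (simp add: field_simps)
    from this[OF \<open>sqrt t \<noteq> 0\<close>] d show ?thesis using assms by simp
  qed
  have "((\<lambda>t. t powr e) has_real_derivative e * t powr (e - 1)) (at t)"
    by (rule has_real_derivative_powr[OF assms])
  from DERIV_mult[OF this DERIV_chain2[OF poly_gauss_deriv z]]
  have "((\<lambda>t. t powr e * (poly p (y / sqrt t) * exp (- (y / sqrt t)\<^sup>2 / 4))) has_real_derivative
      e * t powr (e - 1) * (poly p ?z * exp (- ?z\<^sup>2 / 4))
        + poly ?q ?z * exp (- ?z\<^sup>2 / 4) * (- ?z / (2 * t)) * t powr e) (at t)" .
  also have "e * t powr (e - 1) * (poly p ?z * exp (- ?z\<^sup>2 / 4))
        + poly ?q ?z * exp (- ?z\<^sup>2 / 4) * (- ?z / (2 * t)) * t powr e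
    = t powr (e - 1) * (poly (smult e p - [:0, 1 / 2:] * ?q) ?z * exp (- ?z\<^sup>2 / 4))"
  proof -
    have te: "t powr e = t powr (e - 1) * t" using assms by (simp add: powr_diff)
    have alg: "e * P * (f * E) + d * E * (- z / (2 * t)) * (P * t) = P * ((e * f - (z / 2) * d) * E)" for P f E d z :: real
      using assms by (simp add: field_simps)
    have "poly (smult e p - [:0, 1 / 2:] * ?q) ?z = e * poly p ?z - (?z / 2) * poly ?q ?z"
      by simp
    then show ?thesis unfolding te by (simp only: alg)
  qed
  finally show ?thesis by (simp add: gk_def)
qed

lemma hk_bound: "\<exists>C\<ge>0. \<forall>t y. 0 < t \<longrightarrow> \<bar>hk k t y\<bar> \<le> C * t powr (- real (k + 1) / 2) / (1 + \<bar>y\<bar> / sqrt t) ^ N"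
  unfolding hk_def by (rule gk_bound)

text \<open>Mean value theorem in time. The intermediate time is eliminated in favour of the worse
  endpoint, which is the earlier time in the negative power and the later time in the spatial
  decay.\<close>

lemma hk_diff_bound:
  "\<exists>C\<ge>0. \<forall>s t y. 0 < s \<longrightarrow> s \<le> t \<longrightarrow>
    \<bar>hk k t y - hk k s y\<bar> \<le> C * (t - s) * s powr (- real (k + 1) / 2 - 1) / (1 + \<bar>y\<bar> / sqrt t) ^ N"
proof -
  define e where "e = - real (k + 1) / 2"
  define q where "q = smult e (hpoly k) - [:0, 1 / 2:] * (pderiv (hpoly k) - [:0, 1 / 2:] * hpoly k)"
  obtain C where C: "C \<ge> 0" "\<And>t y. 0 < t \<Longrightarrow> \<bar>gk q (e - 1) t y\<bar> \<le> C * t powr (e - 1) / (1 + \<bar>y\<bar> / sqrt t) ^ N"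
    using gk_bound by blast
  have "\<bar>hk k t y - hk k s y\<bar> \<le> C * (t - s) * s powr (e - 1) / (1 + \<bar>y\<bar> / sqrt t) ^ N" if st: "0 < s" "s \<le> t" for s t y
  proof (cases "s = t")
    case False
    then have lt: "s < t" using st by simp
    have "\<And>x. s \<le> x \<Longrightarrow> x \<le> t \<Longrightarrow> ((\<lambda>t. gk (hpoly k) e t y) has_real_derivative gk q (e - 1) x y) (at x)"
      using gk_deriv_time st unfolding q_def by auto
    from MVT2[OF lt this] obtain x where x: "s < x" "x < t" "gk (hpoly k) e t y - gk (hpoly k) e s y = (t - s) * gk q (e - 1) x y"
      by blast
    have "\<bar>gk q (e - 1) x y\<bar> \<le> C * x powr (e - 1) / (1 + \<bar>y\<bar> / sqrt x) ^ N"
      using C(2) x st by simp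
    also have "\<dots> \<le> C * s powr (e - 1) / (1 + \<bar>y\<bar> / sqrt t) ^ N"
    proof (rule frac_le)
      have "x powr (e - 1) \<le> s powr (e - 1)" using x st by (intro powr_mono2') (auto simp: e_def)
      then show "C * x powr (e - 1) \<le> C * s powr (e - 1)" using C(1) by (rule mult_left_mono)
      show "0 < (1 + \<bar>y\<bar> / sqrt t) ^ N" using st by (intro zero_less_power add_pos_nonneg) auto
      show "(1 + \<bar>y\<bar> / sqrt t) ^ N \<le> (1 + \<bar>y\<bar> / sqrt x) ^ N"
        using x st by (intro power_mono add_left_mono divide_left_mono) auto
    qed (use C in auto)
    finally have "(t - s) * \<bar>gk q (e - 1) x y\<bar> \<le> (t - s) * (C * s powr (e - 1) / (1 + \<bar>y\<bar> / sqrt t) ^ N)"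
      using st by (intro mult_left_mono) auto
    then show ?thesis using st x(3) unfolding hk_def e_def[symmetric] by (simp add: abs_mult mult_ac)
  qed simp
  then show ?thesis using C(1) unfolding e_def by blast
qed

section \<open>Lattice sums and the heat kernel on the circle\<close>

lemma summable_int_decode: "summable (\<lambda>n. 1 / (1 / 2 + \<bar>real_of_int (int_decode n)\<bar>)\<^sup>2)"
proof (rule summable_comparison_test')
  have "summable (\<lambda>n. inverse ((real (n + 1))\<^sup>2))"
    using inverse_power_summable[of 2, where 'a = real] by (subst summable_iff_shift) simp
  then show "summable (\<lambda>n. 16 * inverse ((real (n + 1))\<^sup>2))" by (rule summable_mult)
  fix n :: nat
  \<comment> \<open>The modulus of \<open>int_decode n\<close> is about \<open>n / 2\<close>, so the
    enumeration of the integers is comparable with the natural order.\<close>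
  have "real (n + 1) / 4 \<le> 1 / 2 + \<bar>real_of_int (int_decode n)\<bar>"
    by (auto simp: int_decode_def sum_decode_def real_of_nat_div elim!: evenE oddE)
  then have "(real (n + 1) / 4)\<^sup>2 \<le> (1 / 2 + \<bar>real_of_int (int_decode n)\<bar>)\<^sup>2"
    by (intro power_mono) auto
  then have "1 / (1 / 2 + \<bar>real_of_int (int_decode n)\<bar>)\<^sup>2 \<le> 1 / (real (n + 1) / 4)\<^sup>2"
    by (intro divide_left_mono mult_pos_pos) auto
  also have "1 / (x / 4)\<^sup>2 = 16 * inverse (x\<^sup>2)" for x :: real
    by (simp add: power_divide inverse_eq_divide)
  finally show "norm (1 / (1 / 2 + \<bar>real_of_int (int_decode n)\<bar>)\<^sup>2) \<le> 16 * inverse ((real (n + 1))\<^sup>2)"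
    by simp
qed

lemma summable_on_int_square: "(\<lambda>j::int. 1 / (1 / 2 + \<bar>real_of_int j\<bar>)\<^sup>2) summable_on UNIV"
proof -
  have "(\<lambda>n. 1 / (1 / 2 + \<bar>real_of_int (int_decode n)\<bar>)\<^sup>2) summable_on UNIV"
    using summable_int_decode by (subst summable_on_UNIV_nonneg_real_iff) auto
  then show ?thesis
    using summable_on_reindex_bij_betw[OF bij_int_decode, of "\<lambda>j::int. 1 / (1 / 2 + \<bar>real_of_int j\<bar>)\<^sup>2"] by simp
qed

text \<open>Of the \<open>M + 2\<close> orders of decay, \<open>M\<close> are kept at the distance
  to the nearest integer, which is the least distance occurring in the sum. The other two make the
  sum over the lattice converge, and in these \<open>t \<le> 1\<close> allows \<open>sqrt t\<close>
  to be dropped. The \<open>1 / 2\<close> is what remains of 1 after shifting \<open>y\<close> to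
  its nearest integer.\<close>

lemma lattice_sum_bound:
  fixes f :: "int \<Rightarrow> real"
  assumes t: "0 < t" "t \<le> 1" and K: "0 \<le> K"
    and f: "\<And>j. \<bar>f j\<bar> \<le> K / (1 + \<bar>y + real_of_int j\<bar> / sqrt t) ^ (M + 2)"
  shows "(\<lambda>j. norm (f j)) summable_on UNIV"
    and "\<bar>infsum f UNIV\<bar> \<le> K * infsum (\<lambda>j::int. 1 / (1 / 2 + \<bar>real_of_int j\<bar>)\<^sup>2) UNIV
        / (1 + \<bar>y - of_int (round y)\<bar> / sqrt t) ^ M"
proof -
  define r where "r = \<bar>y - of_int (round y)\<bar>"
  define g where "g = (\<lambda>j::int. 1 / (1 / 2 + \<bar>real_of_int j\<bar>)\<^sup>2)"
  have st: "0 < sqrt t" "sqrt t \<le> 1" using t by auto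
  have le: "\<bar>f j\<bar> \<le> K / (1 + r / sqrt t) ^ M * g (j + round y)" for j
  proof -
    let ?u = "\<bar>y + real_of_int j\<bar>"
    have "r \<le> \<bar>y - of_int (- j)\<bar>" unfolding r_def by (rule round_diff_minimal)
    then have ru: "r \<le> ?u" by simp
    have r12: "r \<le> 1 / 2" using of_int_round_abs_le[of y] by (simp add: r_def abs_minus_commute)
    have "\<bar>real_of_int (j + round y)\<bar> \<le> ?u + r"
      unfolding r_def using abs_triangle_ineq4[of "y + real_of_int j" "y - of_int (round y)"] by simp
    then have "1 / 2 + \<bar>real_of_int (j + round y)\<bar> \<le> 1 + ?u" using r12 by simp
    also have "\<dots> \<le> 1 + ?u / sqrt t" using st by (simp add: pos_le_divide_eq mult_left_le)
    finally have "(1 / 2 + \<bar>real_of_int (j + round y)\<bar>)\<^sup>2 \<le> (1 + ?u / sqrt t)\<^sup>2"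
      by (intro power_mono) auto
    moreover have "(1 + r / sqrt t) ^ M \<le> (1 + ?u / sqrt t) ^ M"
      using ru st by (intro power_mono add_left_mono divide_right_mono) (auto simp: r_def)
    ultimately have "(1 + r / sqrt t) ^ M * (1 / 2 + \<bar>real_of_int (j + round y)\<bar>)\<^sup>2 \<le> (1 + ?u / sqrt t) ^ (M + 2)"
      unfolding power_add using st by (intro mult_mono) (auto simp: r_def)
    moreover have "0 < (1 + r / sqrt t) ^ M * (1 / 2 + \<bar>real_of_int (j + round y)\<bar>)\<^sup>2"
      using st by (intro mult_pos_pos zero_less_power add_pos_nonneg) (auto simp: r_def)
    ultimately have "K / (1 + ?u / sqrt t) ^ (M + 2) \<le> K / ((1 + r / sqrt t) ^ M * (1 / 2 + \<bar>real_of_int (j + round y)\<bar>)\<^sup>2)"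
      by (intro frac_le K order_refl)
    then show ?thesis using f[of j] by (simp add: g_def)
  qed
  have bij: "bij_betw (\<lambda>j. j + round y) UNIV UNIV"
    by (rule bij_betwI[of _ _ _ "\<lambda>j. j - round y"]) auto
  have sg: "(\<lambda>j. g (j + round y)) summable_on UNIV"
    using summable_on_reindex_bij_betw[OF bij, of g] summable_on_int_square by (simp add: g_def)
  then have s: "(\<lambda>j. K / (1 + r / sqrt t) ^ M * g (j + round y)) summable_on UNIV"
    by (rule summable_on_cmult_right)
  show a: "(\<lambda>j. norm (f j)) summable_on UNIV"
    by (rule Infinite_Sum.abs_summable_on_comparison_test'[OF s]) (use le in auto)
  have "\<bar>infsum f UNIV\<bar> \<le> infsum (\<lambda>j. \<bar>f j\<bar>) UNIV"
    using Infinite_Sum.norm_infsum_bound[OF a] by simp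
  also have "\<dots> \<le> infsum (\<lambda>j. K / (1 + r / sqrt t) ^ M * g (j + round y)) UNIV"
    using a s le by (intro infsum_mono) auto
  also have "\<dots> = K / (1 + r / sqrt t) ^ M * infsum (\<lambda>j. g (j + round y)) UNIV"
    by (rule infsum_cmult_right) (use sg in auto)
  also have "infsum (\<lambda>j. g (j + round y)) UNIV = infsum g UNIV"
    by (rule infsum_reindex_bij_betw[OF bij])
  finally show "\<bar>infsum f UNIV\<bar> \<le> K * infsum (\<lambda>j::int. 1 / (1 / 2 + \<bar>real_of_int j\<bar>)\<^sup>2) UNIV
        / (1 + \<bar>y - of_int (round y)\<bar> / sqrt t) ^ M"
    by (simp add: g_def r_def)
qed

text \<open>The \<open>k\<close>-th derivative of the heat kernel on the circle.\<close>

definition Th :: "nat \<Rightarrow> real \<Rightarrow> real \<Rightarrow> real" where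
  "Th k t y = (\<Sum>\<^sub>\<infinity>j. hk k t (y + real_of_int j))"

lemma hk_abs_summable:
  assumes "0 < t" "t \<le> 1"
  shows "(\<lambda>j. norm (hk k t (y + real_of_int j))) summable_on UNIV"
proof -
  obtain C where "C \<ge> 0" "\<And>t y. 0 < t \<Longrightarrow> \<bar>hk k t y\<bar> \<le> C * t powr (- real (k + 1) / 2) / (1 + \<bar>y\<bar> / sqrt t) ^ (0 + 2)"
    using hk_bound by blast
  then show ?thesis using assms by (intro lattice_sum_bound(1)[OF assms, of "C * t powr (- real (k + 1) / 2)" _ y 0]) auto
qed

lemma Th_bound:
  "\<exists>C\<ge>0. \<forall>t y. 0 < t \<longrightarrow> t \<le> 1 \<longrightarrow>
    \<bar>Th k t y\<bar> \<le> C * t powr (- real (k + 1) / 2) / (1 + \<bar>y - of_int (round y)\<bar> / sqrt t) ^ M"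
proof -
  let ?S = "infsum (\<lambda>j::int. 1 / (1 / 2 + \<bar>real_of_int j\<bar>)\<^sup>2) UNIV"
  have S: "0 \<le> ?S" by (intro infsum_nonneg) auto
  obtain C where C: "C \<ge> 0" "\<And>t y. 0 < t \<Longrightarrow> \<bar>hk k t y\<bar> \<le> C * t powr (- real (k + 1) / 2) / (1 + \<bar>y\<bar> / sqrt t) ^ (M + 2)"
    using hk_bound by blast
  show ?thesis
  proof (intro exI[of _ "C * ?S"] conjI allI impI)
    show "0 \<le> C * ?S" using C(1) S by simp
    fix t y :: real assume t: "0 < t" "t \<le> 1"
    show "\<bar>Th k t y\<bar> \<le> C * ?S * t powr (- real (k + 1) / 2) / (1 + \<bar>y - of_int (round y)\<bar> / sqrt t) ^ M"
      using lattice_sum_bound(2)[OF t, of "C * t powr (- real (k + 1) / 2)" "\<lambda>j. hk k t (y + real_of_int j)" y M] C t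
      by (simp add: Th_def mult_ac)
  qed
qed

lemma Th_diff_bound:
  "\<exists>C\<ge>0. \<forall>s t y. 0 < s \<longrightarrow> s \<le> t \<longrightarrow> t \<le> 1 \<longrightarrow>
    \<bar>Th k t y - Th k s y\<bar> \<le> C * (t - s) * s powr (- real (k + 1) / 2 - 1) / (1 + \<bar>y - of_int (round y)\<bar> / sqrt t) ^ M"
proof -
  let ?S = "infsum (\<lambda>j::int. 1 / (1 / 2 + \<bar>real_of_int j\<bar>)\<^sup>2) UNIV"
  have S: "0 \<le> ?S" by (intro infsum_nonneg) auto
  obtain C where C: "C \<ge> 0" "\<And>s t y. 0 < s \<Longrightarrow> s \<le> t \<Longrightarrow>
      \<bar>hk k t y - hk k s y\<bar> \<le> C * (t - s) * s powr (- real (k + 1) / 2 - 1) / (1 + \<bar>y\<bar> / sqrt t) ^ (M + 2)"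
    using hk_diff_bound by blast
  show ?thesis
  proof (intro exI[of _ "C * ?S"] conjI allI impI)
    show "0 \<le> C * ?S" using C(1) S by simp
    fix s t y :: real assume s: "0 < s" "s \<le> t" "t \<le> 1"
    have t: "0 < t" "s \<le> 1" using s by auto
    have "(\<lambda>j. hk k t (y + real_of_int j)) summable_on UNIV" "(\<lambda>j. hk k s (y + real_of_int j)) summable_on UNIV"
      using hk_abs_summable[of _ k y] s t by (auto intro: Infinite_Sum.abs_summable_summable)
    then have "Th k t y - Th k s y = (\<Sum>\<^sub>\<infinity>j. hk k t (y + real_of_int j) - hk k s (y + real_of_int j))"
      unfolding Th_def
      using infsum_add[of "\<lambda>j. hk k t (y + real_of_int j)" UNIV "\<lambda>j. - hk k s (y + real_of_int j)"]
      by (simp add: infsum_uminus summable_on_uminus)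
    then show "\<bar>Th k t y - Th k s y\<bar> \<le> C * ?S * (t - s) * s powr (- real (k + 1) / 2 - 1) / (1 + \<bar>y - of_int (round y)\<bar> / sqrt t) ^ M"
      using lattice_sum_bound(2)[OF t(1) s(3), of "C * (t - s) * s powr (- real (k + 1) / 2 - 1)"
          "\<lambda>j. hk k t (y + real_of_int j) - hk k s (y + real_of_int j)" y M] C s
      by (simp add: mult_ac)
  qed
qed

text \<open>The unordered sum is enumerated as a series, the setting in which it is differentiated
  term by term.\<close>

lemma Th_suminf:
  assumes "0 < t" "t \<le> 1"
  shows "summable (\<lambda>n. hk k t (y + real_of_int (int_decode n)))"
    "Th k t y = (\<Sum>n. hk k t (y + real_of_int (int_decode n)))"
proof -
  have "(\<lambda>n. norm (hk k t (y + real_of_int (int_decode n)))) summable_on UNIV"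
    by (rule iffD2[OF summable_on_reindex_bij_betw[OF bij_int_decode, of "\<lambda>j. norm (hk k t (y + real_of_int j))"]
      hk_abs_summable[OF assms]])
  then have "((\<lambda>n. hk k t (y + real_of_int (int_decode n))) has_sum infsum (\<lambda>n. hk k t (y + real_of_int (int_decode n))) UNIV) UNIV"
    by (rule has_sum_infsum[OF Infinite_Sum.abs_summable_summable])
  then have "(\<lambda>n. hk k t (y + real_of_int (int_decode n))) sums infsum (\<lambda>n. hk k t (y + real_of_int (int_decode n))) UNIV"
    by (rule has_sum_imp_sums)
  moreover have "infsum (\<lambda>n. hk k t (y + real_of_int (int_decode n))) UNIV = Th k t y"
    unfolding Th_def by (rule infsum_reindex_bij_betw[OF bij_int_decode, of "\<lambda>j. hk k t (y + real_of_int j)"])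
  ultimately show "summable (\<lambda>n. hk k t (y + real_of_int (int_decode n)))"
    "Th k t y = (\<Sum>n. hk k t (y + real_of_int (int_decode n)))"
    by (auto simp: sums_iff)
qed

text \<open>Termwise differentiation on an interval around \<open>y\<close>, where the
  differentiated series has a summable majorant independent of the point.\<close>

lemma Th_deriv:
  assumes t: "0 < t" "t \<le> 1"
  shows "(Th k t has_real_derivative Th (Suc k) t y) (at y)"
proof -
  define A where "A = \<bar>y\<bar> + 1"
  obtain C where C: "C \<ge> 0" "\<And>t y. 0 < t \<Longrightarrow> \<bar>hk (Suc k) t y\<bar> \<le> C * t powr (- real (Suc k + 1) / 2) / (1 + \<bar>y\<bar> / sqrt t) ^ 2"
    using hk_bound by blast
  \<comment> \<open>On the interval \<open>1 / 2 + \<bar>j\<bar>\<close> is at most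
    \<open>(1 + A) * (1 + \<bar>x + j\<bar>)\<close>. The square of the first factor is the price of
    a majorant in which \<open>x\<close> no longer occurs.\<close>
  define K where "K = C * t powr (- real (Suc k + 1) / 2) * (1 + A)\<^sup>2"
  have A: "0 \<le> A" by (simp add: A_def)
  have bound: "\<bar>hk (Suc k) t (x + real_of_int j)\<bar> \<le> K * (1 / (1 / 2 + \<bar>real_of_int j\<bar>)\<^sup>2)"
    if "x \<in> {y - 1..y + 1}" for x j
  proof -
    have x: "\<bar>x\<bar> \<le> A" using that by (auto simp: A_def)
    let ?u = "\<bar>x + real_of_int j\<bar>"
    have "1 / 2 + \<bar>real_of_int j\<bar> \<le> (1 + A) + ?u" using x by linarith
    also have "\<dots> \<le> (1 + A) * (1 + ?u)" using A by (simp add: algebra_simps)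
    also have "\<dots> \<le> (1 + A) * (1 + ?u / sqrt t)"
      using t A by (intro mult_left_mono add_left_mono) (auto simp: pos_le_divide_eq mult_left_le)
    finally have "(1 / 2 + \<bar>real_of_int j\<bar>)\<^sup>2 \<le> ((1 + A) * (1 + ?u / sqrt t))\<^sup>2" by (intro power_mono) auto
    then have "1 / (1 + ?u / sqrt t)\<^sup>2 \<le> (1 + A)\<^sup>2 * (1 / (1 / 2 + \<bar>real_of_int j\<bar>)\<^sup>2)"
    proof -
      assume le: "(1 / 2 + \<bar>real_of_int j\<bar>)\<^sup>2 \<le> ((1 + A) * (1 + ?u / sqrt t))\<^sup>2"
      have p: "0 < (1 + ?u / sqrt t)\<^sup>2" "0 < (1 / 2 + \<bar>real_of_int j\<bar>)\<^sup>2"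
        using t by (intro zero_less_power add_pos_nonneg; simp)+
      have "1 / w \<le> a * (1 / v)" if "v \<le> a * w" "0 < w" "0 < v" for a v w :: real
        using that by (simp add: field_simps)
      from this[OF le[unfolded power_mult_distrib] p] show ?thesis .
    qed
    then have "C * t powr (- real (Suc k + 1) / 2) * (1 / (1 + ?u / sqrt t)\<^sup>2)
        \<le> C * t powr (- real (Suc k + 1) / 2) * ((1 + A)\<^sup>2 * (1 / (1 / 2 + \<bar>real_of_int j\<bar>)\<^sup>2))"
      using C(1) by (intro mult_left_mono) auto
    then show ?thesis using C(2)[OF t(1), of "x + real_of_int j"] by (simp add: K_def mult_ac)
  qed
  have "((\<lambda>x. \<Sum>n. hk k t (x + real_of_int (int_decode n))) has_real_derivative
      (\<Sum>n. hk (Suc k) t (y + real_of_int (int_decode n)))) (at y)"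
  proof (rule has_field_derivative_series'(2)[of "{y - 1..y + 1}" _ _ y])
    fix n x assume "x \<in> {y - 1..y + 1}"
    have "((\<lambda>x. hk k t (x + real_of_int (int_decode n))) has_real_derivative hk (Suc k) t (x + real_of_int (int_decode n)) * 1) (at x)"
      by (rule DERIV_chain2[OF hk_deriv[OF t(1)]]) (auto intro!: derivative_eq_intros)
    then show "((\<lambda>x. hk k t (x + real_of_int (int_decode n))) has_real_derivative hk (Suc k) t (x + real_of_int (int_decode n)))
        (at x within {y - 1..y + 1})"
      by (simp add: has_field_derivative_at_within)
  next
    show "uniformly_convergent_on {y - 1..y + 1} (\<lambda>n x. \<Sum>i<n. hk (Suc k) t (x + real_of_int (int_decode i)))"
    proof (rule Weierstrass_m_test')
      show "summable (\<lambda>n. K * (1 / (1 / 2 + \<bar>real_of_int (int_decode n)\<bar>)\<^sup>2))"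
        by (intro summable_mult summable_int_decode)
    qed (use bound in auto)
    show "summable (\<lambda>n. hk k t (y + real_of_int (int_decode n)))" by (rule Th_suminf(1)[OF t])
  qed auto
  moreover have "Th k t = (\<lambda>x. \<Sum>n. hk k t (x + real_of_int (int_decode n)))"
    by (rule ext) (rule Th_suminf(2)[OF t])
  ultimately show ?thesis using Th_suminf(2)[OF t, of "Suc k" y] by simp
qed

section \<open>From the circle to the torus\<close>

lemma heat_eq_prod_Th:
  fixes x :: "real ^ 'n::finite"
  assumes t: "0 < t" "t \<le> 1"
  shows "heat t x = (\<Prod>i\<in>UNIV. Th 0 t (x $ i))"
proof -
  have summand: "(4 * pi * t) powr (- real CARD('n) / 2) * exp (- (norm (x + (\<chi> i. of_int (m $ i))))\<^sup>2 / (4 * t))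
      = (\<Prod>i\<in>UNIV. hk 0 t (x $ i + real_of_int (m $ i)))" for m :: "int ^ 'n"
  proof -
    have hk0: "hk 0 t y = (4 * pi * t) powr (- 1 / 2) * exp (- y\<^sup>2 / (4 * t))" for y
    proof -
      have "(4 * pi * t) powr (- 1 / 2) = (4 * pi) powr (- 1 / 2) * t powr (- 1 / 2)"
        by (rule powr_mult)
      moreover have "(y / sqrt t)\<^sup>2 = y\<^sup>2 / t" using t by (simp add: power_divide)
      ultimately show ?thesis by (simp add: hk_def gk_def mult_ac)
    qed
    have "(norm (x + (\<chi> i. of_int (m $ i))))\<^sup>2 = (\<Sum>i\<in>UNIV. (x $ i + real_of_int (m $ i))\<^sup>2)"
      by (simp add: norm_vec_def L2_set_def sum_nonneg)
    then have "exp (- (norm (x + (\<chi> i. of_int (m $ i))))\<^sup>2 / (4 * t))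
        = (\<Prod>i\<in>UNIV. exp (- (x $ i + real_of_int (m $ i))\<^sup>2 / (4 * t)))"
      by (simp add: exp_sum[symmetric] sum_negf sum_divide_distrib)
    moreover have "(4 * pi * t) powr (- real CARD('n) / 2) = (\<Prod>i\<in>(UNIV :: 'n set). (4 * pi * t) powr (- 1 / 2))"
      using t by (simp add: powr_power)
    ultimately show ?thesis by (simp add: hk0 prod.distrib)
  qed
  \<comment> \<open>Lattice vectors are read as functions on the coordinates. Over such a product
    index set an absolutely convergent sum of products is the product of the one-dimensional
    sums.\<close>
  have bij: "bij_betw (\<lambda>m :: int ^ 'n. (\<lambda>i. m $ i)) UNIV (PiE UNIV (\<lambda>_. UNIV))"
    by (rule bij_betwI[of _ _ _ vec_lambda]) (auto simp: vec_lambda_eta)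
  have "heat t x = (\<Sum>\<^sub>\<infinity>m::int ^ 'n. \<Prod>i\<in>UNIV. hk 0 t (x $ i + real_of_int (m $ i)))"
    unfolding heat_def summand ..
  also have "\<dots> = (\<Sum>\<^sub>\<infinity>g\<in>PiE UNIV (\<lambda>_. UNIV). \<Prod>i\<in>UNIV. hk 0 t (x $ i + real_of_int (g i)))"
    by (rule infsum_reindex_bij_betw[OF bij, of "\<lambda>g. \<Prod>i\<in>UNIV. hk 0 t (x $ i + real_of_int (g i))"])
  also have "\<dots> = (\<Prod>i\<in>UNIV. infsum (\<lambda>j. hk 0 t (x $ i + real_of_int j)) UNIV)"
    by (rule infsum_prod_PiE_abs) (use hk_abs_summable[OF t] in auto)
  finally show ?thesis by (simp add: Th_def)
qed

lemma pdiff_prod_Th: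
  fixes x :: "real ^ 'n::finite"
  assumes t: "0 < t" "t \<le> 1"
  shows "pdiff i (\<lambda>x. \<Prod>j\<in>UNIV. Th (a j) t (x $ j)) x = (\<Prod>j\<in>UNIV. Th ((a(i := Suc (a i))) j) t (x $ j))"
proof -
  let ?P = "\<Prod>j\<in>UNIV - {i}. Th (a j) t (x $ j)"
  have split: "(\<Prod>j\<in>UNIV. f j) = f i * (\<Prod>j\<in>UNIV - {i}. f j)" for f :: "'n \<Rightarrow> real"
    by (rule prod.remove) auto
  have "(\<lambda>h. \<Prod>j\<in>UNIV. Th (a j) t ((x + h *\<^sub>R axis i 1) $ j)) = (\<lambda>h. Th (a i) t (x $ i + h) * ?P)"
  proof
    fix h
    have "(\<Prod>j\<in>UNIV - {i}. Th (a j) t ((x + h *\<^sub>R axis i 1) $ j)) = ?P"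
      by (intro prod.cong) (auto simp: axis_def)
    then show "(\<Prod>j\<in>UNIV. Th (a j) t ((x + h *\<^sub>R axis i 1) $ j)) = Th (a i) t (x $ i + h) * ?P"
      by (subst split) (simp add: axis_def)
  qed
  moreover have "((\<lambda>h. Th (a i) t (x $ i + h) * ?P) has_real_derivative Th (Suc (a i)) t (x $ i) * ?P) (at 0)"
  proof -
    have "((\<lambda>h. Th (a i) t (x $ i + h)) has_real_derivative Th (Suc (a i)) t (x $ i + 0) * 1) (at 0)"
      by (rule DERIV_chain2[OF Th_deriv[OF t]]) (auto intro!: derivative_eq_intros)
    then show ?thesis by (intro DERIV_cmult_right) simp
  qed
  ultimately have "pdiff i (\<lambda>x. \<Prod>j\<in>UNIV. Th (a j) t (x $ j)) x = Th (Suc (a i)) t (x $ i) * ?P"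
    unfolding pdiff_def by (simp add: DERIV_imp_deriv)
  also have "?P = (\<Prod>j\<in>UNIV - {i}. Th ((a(i := Suc (a i))) j) t (x $ j))"
    by (intro prod.cong) auto
  finally show ?thesis by (subst split) simp
qed

text \<open>A partial derivative only raises the order of one factor, so the result depends on the
  multiplicities in the list of directions and not on their order. This makes the choice in
  \<open>heatD\<close> harmless.\<close>

lemma heatD_eq_prod_Th:
  fixes x :: "real ^ 'n::finite"
  assumes t: "0 < t" "t \<le> 1"
  shows "heatD k t x = (\<Prod>i\<in>UNIV. Th (k $ i) t (x $ i))"
proof -
  have fold: "foldr pdiff ks (heat t) = (\<lambda>x :: real ^ 'n. \<Prod>i\<in>UNIV. Th (count (mset ks) i) t (x $ i))" for ks
  proof (induction ks)
    case Nil
    show ?case using heat_eq_prod_Th[OF t] by auto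
  next
    case (Cons i ks)
    have "count (mset (i # ks)) = (count (mset ks))(i := Suc (count (mset ks) i))" by auto
    then show ?case using pdiff_prod_Th[OF t, of i "count (mset ks)"] by (simp only: foldr.simps o_apply Cons.IH)
  qed
  \<comment> \<open>A list with the prescribed multiplicities exists, so the chosen list has them
    too.\<close>
  obtain ks where "mset ks = (\<Sum>i\<in>UNIV. replicate_mset (k $ i) i)" using ex_mset by blast
  then have "\<forall>i. count (mset ks) i = k $ i" by (simp add: count_sum)
  then have "\<forall>i. count (mset (SOME ks. \<forall>i. count (mset ks) i = k $ i)) i = k $ i"
    by (rule someI[where P = "\<lambda>ks. \<forall>i. count (mset ks) i = k $ i"])
  then show ?thesis unfolding heatD_def fold by simp
qed

lemma one_plus_sum_le_prod:
  fixes a :: "'a \<Rightarrow> real"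
  assumes "finite A" "\<And>i. i \<in> A \<Longrightarrow> 0 \<le> a i"
  shows "1 + sum a A \<le> (\<Prod>i\<in>A. 1 + a i)"
  using assms
proof (induction A)
  case (insert i A)
  have "1 + sum a A \<le> (\<Prod>i\<in>A. 1 + a i)" using insert by auto
  then have "(1 + a i) * (1 + sum a A) \<le> (1 + a i) * (\<Prod>i\<in>A. 1 + a i)"
    using insert.prems by (intro mult_left_mono) auto
  moreover have "1 + sum a (insert i A) \<le> (1 + a i) * (1 + sum a A)"
    using insert by (simp add: algebra_simps sum_nonneg)
  ultimately show ?case using insert by simp
qed simp

text \<open>Each coordinate carries the full order \<open>2 * CARD('n)\<close>. The product over the
  coordinates is compared with the decay in the norm through
  \<open>1 + (\<Sum>i. a i) \<le> (\<Prod>i. 1 + a i)\<close>, so no order can be saved.\<close>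

definition decay :: "real \<Rightarrow> real ^ 'n::finite \<Rightarrow> 'n \<Rightarrow> real" where
  "decay t x i = 1 / (1 + \<bar>x $ i - of_int (round (x $ i))\<bar> / sqrt t) ^ (2 * CARD('n))"

lemma decay_pos: "0 < t \<Longrightarrow> 0 < decay t x i"
  unfolding decay_def by (intro divide_pos_pos zero_less_power add_pos_nonneg) auto

lemma decay_mono: "0 < s \<Longrightarrow> s \<le> t \<Longrightarrow> decay s x i \<le> decay t x i"
  unfolding decay_def
  by (intro divide_left_mono power_mono add_left_mono mult_pos_pos zero_less_power add_pos_nonneg) auto

lemma prod_decay_le:
  fixes x :: "real ^ 'n::finite"
  assumes t: "0 < t"
  shows "(\<Prod>i\<in>UNIV. decay t x i) \<le> (1 + tnorm x / sqrt t) powr (- 2 * real CARD('n))"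
proof -
  let ?a = "\<lambda>i. \<bar>x $ i - of_int (round (x $ i))\<bar> / sqrt t" and ?N = "2 * CARD('n)"
  have w: "0 < 1 + tnorm x / sqrt t" using t by (intro add_pos_nonneg) auto
  have "tnorm x \<le> (\<Sum>i\<in>UNIV. \<bar>x $ i - of_int (round (x $ i))\<bar>)"
    unfolding tnorm_eq_norm_cen using norm_le_l1_cart[of "cen x"] by (simp add: cen_def)
  then have "tnorm x / sqrt t \<le> (\<Sum>i\<in>UNIV. ?a i)"
    using t by (simp add: sum_divide_distrib[symmetric] divide_right_mono)
  then have "1 + tnorm x / sqrt t \<le> (\<Prod>i\<in>UNIV. 1 + ?a i)"
    using one_plus_sum_le_prod[of UNIV ?a] t by simp
  then have "(1 + tnorm x / sqrt t) ^ ?N \<le> (\<Prod>i\<in>UNIV. 1 + ?a i) ^ ?N"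
    using w by (intro power_mono) auto
  then have "1 / (\<Prod>i\<in>UNIV. 1 + ?a i) ^ ?N \<le> 1 / (1 + tnorm x / sqrt t) ^ ?N"
    using w by (intro frac_le) auto
  moreover have "(\<Prod>i\<in>UNIV. decay t x i) = 1 / (\<Prod>i\<in>UNIV. 1 + ?a i) ^ ?N"
    by (simp add: decay_def prod_dividef prod_power_distrib)
  moreover have "(1 + tnorm x / sqrt t) powr (- 2 * real CARD('n)) = 1 / (1 + tnorm x / sqrt t) ^ ?N"
  proof -
    have "(1 + tnorm x / sqrt t) powr (- real ?N) = 1 / (1 + tnorm x / sqrt t) ^ ?N"
      using w by (simp only: powr_minus_divide powr_realpow)
    then show ?thesis by simp
  qed
  ultimately show ?thesis by simp
qed

lemma prod_heat_powr:
  fixes k :: "nat ^ 'n::finite"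
  assumes "0 < s"
  shows "(\<Prod>i\<in>UNIV. s powr (- real (k $ i + 1) / 2)) = s powr (- kabs k / 2) * s powr (- real CARD('n) / 2)"
proof -
  have "(\<Prod>i\<in>UNIV. s powr (- real (k $ i + 1) / 2)) = s powr (\<Sum>i\<in>UNIV. - real (k $ i + 1) / 2)"
    using assms by (simp add: powr_sum)
  also have "(\<Sum>i\<in>UNIV. - real (k $ i + 1) / 2) = - kabs k / 2 + - real CARD('n) / 2"
    by (simp add: kabs_def sum_divide_distrib[symmetric] sum_negf sum.distrib add_divide_distrib sum_subtractf)
  finally show ?thesis by (simp only: powr_add)
qed

lemma heatD_bound:
  fixes k :: "nat ^ 'n::finite"
  shows "\<exists>C\<ge>0. \<forall>t x. 0 < t \<longrightarrow> t \<le> 1 \<longrightarrow>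
    \<bar>heatD k t x\<bar> \<le> C * t powr (- kabs k / 2) * pk CARD('n) t (tnorm x)"
proof -
  have "\<forall>i. \<exists>C. C \<ge> 0 \<and> (\<forall>t (x :: real ^ 'n). 0 < t \<longrightarrow> t \<le> 1 \<longrightarrow>
      \<bar>Th (k $ i) t (x $ i)\<bar> \<le> C * (t powr (- real (k $ i + 1) / 2) * decay t x i))"
  proof
    fix i
    obtain C where "C \<ge> 0" "\<And>t y. 0 < t \<Longrightarrow> t \<le> 1 \<Longrightarrow> \<bar>Th (k $ i) t y\<bar> \<le> C * t powr (- real (k $ i + 1) / 2)
        / (1 + \<bar>y - of_int (round y)\<bar> / sqrt t) ^ (2 * CARD('n))"
      using Th_bound by blast
    then show "\<exists>C. C \<ge> 0 \<and> (\<forall>t (x :: real ^ 'n). 0 < t \<longrightarrow> t \<le> 1 \<longrightarrow>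
      \<bar>Th (k $ i) t (x $ i)\<bar> \<le> C * (t powr (- real (k $ i + 1) / 2) * decay t x i))"
      by (intro exI[of _ C]) (simp add: decay_def)
  qed
  from choice[OF this] obtain C where C: "\<And>i. C i \<ge> 0" "\<And>i t (x :: real ^ 'n). 0 < t \<Longrightarrow> t \<le> 1 \<Longrightarrow>
      \<bar>Th (k $ i) t (x $ i)\<bar> \<le> C i * (t powr (- real (k $ i + 1) / 2) * decay t x i)"
    by blast
  show ?thesis
  proof (intro exI[of _ "\<Prod>i\<in>UNIV. C i"] conjI allI impI)
    show "0 \<le> (\<Prod>i\<in>UNIV. C i)" by (intro prod_nonneg) (use C in auto)
    fix t :: real and x :: "real ^ 'n" assume t: "0 < t" "t \<le> 1"
    have "\<bar>heatD k t x\<bar> = (\<Prod>i\<in>UNIV. \<bar>Th (k $ i) t (x $ i)\<bar>)"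
      by (simp add: heatD_eq_prod_Th[OF t] abs_prod)
    also have "\<dots> \<le> (\<Prod>i\<in>UNIV. C i * (t powr (- real (k $ i + 1) / 2) * decay t x i))"
      by (intro prod_mono) (use C t in auto)
    also have "\<dots> = (\<Prod>i\<in>UNIV. C i) * ((\<Prod>i\<in>UNIV. t powr (- real (k $ i + 1) / 2)) * (\<Prod>i\<in>UNIV. decay t x i))"
      by (simp only: prod.distrib)
    also have "\<dots> \<le> (\<Prod>i\<in>UNIV. C i) * ((\<Prod>i\<in>UNIV. t powr (- real (k $ i + 1) / 2)) * (1 + tnorm x / sqrt t) powr (- 2 * real CARD('n)))"
      by (intro mult_left_mono prod_decay_le t prod_nonneg) (use C in auto)
    also have "\<dots> = (\<Prod>i\<in>UNIV. C i) * t powr (- kabs k / 2) * pk CARD('n) t (tnorm x)"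
      unfolding prod_heat_powr[OF t(1)] pk_def by (simp only: mult.assoc)
    finally show "\<bar>heatD k t x\<bar> \<le> (\<Prod>i\<in>UNIV. C i) * t powr (- kabs k / 2) * pk CARD('n) t (tnorm x)" .
  qed
qed

text \<open>Both products are normalised by a common envelope \<open>E\<close>. All factors then
  have modulus at most 1, so the products differ by at most the sum of the differences of their
  factors, each of size \<open>(t - s) / s\<close>. The envelope takes the power at the earlier and
  the decay at the later time, which dominates both kernels.\<close>

lemma heatD_diff_bound:
  fixes k :: "nat ^ 'n::finite"
  shows "\<exists>C\<ge>0. \<forall>s t x. 0 < s \<longrightarrow> s \<le> t \<longrightarrow> t \<le> 2 * s \<longrightarrow> t \<le> 1 \<longrightarrow>
    \<bar>heatD k t x - heatD k s x\<bar> \<le> C * ((t - s) / s) * s powr (- kabs k / 2) * pk CARD('n) t (tnorm x)"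
proof -
  let ?D = "\<lambda>s t (x :: real ^ 'n) i. s powr (- real (k $ i + 1) / 2) * decay t x i"
  have "\<forall>i. \<exists>C. C \<ge> 0 \<and> (\<forall>t (x :: real ^ 'n). 0 < t \<longrightarrow> t \<le> 1 \<longrightarrow> \<bar>Th (k $ i) t (x $ i)\<bar> \<le> C * ?D t t x i)
      \<and> (\<forall>s t (x :: real ^ 'n). 0 < s \<longrightarrow> s \<le> t \<longrightarrow> t \<le> 1 \<longrightarrow>
          \<bar>Th (k $ i) t (x $ i) - Th (k $ i) s (x $ i)\<bar> \<le> C * ((t - s) / s * ?D s t x i))"
  proof
    fix i
    obtain C0 where C0: "C0 \<ge> 0" "\<And>t y. 0 < t \<Longrightarrow> t \<le> 1 \<Longrightarrow> \<bar>Th (k $ i) t y\<bar> \<le> C0 * t powr (- real (k $ i + 1) / 2)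
        / (1 + \<bar>y - of_int (round y)\<bar> / sqrt t) ^ (2 * CARD('n))"
      using Th_bound by blast
    obtain C1 where C1: "C1 \<ge> 0" "\<And>s t y. 0 < s \<Longrightarrow> s \<le> t \<Longrightarrow> t \<le> 1 \<Longrightarrow> \<bar>Th (k $ i) t y - Th (k $ i) s y\<bar>
        \<le> C1 * (t - s) * s powr (- real (k $ i + 1) / 2 - 1) / (1 + \<bar>y - of_int (round y)\<bar> / sqrt t) ^ (2 * CARD('n))"
      using Th_diff_bound by blast
    show "\<exists>C. C \<ge> 0 \<and> (\<forall>t (x :: real ^ 'n). 0 < t \<longrightarrow> t \<le> 1 \<longrightarrow> \<bar>Th (k $ i) t (x $ i)\<bar> \<le> C * ?D t t x i)
      \<and> (\<forall>s t (x :: real ^ 'n). 0 < s \<longrightarrow> s \<le> t \<longrightarrow> t \<le> 1 \<longrightarrow>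
          \<bar>Th (k $ i) t (x $ i) - Th (k $ i) s (x $ i)\<bar> \<le> C * ((t - s) / s * ?D s t x i))"
    proof (intro exI[of _ "C0 + C1"] conjI allI impI)
      show "0 \<le> C0 + C1" using C0 C1 by simp
      fix t :: real and x :: "real ^ 'n" assume t: "0 < t" "t \<le> 1"
      have "\<bar>Th (k $ i) t (x $ i)\<bar> \<le> C0 * ?D t t x i"
        using C0(2)[OF t, of "x $ i"] by (simp add: decay_def)
      also have "\<dots> \<le> (C0 + C1) * ?D t t x i"
        using C1 decay_pos[OF t(1), of x i] by (intro mult_right_mono mult_nonneg_nonneg) auto
      finally show "\<bar>Th (k $ i) t (x $ i)\<bar> \<le> (C0 + C1) * ?D t t x i" .
    next
      fix s t :: real and x :: "real ^ 'n" assume s: "0 < s" "s \<le> t" "t \<le> 1"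
      have "s powr (- real (k $ i + 1) / 2 - 1) = s powr (- real (k $ i + 1) / 2) / s"
        using s by (simp only: powr_diff powr_one less_imp_le)
      then have "\<bar>Th (k $ i) t (x $ i) - Th (k $ i) s (x $ i)\<bar> \<le> C1 * ((t - s) / s * ?D s t x i)"
        using C1(2)[OF s, of "x $ i"] by (simp add: decay_def mult_ac)
      also have "\<dots> \<le> (C0 + C1) * ((t - s) / s * ?D s t x i)"
        using C0 s decay_pos[of t x i] by (intro mult_right_mono mult_nonneg_nonneg divide_nonneg_nonneg) auto
      finally show "\<bar>Th (k $ i) t (x $ i) - Th (k $ i) s (x $ i)\<bar> \<le> (C0 + C1) * ((t - s) / s * ?D s t x i)" .
    qed
  qed
  from choice[OF this] obtain C where C: "\<And>i. C i \<ge> 0"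
    "\<And>i t (x :: real ^ 'n). 0 < t \<Longrightarrow> t \<le> 1 \<Longrightarrow> \<bar>Th (k $ i) t (x $ i)\<bar> \<le> C i * ?D t t x i"
    "\<And>i s t (x :: real ^ 'n). 0 < s \<Longrightarrow> s \<le> t \<Longrightarrow> t \<le> 1 \<Longrightarrow>
          \<bar>Th (k $ i) t (x $ i) - Th (k $ i) s (x $ i)\<bar> \<le> C i * ((t - s) / s * ?D s t x i)"
    by blast
  \<comment> \<open>The added 1 makes the envelope strictly positive, since it is divided
    by.\<close>
  define K where "K i = C i + 1" for i
  have K: "0 < K i" "C i \<le> K i" for i using C(1)[of i] by (auto simp: K_def)
  define KK where "KK = (\<Prod>i\<in>UNIV. K i)"
  have KK: "0 < KK" unfolding KK_def by (intro prod_pos) (use K in auto)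
  let ?c = "KK * real CARD('n) * 2 powr (real CARD('n) / 2)"
  show ?thesis
  proof (intro exI[of _ ?c] conjI allI impI)
    show "0 \<le> ?c" using KK by simp
    fix s t :: real and x :: "real ^ 'n" assume s: "0 < s" "s \<le> t" "t \<le> 2 * s" "t \<le> 1"
    have t: "0 < t" "s \<le> 1" using s by auto
    define E where "E i = K i * ?D s t x i" for i
    have E: "0 < E i" for i unfolding E_def using K s t decay_pos[OF t(1)] by (intro mult_pos_pos) auto
    have CE: "C i * ?D s t x i \<le> E i" for i
      unfolding E_def using K decay_pos[OF t(1), of x i] by (intro mult_right_mono mult_nonneg_nonneg) auto
    have Dt: "?D t t x i \<le> ?D s t x i" "?D s s x i \<le> ?D s t x i" for i
      using s t decay_pos[OF t(1), of x i] decay_mono[OF s(1,2), of x i]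
      by (auto intro!: mult_right_mono mult_left_mono powr_mono2')
    let ?A = "\<lambda>i. Th (k $ i) t (x $ i) / E i" and ?B = "\<lambda>i. Th (k $ i) s (x $ i) / E i"
    have A: "norm (?A i) \<le> 1" for i
    proof -
      have "\<bar>Th (k $ i) t (x $ i)\<bar> \<le> C i * ?D s t x i"
        using C(2)[OF t(1) s(4), of i x] mult_left_mono[OF Dt(1)[of i] C(1)[of i]] by linarith
      then have "\<bar>Th (k $ i) t (x $ i)\<bar> \<le> E i" using CE[of i] by linarith
      then show ?thesis using E[of i] by simp
    qed
    have B: "norm (?B i) \<le> 1" for i
    proof -
      have "\<bar>Th (k $ i) s (x $ i)\<bar> \<le> C i * ?D s t x i"
        using C(2)[OF s(1) t(2), of i x] mult_left_mono[OF Dt(2)[of i] C(1)[of i]] by linarith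
      then have "\<bar>Th (k $ i) s (x $ i)\<bar> \<le> E i" using CE[of i] by linarith
      then show ?thesis using E[of i] by simp
    qed
    have AB: "norm (?A i - ?B i) \<le> (t - s) / s" for i
    proof -
      have "\<bar>Th (k $ i) t (x $ i) - Th (k $ i) s (x $ i)\<bar> \<le> (t - s) / s * (C i * ?D s t x i)"
        using C(3)[OF s(1,2,4), of i x] by (simp only: mult.left_commute)
      also have "\<dots> \<le> (t - s) / s * E i"
        using s by (intro mult_left_mono CE) auto
      finally show ?thesis using E[of i] by (simp add: diff_divide_distrib[symmetric] abs_divide pos_divide_le_eq)
    qed
    have "norm ((\<Prod>i\<in>UNIV. ?A i) - (\<Prod>i\<in>UNIV. ?B i)) \<le> (\<Sum>i\<in>UNIV. norm (?A i - ?B i))"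
      by (intro norm_prod_diff A B)
    also have "\<dots> \<le> (\<Sum>i\<in>(UNIV :: 'n set). (t - s) / s)" by (intro sum_mono AB)
    finally have AB': "\<bar>(\<Prod>i\<in>UNIV. ?A i) - (\<Prod>i\<in>UNIV. ?B i)\<bar> \<le> real CARD('n) * ((t - s) / s)" by simp
    have E0: "E i \<noteq> 0" for i using E[of i] by simp
    have prodE: "0 < (\<Prod>i\<in>UNIV. E i)" by (intro prod_pos) (use E in auto)
    have "heatD k t x - heatD k s x = (\<Prod>i\<in>UNIV. E i) * ((\<Prod>i\<in>UNIV. ?A i) - (\<Prod>i\<in>UNIV. ?B i))"
      using E0 by (simp add: heatD_eq_prod_Th[OF t(1) s(4)] heatD_eq_prod_Th[OF s(1) t(2)] prod_dividef right_diff_distrib)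
    then have "\<bar>heatD k t x - heatD k s x\<bar> \<le> (\<Prod>i\<in>UNIV. E i) * (real CARD('n) * ((t - s) / s))"
      using mult_left_mono[OF AB' less_imp_le[OF prodE]] by (simp only: abs_mult abs_of_pos[OF prodE])
    also have "(\<Prod>i\<in>UNIV. E i) = KK * ((\<Prod>i\<in>UNIV. s powr (- real (k $ i + 1) / 2)) * (\<Prod>i\<in>UNIV. decay t x i))"
      unfolding E_def KK_def by (simp only: prod.distrib)
    also have "\<dots> * (real CARD('n) * ((t - s) / s))
        \<le> KK * (s powr (- kabs k / 2) * (2 powr (real CARD('n) / 2) * pk CARD('n) t (tnorm x))) * (real CARD('n) * ((t - s) / s))"
    proof (intro mult_right_mono mult_left_mono)
      have sn: "s powr (- real CARD('n) / 2) \<le> 2 powr (real CARD('n) / 2) * t powr (- real CARD('n) / 2)"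
        using powr_comparable[of t s "- real CARD('n) / 2"] s t by simp
      have "(\<Prod>i\<in>UNIV. s powr (- real (k $ i + 1) / 2)) * (\<Prod>i\<in>UNIV. decay t x i)
        \<le> (s powr (- kabs k / 2) * (2 powr (real CARD('n) / 2) * t powr (- real CARD('n) / 2))) * (1 + tnorm x / sqrt t) powr (- 2 * real CARD('n))"
        unfolding prod_heat_powr[OF s(1)]
        by (intro mult_mono mult_left_mono sn prod_decay_le t prod_nonneg mult_nonneg_nonneg) (use decay_pos[OF t(1), of x] in \<open>auto intro: less_imp_le\<close>)
      then show "(\<Prod>i\<in>UNIV. s powr (- real (k $ i + 1) / 2)) * (\<Prod>i\<in>UNIV. decay t x i)
        \<le> s powr (- kabs k / 2) * (2 powr (real CARD('n) / 2) * pk CARD('n) t (tnorm x))"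
        unfolding pk_def by (simp only: mult.assoc)
    qed (use KK s in auto)
    finally show "\<bar>heatD k t x - heatD k s x\<bar> \<le> ?c * ((t - s) / s) * s powr (- kabs k / 2) * pk CARD('n) t (tnorm x)"
      by (simp only: mult_ac)
  qed
qed

section \<open>Weighted kernels and their differences in time\<close>

lemma kfac_bound:
  fixes k :: "nat ^ 'n::finite"
  shows "\<exists>C>0. \<forall>r y. r < 1 \<longrightarrow> \<bar>kfac g k r y\<bar> \<le> C * kb (g - kabs k / 2) r y"
proof -
  obtain C where C: "C \<ge> 0" "\<And>t x. 0 < t \<Longrightarrow> t \<le> 1 \<Longrightarrow>
    \<bar>heatD k t x\<bar> \<le> C * t powr (- kabs k / 2) * pk CARD('n) t (tnorm x)"
    using heatD_bound by blast
  have "\<bar>kfac g k r y\<bar> \<le> (C + 1) * kb (g - kabs k / 2) r y" if r: "r < 1" for r y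
  proof (cases "0 < r")
    case True
    have "\<bar>kfac g k r y\<bar> = r powr g * \<bar>heatD k r y\<bar>" using True by (simp add: kfac_def abs_mult)
    also have "\<dots> \<le> r powr g * ((C + 1) * r powr (- kabs k / 2) * pk CARD('n) r (tnorm y))"
    proof (intro mult_left_mono)
      have "C * (r powr (- kabs k / 2) * pk CARD('n) r (tnorm y)) \<le> (C + 1) * (r powr (- kabs k / 2) * pk CARD('n) r (tnorm y))"
        by (intro mult_right_mono) auto
      then show "\<bar>heatD k r y\<bar> \<le> (C + 1) * r powr (- kabs k / 2) * pk CARD('n) r (tnorm y)"
        using C(2)[OF True less_imp_le[OF r], of y] by (simp only: mult.assoc)
    qed simp
    also have "\<dots> = (C + 1) * (r powr (g + - kabs k / 2) * pk CARD('n) r (tnorm y))"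
      by (simp only: powr_add mult_ac)
    also have "\<dots> = (C + 1) * kb (g - kabs k / 2) r y" using True by (simp add: kb_def)
    finally show ?thesis .
  qed (simp add: kfac_def kb_def)
  then show ?thesis using C(1) by (intro exI[of _ "C + 1"]) auto
qed

text \<open>Mean value theorem. The intermediate point is compared first with \<open>t\<close> and
  then \<open>t\<close> with \<open>s\<close>; each comparison costs
  \<open>2 powr \<bar>g - 1\<bar>\<close>.\<close>

lemma powr_diff_bound:
  fixes g :: real
  assumes "0 < s" "s \<le> t" "t \<le> 2 * s"
  shows "\<bar>t powr g - s powr g\<bar> \<le> \<bar>g\<bar> * (2 powr (2 * \<bar>g - 1\<bar>)) * ((t - s) / s) * s powr g"
proof (cases "s = t")
  case False
  then have lt: "s < t" using assms by simp
  have "\<And>x. s \<le> x \<Longrightarrow> x \<le> t \<Longrightarrow> ((\<lambda>t. t powr g) has_real_derivative g * x powr (g - 1)) (at x)"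
    using assms by (intro has_real_derivative_powr) auto
  from MVT2[OF lt this] obtain x where x: "s < x" "x < t" "t powr g - s powr g = (t - s) * (g * x powr (g - 1))"
    by blast
  have t0: "t powr (g - 1) \<le> 2 powr \<bar>g - 1\<bar> * s powr (g - 1)"
  proof (cases "0 \<le> g - 1")
    case True
    have "t powr (g - 1) \<le> (2 * s) powr (g - 1)" using True assms by (intro powr_mono2) auto
    then show ?thesis using True by (simp add: powr_mult)
  next
    case False
    have "t powr (g - 1) \<le> 1 * s powr (g - 1)" using False assms by (simp add: powr_mono2')
    also have "\<dots> \<le> 2 powr \<bar>g - 1\<bar> * s powr (g - 1)" by (intro mult_right_mono ge_one_powr_ge_zero) auto
    finally show ?thesis .
  qed
  have "x powr (g - 1) \<le> 2 powr \<bar>g - 1\<bar> * t powr (g - 1)"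
    using x assms by (intro powr_comparable) auto
  also have "\<dots> \<le> 2 powr \<bar>g - 1\<bar> * (2 powr \<bar>g - 1\<bar> * s powr (g - 1))"
    by (intro mult_left_mono t0) auto
  also have "\<dots> = 2 powr (2 * \<bar>g - 1\<bar>) * (s powr g / s)"
    using assms by (simp add: powr_add[symmetric] powr_diff mult.assoc[symmetric])
  finally have "(t - s) * \<bar>g\<bar> * x powr (g - 1) \<le> (t - s) * \<bar>g\<bar> * (2 powr (2 * \<bar>g - 1\<bar>) * (s powr g / s))"
    using lt by (intro mult_left_mono) auto
  then show ?thesis using lt x(3) by (simp add: abs_mult mult_ac)
qed simp

text \<open>The difference of the products of weight and kernel is split as in the product rule.
  Either part gains the factor \<open>(t - s) / s\<close>, and comparable times allow everything
  else to be expressed by one power and one kernel.\<close>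

lemma kfac_diff_near:
  fixes k :: "nat ^ 'n::finite"
  shows "\<exists>C\<ge>0. \<forall>s t y. 0 < s \<longrightarrow> s \<le> t \<longrightarrow> t \<le> 2 * s \<longrightarrow> t \<le> 1 \<longrightarrow>
    \<bar>kfac g k t y - kfac g k s y\<bar> \<le> C * ((t - s) / s * (s powr (g - kabs k / 2) * pk CARD('n) t (tnorm y)))"
proof -
  let ?n = "real CARD('n)"
  obtain C1 where C1: "C1 \<ge> 0" "\<And>t x. 0 < t \<Longrightarrow> t \<le> 1 \<Longrightarrow>
    \<bar>heatD k t x\<bar> \<le> C1 * t powr (- kabs k / 2) * pk CARD('n) t (tnorm x)"
    using heatD_bound by blast
  obtain C2 where C2: "C2 \<ge> 0" "\<And>s t x. 0 < s \<Longrightarrow> s \<le> t \<Longrightarrow> t \<le> 2 * s \<Longrightarrow> t \<le> 1 \<Longrightarrow>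
    \<bar>heatD k t x - heatD k s x\<bar> \<le> C2 * ((t - s) / s) * s powr (- kabs k / 2) * pk CARD('n) t (tnorm x)"
    using heatD_diff_bound by blast
  define c1 where "c1 = \<bar>g\<bar> * (2 powr (2 * \<bar>g - 1\<bar>))"
  define c2 where "c2 = 2 powr (?n / 2)"
  have c: "0 \<le> c1" "0 \<le> c2" by (auto simp: c1_def c2_def)
  show ?thesis
  proof (intro exI[of _ "(1 + c1) * C2 + c1 * C1 * c2"] conjI allI impI)
    show "0 \<le> (1 + c1) * C2 + c1 * C1 * c2" using c C1 C2 by (intro add_nonneg_nonneg mult_nonneg_nonneg) auto
    fix s t :: real and y :: "real ^ 'n" assume s: "0 < s" "s \<le> t" "t \<le> 2 * s" "t \<le> 1"
    let ?P = "pk CARD('n) t (tnorm y)" and ?d = "(t - s) / s" and ?h = "s powr (- kabs k / 2)"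
    have d: "0 \<le> ?d" "?d \<le> 1" using s by auto
    have pd: "\<bar>t powr g - s powr g\<bar> \<le> c1 * ?d * s powr g"
      using powr_diff_bound[OF s(1-3), of g] by (simp only: c1_def)
    have tg: "t powr g \<le> (1 + c1) * s powr g"
    proof -
      have "c1 * ?d * s powr g \<le> c1 * 1 * s powr g" using c d by (intro mult_right_mono mult_left_mono) auto
      then show ?thesis using pd by (simp add: algebra_simps)
    qed
    have ps: "pk CARD('n) s (tnorm y) \<le> c2 * ?P"
    proof -
      have "s powr (- ?n / 2) \<le> c2 * t powr (- ?n / 2)"
        using powr_comparable[of t s "- ?n / 2"] s by (simp add: c2_def)
      moreover have "(1 + tnorm y / sqrt s) powr (- 2 * ?n) \<le> (1 + tnorm y / sqrt t) powr (- 2 * ?n)"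
        using s by (intro powr_mono2' add_left_mono divide_left_mono add_pos_nonneg) auto
      ultimately show ?thesis unfolding pk_def mult.assoc[symmetric] using c by (intro mult_mono) auto
    qed
    have "kfac g k t y - kfac g k s y = t powr g * (heatD k t y - heatD k s y) + (t powr g - s powr g) * heatD k s y"
      using s by (simp add: kfac_def algebra_simps)
    then have "\<bar>kfac g k t y - kfac g k s y\<bar> \<le> t powr g * \<bar>heatD k t y - heatD k s y\<bar> + \<bar>t powr g - s powr g\<bar> * \<bar>heatD k s y\<bar>"
      using abs_triangle_ineq[of "t powr g * (heatD k t y - heatD k s y)" "(t powr g - s powr g) * heatD k s y"] by (simp add: abs_mult)
    also have "\<dots> \<le> ((1 + c1) * s powr g) * (C2 * ?d * ?h * ?P) + (c1 * ?d * s powr g) * (C1 * ?h * (c2 * ?P))"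
    proof (intro add_mono mult_mono tg pd C2(2) s)
      have "\<bar>heatD k s y\<bar> \<le> C1 * ?h * pk CARD('n) s (tnorm y)" using C1(2)[of s y] s by simp
      also have "\<dots> \<le> C1 * ?h * (c2 * ?P)" using C1 by (intro mult_left_mono ps) auto
      finally show "\<bar>heatD k s y\<bar> \<le> C1 * ?h * (c2 * ?P)" .
    qed ((intro mult_nonneg_nonneg add_nonneg_nonneg c d C1(1) C2(1) powr_ge_zero pk_nonneg abs_ge_zero zero_le_one)+)
    also have "\<dots> = ((1 + c1) * C2 + c1 * C1 * c2) * (?d * ((s powr g * ?h) * ?P))"
    proof -
      have "((1 + c1) * a) * (C2 * d * h * P) + (c1 * d * a) * (C1 * h * (c2 * P))
          = ((1 + c1) * C2 + c1 * C1 * c2) * (d * ((a * h) * P))" for a d h P :: real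
        by (simp add: algebra_simps)
      then show ?thesis .
    qed
    also have "s powr g * ?h = s powr (g - kabs k / 2)"
      using powr_add[of s g "- kabs k / 2"] by simp
    finally show "\<bar>kfac g k t y - kfac g k s y\<bar>
        \<le> ((1 + c1) * C2 + c1 * C1 * c2) * (?d * (s powr (g - kabs k / 2) * ?P))" .
  qed
qed

text \<open>For \<open>0 < s\<close> and \<open>t \<le> 2 * s\<close> the gain
  \<open>(t - s) / s\<close> is at most 1, so it can be weakened to its power
  \<open>\<kappa>\<close>. In the remaining case, which includes \<open>s \<le> 0\<close>, both
  times are at most \<open>2 * (t - s)\<close>; then the two kernels are bounded separately and
  \<open>r powr \<kappa>\<close> is traded for \<open>(t - s) powr \<kappa>\<close>.\<close>

lemma kfac_diff_bound:
  fixes k :: "nat ^ 'n::finite"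
  assumes \<kappa>: "0 \<le> \<kappa>" "\<kappa> \<le> 1"
  shows "\<exists>C>0. \<forall>s t y. s \<le> t \<longrightarrow> t < 1 \<longrightarrow>
    \<bar>kfac g k t y - kfac g k s y\<bar> \<le> C * (if \<kappa> = 0 then 1 else (t - s) powr \<kappa>)
      * (kb (g - \<kappa> - kabs k / 2) t y + kb (g - \<kappa> - kabs k / 2) s y)"
proof -
  define e where "e = g - kabs k / 2"
  obtain C1 where C1: "C1 > 0" "\<And>r y. r < 1 \<Longrightarrow> \<bar>kfac g k r y\<bar> \<le> C1 * kb e r y"
    using kfac_bound unfolding e_def by blast
  obtain C2 where C2: "C2 \<ge> 0" "\<And>s t y. 0 < s \<Longrightarrow> s \<le> t \<Longrightarrow> t \<le> 2 * s \<Longrightarrow> t \<le> 1 \<Longrightarrow>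
    \<bar>kfac g k t y - kfac g k s y\<bar> \<le> C2 * ((t - s) / s * (s powr e * pk CARD('n) t (tnorm y)))"
    using kfac_diff_near unfolding e_def by blast
  define C where "C = C1 * 2 powr \<kappa> + C2 * 2 powr \<bar>e - \<kappa>\<bar>"
  have C: "0 < C" using C1 C2 by (simp add: C_def add_pos_nonneg)
  have "\<bar>kfac g k t y - kfac g k s y\<bar> \<le> C * (t - s) powr \<kappa> * (kb (e - \<kappa>) t y + kb (e - \<kappa>) s y)"
    if st: "s < t" "t < 1" for s t y
  proof (cases "0 < s \<and> t \<le> 2 * s")
    case True
    let ?P = "pk CARD('n) t (tnorm y)"
    have d: "0 < (t - s) / s" "(t - s) / s \<le> 1" using True st by auto
    have "(t - s) / s = ((t - s) / s) powr 1" using d by (simp only: powr_one less_imp_le)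
    also have "\<dots> \<le> ((t - s) / s) powr \<kappa>" using d \<kappa> by (intro powr_mono') auto
    also have "\<dots> = (t - s) powr \<kappa> / s powr \<kappa>" using True st by (simp add: powr_divide)
    finally have "(t - s) / s * (s powr e * ?P) \<le> (t - s) powr \<kappa> / s powr \<kappa> * (s powr e * ?P)"
      by (intro mult_right_mono) auto
    also have "\<dots> = (t - s) powr \<kappa> * (s powr (e - \<kappa>) * ?P)" by (simp add: powr_diff)
    also have "\<dots> \<le> (t - s) powr \<kappa> * ((2 powr \<bar>e - \<kappa>\<bar> * t powr (e - \<kappa>)) * ?P)"
      using True st by (intro mult_left_mono mult_right_mono powr_comparable) auto
    also have "\<dots> = 2 powr \<bar>e - \<kappa>\<bar> * ((t - s) powr \<kappa> * kb (e - \<kappa>) t y)"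
      using True st by (simp add: kb_def)
    finally have "\<bar>kfac g k t y - kfac g k s y\<bar> \<le> C2 * (2 powr \<bar>e - \<kappa>\<bar> * ((t - s) powr \<kappa> * kb (e - \<kappa>) t y))"
      using C2(2)[of s t y] True st mult_left_mono[OF _ C2(1)] by fastforce
    also have "\<dots> \<le> C * ((t - s) powr \<kappa> * (kb (e - \<kappa>) t y + kb (e - \<kappa>) s y))"
      unfolding mult.assoc[symmetric, of C2] using C1 C2
      by (intro mult_mono mult_left_mono) (auto simp: C_def)
    finally show ?thesis by (simp only: mult.assoc)
  next
    case False
    have 1: "kb e r y \<le> 2 powr \<kappa> * ((t - s) powr \<kappa> * kb (e - \<kappa>) r y)" if "r \<le> 2 * (t - s)" for r
    proof (cases "0 < r")
      case True
      have "r powr \<kappa> \<le> (2 * (t - s)) powr \<kappa>" using that True \<kappa> by (intro powr_mono2) auto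
      also have "\<dots> = 2 powr \<kappa> * (t - s) powr \<kappa>" by (rule powr_mult)
      finally have "r powr \<kappa> * (r powr (e - \<kappa>) * pk CARD('n) r (tnorm y))
          \<le> (2 powr \<kappa> * (t - s) powr \<kappa>) * (r powr (e - \<kappa>) * pk CARD('n) r (tnorm y))"
        by (intro mult_right_mono) auto
      moreover have "r powr \<kappa> * (r powr (e - \<kappa>) * pk CARD('n) r (tnorm y)) = kb e r y"
        using True by (simp add: kb_def powr_diff)
      ultimately show ?thesis using True by (simp add: kb_def mult.assoc)
    qed (simp add: kb_def)
    have "t \<le> 2 * (t - s)" "s \<le> 2 * (t - s)" using False st by auto
    have "\<bar>kfac g k t y - kfac g k s y\<bar> \<le> C1 * kb e t y + C1 * kb e s y"
      using C1(2)[of t y] C1(2)[of s y] st by linarith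
    also have "\<dots> \<le> C1 * (2 powr \<kappa> * ((t - s) powr \<kappa> * kb (e - \<kappa>) t y)) + C1 * (2 powr \<kappa> * ((t - s) powr \<kappa> * kb (e - \<kappa>) s y))"
      using C1 by (intro add_mono mult_left_mono 1 \<open>t \<le> 2 * (t - s)\<close> \<open>s \<le> 2 * (t - s)\<close>) auto
    also have "\<dots> = (C1 * 2 powr \<kappa>) * ((t - s) powr \<kappa> * (kb (e - \<kappa>) t y + kb (e - \<kappa>) s y))"
      by (simp only: distrib_left mult_ac)
    also have "\<dots> \<le> C * ((t - s) powr \<kappa> * (kb (e - \<kappa>) t y + kb (e - \<kappa>) s y))"
      using C2 by (intro mult_right_mono) (auto simp: C_def)
    finally show ?thesis by (simp only: mult.assoc)
  qed
  note lt = this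
  \<comment> \<open>For \<open>\<kappa> = 0\<close> the factor is written as 1, because
    \<open>0 powr 0\<close> is 0. At \<open>s = t\<close> the left-hand side vanishes in any
    case.\<close>
  have main: "\<bar>kfac g k t y - kfac g k s y\<bar> \<le> C * (if \<kappa> = 0 then 1 else (t - s) powr \<kappa>) * (kb (e - \<kappa>) t y + kb (e - \<kappa>) s y)"
    if "s \<le> t" "t < 1" for s t y
  proof (cases "s = t")
    case True
    then show ?thesis using C by simp
  next
    case False
    then have "s < t" using that by simp
    then show ?thesis using lt[of s t y] that by (cases "\<kappa> = 0") auto
  qed
  have ee: "e - \<kappa> = g - \<kappa> - kabs k / 2" by (simp add: e_def)
  show ?thesis using main C unfolding ee by blast
qed

section \<open>The integrals of a decorated contracted forest\<close>

text \<open>For a Dirac vertex the space of \<^term>\<open>vmeas True\<close> is everything, so that the time is \<open>0\<close>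
  only almost everywhere.\<close>

lemma AE_PiM_vmeas:
  fixes d :: "'v \<Rightarrow> bool"
  assumes "finite S"
  shows "AE X in PiM S (\<lambda>u. vmeas (d u) :: (real \<times> (real ^ 'n::finite)) measure). \<forall>u\<in>S. 0 \<le> fst (X u) \<and> fst (X u) < 1"
proof (rule AE_finite_allI[OF assms])
  fix u assume u: "u \<in> S"
  let ?M = "\<lambda>u. vmeas (d u) :: (real \<times> (real ^ 'n)) measure"
  interpret product_sigma_finite ?M by (intro product_sigma_finite.intro sigma_finite_vmeas)
  let ?N = "{p \<in> space (?M u). \<not> (0 \<le> fst p \<and> fst p < 1)}"
  have fst: "fst \<in> borel_measurable (?M u)" by (rule measurable_vmeas) measurable
  have N: "?N \<in> sets (?M u)" using fst by measurable
  have N0: "emeasure (?M u) ?N = 0"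
  proof (cases "d u")
    case True
    have "(\<lambda>x. (0::real, x :: real ^ 'n)) \<in> restrict_space lborel cube \<rightarrow>\<^sub>M borel"
      by (intro measurable_restrict_space1) measurable
    then show ?thesis using N True by (simp add: vmeas_def emeasure_distr)
  next
    case False
    then have "?N = {}" using fst_vmeas_False by fastforce
    then show ?thesis by (metis emeasure_empty)
  qed
  let ?A = "\<lambda>i. if i = u then ?N else space (?M i)"
  have "emeasure (PiM S ?M) (PiE S ?A) = (\<Prod>i\<in>S. emeasure (?M i) (?A i))"
    using N by (intro emeasure_PiM assms) auto
  also have "\<dots> = 0" using u N0 assms by (intro prod_zero) auto
  finally have "emeasure (PiM S ?M) (PiE S ?A) = 0" .
  moreover have "PiE S ?A \<in> sets (PiM S ?M)" using N by (intro sets_PiM_I_finite assms) auto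
  moreover have "{X \<in> space (PiM S ?M). \<not> (0 \<le> fst (X u) \<and> fst (X u) < 1)} \<subseteq> PiE S ?A"
    by (auto simp: space_PiM PiE_iff extensional_def)
  ultimately show "AE X in PiM S ?M. 0 \<le> fst (X u) \<and> fst (X u) < 1"
    by (intro AE_I) auto
qed

text \<open>\<open>sh v\<close> is the amount by which \<open>\<gamma>\<close> is lowered on the edge above \<open>v\<close>: it is \<open>0\<close> in the first
  estimate and one of the Hoelder exponents for \<open>v \<in> U\<close> in the second.\<close>

locale decorated_forest =
  fixes F :: "('v, 'n::finite) dforest" and sh :: "'v \<Rightarrow> real"
  assumes wf: "wf_dforest F"
    and noroot: "cedges F (roots F) = {}"
    and ha: "\<And>v. v \<in> Vstar F \<Longrightarrow> \<not> is_dirac F v \<Longrightarrow> zval F v - sh v > -1"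
    and hb: "\<And>v. v \<in> Istar F \<Longrightarrow> Lambda F v
               + Min0 {df_a F e / 4 | e. e \<in> cedges F (branch F v) \<inter> cedges F (df_V F - branch F v)} > -1"
    and hc: "\<And>e. e \<in> df_C F \<Longrightarrow> 0 < df_a F e \<and> df_a F e < real CARD('n)"
    and sh_child: "\<And>v. v \<in> Vstar F \<Longrightarrow> sh v \<noteq> 0 \<Longrightarrow> df_par F v \<in> roots F"
begin

definition dp :: "'v \<Rightarrow> nat" where
  "dp v = (LEAST k. (df_par F ^^ k) v \<in> roots F)"

definition cw :: "'v \<Rightarrow> real" where
  "cw u = (if u \<in> roots F then -1 else df_gam F u - sh u - kabs (df_k F u) / 2)"

lemma wf_facts:
  "finite (df_V F)" "roots F \<subseteq> df_V F" "df_rho F \<noteq> df_rhob F"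
  "v \<in> Vstar F \<Longrightarrow> df_par F v \<in> df_V F" "v \<in> Vstar F \<Longrightarrow> \<exists>k. (df_par F ^^ k) v \<in> roots F"
  "v \<in> Lstar F \<Longrightarrow> df_beta F v \<ge> -1"
  using wf by (auto simp: wf_dforest_def roots_def)

lemma V_eq: "Vstar F \<union> {df_rho F, df_rhob F} = df_V F"
  using wf_facts(2) by (auto simp: Vstar_def roots_def)

lemma branch_root: "u \<in> roots F \<Longrightarrow> u \<in> branch F w \<Longrightarrow> u = w"
proof -
  assume u: "u \<in> roots F" "u \<in> branch F w"
  then obtain k where "(df_par F ^^ k) u = w" "\<forall>j<k. (df_par F ^^ j) u \<notin> roots F" by (auto simp: branch_def)
  then show ?thesis using u(1) by (cases k) auto
qed

lemma branch_par:
  assumes u: "u \<in> Vstar F" "u \<noteq> w"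
  shows "u \<in> branch F w \<longleftrightarrow> df_par F u \<in> branch F w"
proof
  have nr: "u \<notin> roots F" "u \<in> df_V F" using u by (auto simp: Vstar_def)
  assume "u \<in> branch F w"
  then obtain k where k: "(df_par F ^^ k) u = w" "\<forall>j<k. (df_par F ^^ j) u \<notin> roots F" by (auto simp: branch_def)
  then obtain j where j: "k = Suc j" using u(2) by (cases k) auto
  have "(df_par F ^^ j) (df_par F u) = w" using k(1) by (simp add: j funpow_swap1)
  moreover have "\<forall>i<j. (df_par F ^^ i) (df_par F u) \<notin> roots F"
    using k(2) j by (metis Suc_less_eq comp_apply funpow_Suc_right)
  ultimately show "df_par F u \<in> branch F w" using wf_facts(4)[OF u(1)] by (auto simp: branch_def)
next
  have nr: "u \<notin> roots F" "u \<in> df_V F" using u by (auto simp: Vstar_def)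
  assume "df_par F u \<in> branch F w"
  then obtain j where j: "(df_par F ^^ j) (df_par F u) = w" "\<forall>i<j. (df_par F ^^ i) (df_par F u) \<notin> roots F"
    by (auto simp: branch_def)
  have "(df_par F ^^ Suc j) u = w" using j(1) by (simp add: funpow_swap1)
  moreover have "(df_par F ^^ i) u \<notin> roots F" if "i < Suc j" for i
    using that nr j(2) by (cases i) (auto simp: funpow_swap1)
  ultimately show "u \<in> branch F w" using nr unfolding branch_def by blast
qed

lemma branch_self: "w \<in> df_V F \<Longrightarrow> w \<in> branch F w"
  unfolding branch_def by (auto intro!: exI[of _ 0])

lemma dp_par: "v \<in> Vstar F \<Longrightarrow> dp (df_par F v) < dp v"
proof -
  assume v: "v \<in> Vstar F"
  have "(df_par F ^^ dp v) v \<in> roots F"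
    unfolding dp_def using wf_facts(5)[OF v] by (rule LeastI_ex)
  moreover have "v \<notin> roots F" using v by (auto simp: Vstar_def)
  ultimately obtain j where j: "dp v = Suc j" "(df_par F ^^ j) (df_par F v) \<in> roots F"
    by (cases "dp v") (auto simp: funpow_swap1)
  then have "dp (df_par F v) \<le> j" unfolding dp_def by (intro Least_le)
  then show ?thesis using j by simp
qed

sublocale rooted_forest "Vstar F" "df_par F" "df_rho F" "df_rhob F" "branch F" dp "{v. is_dirac F v}" cw
proof
  show "finite (Vstar F)" using wf_facts(1) by (simp add: Vstar_def)
  show "df_rho F \<noteq> df_rhob F" "df_rho F \<notin> Vstar F" "df_rhob F \<notin> Vstar F"
    using wf_facts(3) by (auto simp: Vstar_def roots_def)
  show "df_par F v \<in> Vstar F \<union> {df_rho F, df_rhob F}" if "v \<in> Vstar F" for v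
    using wf_facts(4)[OF that] V_eq by simp
  show "dp (df_par F v) < dp v" if "v \<in> Vstar F" for v using dp_par[OF that] .
  show "w \<in> branch F w" if "w \<in> Vstar F \<union> {df_rho F, df_rhob F}" for w using branch_self[of w] that V_eq by blast
  show "u \<in> branch F w \<longleftrightarrow> df_par F u \<in> branch F w" if "u \<in> Vstar F" "u \<noteq> w" for u w
    using branch_par that by blast
  show "r \<in> branch F w \<longleftrightarrow> r = w" if "r \<in> {df_rho F, df_rhob F}" "w \<in> Vstar F \<union> {df_rho F, df_rhob F}" for r w
    using branch_root[of r w] branch_self[of w] that V_eq unfolding roots_def by blast
  show "cw (df_rho F) = -1" "cw (df_rhob F) = -1" by (auto simp: cw_def roots_def)
  show "{v. is_dirac F v} \<subseteq> Vstar F" by (auto simp: is_dirac_def Lstar_def leaves_def Vstar_def)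
qed

section \<open>The contraction as an involution on leaves, and the initial state\<close>

definition mt :: "'v \<Rightarrow> 'v" where
  "mt u = (THE w. {u, w} \<in> df_C F \<and> w \<noteq> u)"

definition MC :: "'v set" where "MC = \<Union> (df_C F)"

lemma C_pair: "e \<in> df_C F \<Longrightarrow> \<exists>u v. e = {u, v} \<and> u \<noteq> v \<and> u \<in> leaves F \<and> v \<in> leaves F"
  using wf by (auto simp: wf_dforest_def)

lemma C_unique: "e \<in> df_C F \<Longrightarrow> e' \<in> df_C F \<Longrightarrow> l \<in> e \<Longrightarrow> l \<in> e' \<Longrightarrow> e = e'"
  using wf unfolding wf_dforest_def by blast

lemma mt_eq:
  assumes "{u, w} \<in> df_C F" "w \<noteq> u"
  shows "mt u = w"
  unfolding mt_def
proof (rule the_equality)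
  fix w' assume "{u, w'} \<in> df_C F \<and> w' \<noteq> u"
  then show "w' = w" using C_unique[OF assms(1), of "{u, w'}" u] by (auto simp: doubleton_eq_iff)
qed (use assms in simp)

lemma MC_pair:
  assumes "u \<in> MC"
  shows "{u, mt u} \<in> df_C F" "mt u \<noteq> u" "mt u \<in> MC" "mt (mt u) = u" "bval F u = df_a F {u, mt u}"
    "u \<in> leaves F" "u \<in> Vstar F"
proof -
  obtain e where e: "e \<in> df_C F" "u \<in> e" using assms by (auto simp: MC_def)
  then obtain w where w: "e = {u, w}" "w \<noteq> u" "u \<in> leaves F" using C_pair[OF e(1)] by fastforce
  have m: "mt u = w" using mt_eq e w by simp
  show 1: "{u, mt u} \<in> df_C F" "mt u \<noteq> u" "u \<in> leaves F" using m e w by auto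
  show "mt u \<in> MC" using 1 by (auto simp: MC_def)
  have "mt w = u" using mt_eq[of w u] e w by (simp add: insert_commute)
  then show "mt (mt u) = u" using m by simp
  have "(THE e. e \<in> df_C F \<and> u \<in> e) = {u, mt u}"
    using 1 C_unique by (intro the_equality) auto
  then show "bval F u = df_a F {u, mt u}" using e unfolding bval_def by auto
  have "u \<notin> roots F" using noroot e by (auto simp: cedges_def)
  then show "u \<in> Vstar F" using w by (auto simp: Vstar_def leaves_def)
qed

lemma bval_notin: "u \<notin> MC \<Longrightarrow> bval F u = 0"
  by (auto simp: bval_def MC_def)

lemma leafS_leaves: "u \<in> Vstar F \<Longrightarrow> leafS (Vstar F) u \<longleftrightarrow> u \<in> leaves F"
  by (auto simp: leafS_def leaves_def children_def Vstar_def)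

lemma pairing_MC: "pairing (real CARD('n)) (Vstar F) MC mt (bval F)"
proof -
  have "bval F (mt u) = bval F u" if "u \<in> MC" for u
    using MC_pair(5)[OF that] MC_pair(5)[OF MC_pair(3)[OF that]] MC_pair(4)[OF that] by (simp add: insert_commute)
  moreover have "0 < bval F u \<and> bval F u < CARD('n)" if "u \<in> MC" for u
    using MC_pair(1,5)[OF that] hc by auto
  ultimately show ?thesis
    using MC_pair leafS_leaves bval_notin unfolding pairing_def by auto
qed

text \<open>Translates the sets of edges in (a) and (b) into inner endpoints. The partner of such an
  endpoint is a vertex outside the branch, which matches the two-sided description by
  incidences.\<close>

lemma separating_edges:
  assumes w: "w \<in> df_V F"
  shows "{df_a F e / 4 | e. e \<in> cedges F (branch F w) \<inter> cedges F (df_V F - branch F w)} = (\<lambda>u. bval F u / 4) ` ext MC mt w"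
proof (intro equalityI subsetI)
  fix z assume "z \<in> {df_a F e / 4 | e. e \<in> cedges F (branch F w) \<inter> cedges F (df_V F - branch F w)}"
  then obtain e where e: "z = df_a F e / 4" "e \<in> df_C F" "e \<inter> branch F w \<noteq> {}" "e \<inter> (df_V F - branch F w) \<noteq> {}"
    by (auto simp: cedges_def)
  obtain u where u: "u \<in> e" "u \<in> branch F w" using e by auto
  have uM: "u \<in> MC" using u e by (auto simp: MC_def)
  have e': "e = {u, mt u}" using C_unique[OF e(2) MC_pair(1)[OF uM], of u] u by auto
  then have "mt u \<notin> branch F w" using e u by auto
  then show "z \<in> (\<lambda>u. bval F u / 4) ` ext MC mt w"
    using e(1) e' u uM MC_pair(5)[OF uM] by (intro image_eqI[of _ _ u]) (auto simp: ext_def)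
next
  fix z assume "z \<in> (\<lambda>u. bval F u / 4) ` ext MC mt w"
  then obtain u where u: "z = bval F u / 4" "u \<in> MC" "u \<in> branch F w" "mt u \<notin> branch F w" by (auto simp: ext_def)
  have "mt u \<in> df_V F" using MC_pair(7)[OF MC_pair(3)[OF u(2)]] by (auto simp: Vstar_def)
  then have "{u, mt u} \<in> cedges F (branch F w) \<inter> cedges F (df_V F - branch F w)"
    using MC_pair(1)[OF u(2)] u by (auto simp: cedges_def)
  then show "z \<in> {df_a F e / 4 | e. e \<in> cedges F (branch F w) \<inter> cedges F (df_V F - branch F w)}"
    using u(1) MC_pair(5)[OF u(2)] by auto
qed

lemma finite_MC: "finite MC"
  using finite_subset[OF pairingD(1)[OF pairing_MC] finite_V0] .

text \<open>The peeling sees \<open>\<gamma>\<close> lowered by \<open>sh\<close>, so its exponent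
  falls short by all shifts inside the branch. At the roots this produces the loss
  \<open>\<zeta>\<close> in the second estimate.\<close>

lemma Lam_Lambda:
  assumes w: "w \<in> df_V F"
  shows "Lam (Vstar F) (bval F) (df_beta F) w = Lambda F w - (\<Sum>u\<in>branch F w - {w}. sh u)"
proof -
  have Bsub: "branch F w \<subseteq> df_V F" by (auto simp: branch_def)
  have fin: "finite (branch F w)" using finite_subset[OF Bsub wf_facts(1)] .
  have B: "(Vstar F \<union> {df_rho F, df_rhob F}) \<inter> branch F w = branch F w" using Bsub V_eq by auto
  have "(\<Sum>u\<in>branch F w. df_beta F u + 1 + cw u - bval F u / 4)
      = (\<Sum>u\<in>branch F w. df_beta F u) + (\<Sum>u\<in>branch F w. 1 + cw u) - (1 / 4) * (\<Sum>u\<in>branch F w. bval F u)"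
    by (simp add: sum.distrib sum_subtractf sum_divide_distrib[symmetric])
  moreover have "(\<Sum>u\<in>branch F w. 1 + cw u) = 1 + cw w + (\<Sum>u\<in>branch F w - {w}. 1 + cw u)"
    using fin branch_self[OF w] by (simp add: sum.remove)
  moreover have "(\<Sum>u\<in>branch F w - {w}. 1 + cw u)
      = (\<Sum>u\<in>branch F w - {w}. 1 + (df_gam F u - kabs (df_k F u) / 2) - sh u)"
    using branch_root by (intro sum.cong) (auto simp: cw_def)
  moreover have "\<dots> = real (card (branch F w - {w})) + (\<Sum>u\<in>branch F w - {w}. df_gam F u - kabs (df_k F u) / 2) - (\<Sum>u\<in>branch F w - {w}. sh u)"
    by (simp add: sum.distrib sum_subtractf)
  moreover have "(\<Sum>u\<in>branch F w. bval F u) = (\<Sum>u\<in>branch F w \<inter> leaves F. bval F u)"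
    using fin bval_notin MC_pair(6) by (intro sum.mono_neutral_right) auto
  ultimately show ?thesis unfolding Lam_def B Lambda_def by simp
qed

text \<open>Shifts occur only on the edges directly below a root, and no branch of another vertex
  contains such an edge. Hence (b) is unaffected by them.\<close>

lemma Lam_Lambda_vertex:
  assumes w: "w \<in> Vstar F"
  shows "Lam (Vstar F) (bval F) (df_beta F) w = Lambda F w"
proof -
  have "sh u = 0" if "u \<in> branch F w - {w}" for u
  proof (rule ccontr)
    assume s: "sh u \<noteq> 0"
    have "w \<notin> roots F" using w by (simp add: Vstar_def)
    then have u: "u \<in> Vstar F" using that branch_root[of u w] by (auto simp: branch_def Vstar_def)
    then have "df_par F u \<in> branch F w" using branch_par[of u w] that by auto
    moreover have "df_par F u \<in> roots F" using sh_child[OF u s] .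
    ultimately show False using branch_root \<open>w \<notin> roots F\<close> by metis
  qed
  then show ?thesis using Lam_Lambda[of w] w by (simp add: Vstar_def)
qed

text \<open>Condition (b) speaks about inner vertices only. At a leaf that is not Dirac the branch
  condition amounts to \<open>\<beta> > -1\<close>, which is \<open>\<beta> \<ge> -1\<close>
  together with not being Dirac.\<close>

lemma state_init: "state (real CARD('n)) (Vstar F) MC mt (bval F) (df_beta F)"
  unfolding state_def
proof (intro conjI ballI impI)
  show "Vstar F \<subseteq> Vstar F" "pairing (real CARD('n)) (Vstar F) MC mt (bval F)" using pairing_MC by auto
  show "df_par F u \<in> Vstar F \<union> {df_rho F, df_rhob F}" if "u \<in> Vstar F" for u using par_in[OF that] .
  fix u assume u: "u \<in> Vstar F \<inter> {v. is_dirac F v}"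
  then show "leafS (Vstar F) u" "df_beta F u = -1" using leafS_leaves by (auto simp: is_dirac_def Lstar_def)
next
  fix w assume w: "w \<in> Vstar F - {v. is_dirac F v}"
  then have wV: "w \<in> df_V F" "w \<in> Vstar F" "w \<notin> roots F" by (auto simp: Vstar_def)
  let ?A = "(\<lambda>u. bval F u / 4) ` ext MC mt w"
  note P = pairingD[OF pairing_MC]
  have fin: "finite ?A" using finite_MC by (auto simp: ext_def)
  have z: "zval F w = - Max0 ?A - kabs (df_k F w) / 2 + df_gam F w"
    unfolding zval_def separating_edges[OF wV(1)] ..
  have zw: "zval F w - sh w > -1" using ha w by auto
  have cw: "cw w = zval F w + Max0 ?A - sh w" using wV by (simp add: cw_def z)
  have max: "bval F u / 4 \<le> Max0 ?A" if "u \<in> ext MC mt w" for u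
  proof -
    have "?A \<noteq> {}" using that by auto
    then have "Max0 ?A = Max ?A" by (simp only: Max0_def if_False)
    then show ?thesis using that fin by (metis Max_ge imageI)
  qed
  \<comment> \<open>Condition (a) also has to give \<open>c > -1\<close> without any charge; this
    follows because the maximum is nonnegative.\<close>
  have "0 \<le> Max0 ?A"
  proof (cases "ext MC mt w = {}")
    case False
    then obtain u where u: "u \<in> ext MC mt w" by auto
    then show ?thesis using max[OF u] P(10)[of u] by simp
  qed (simp add: Max0_def)
  then show "cw w > -1" using cw zw by simp
  show "cw w - bval F u / 4 > -1" if "u \<in> ext MC mt w" for u using cw zw max[OF that] by simp
  have L: "Lam (Vstar F) (bval F) (df_beta F) w = Lambda F w" by (rule Lam_Lambda_vertex[OF wV(2)])
  have main: "(\<forall>u\<in>ext MC mt w. Lam (Vstar F) (bval F) (df_beta F) w + bval F u / 4 > -1)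
      \<and> (ext MC mt w = {} \<longrightarrow> Lam (Vstar F) (bval F) (df_beta F) w > -1)"
  proof (cases "w \<in> leaves F")
    case True
    then have lf: "leafS (Vstar F) w" using leafS_leaves wV by auto
    have br: "u \<in> Vstar F \<Longrightarrow> u \<in> branch F w \<longleftrightarrow> u = w" for u
      using leaf_branch[OF _ _ lf] par_in by blast
    have "(Vstar F \<union> {df_rho F, df_rhob F}) \<inter> branch F w = {w}"
      using br wV root_notin_B[OF wV(2)] by auto
    then have Lw: "Lam (Vstar F) (bval F) (df_beta F) w = df_beta F w - bval F w / 4" by (simp add: Lam_def)
    have b: "df_beta F w > -1"
      using w True wV wf_facts(6)[of w] by (auto simp: is_dirac_def Lstar_def less_le)
    have ext: "ext MC mt w = (if w \<in> MC then {w} else {})"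
      using br MC_pair(2,3,7) by (auto simp: ext_def)
    show ?thesis using Lw b bval_notin[of w] by (auto simp: ext)
  next
    case False
    then have hb': "Lambda F w + Min0 ?A > -1"
      using hb[of w] wV unfolding separating_edges[OF wV(1)] by (auto simp: Istar_def)
    have "Min0 ?A \<le> bval F u / 4" if "u \<in> ext MC mt w" for u
    proof -
      have "?A \<noteq> {}" using that by auto
      then have "Min0 ?A = Min ?A" by (simp only: Min0_def if_False)
      then show ?thesis using that fin by (metis Min_le imageI)
    qed
    then have "\<forall>u\<in>ext MC mt w. Lambda F w + bval F u / 4 > -1" using hb' by fastforce
    moreover have "Lambda F w > -1" if e: "ext MC mt w = {}" using hb' unfolding e by (simp add: Min0_def)
    ultimately show ?thesis by (simp add: L)
  qed
  show "Lam (Vstar F) (bval F) (df_beta F) w + bval F u / 4 > -1" if "u \<in> ext MC mt w" for u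
    using main that by blast
  show "Lam (Vstar F) (bval F) (df_beta F) w > -1" if "ext MC mt w = {}"
    using main that by blast
qed

lemma cross_init:
  assumes "0 \<le> \<theta>" "\<theta> \<le> thmax F"
  shows "cross \<theta> MC mt (bval F)"
proof (cases "\<theta> = 0")
  case False
  let ?E = "cedges F (branch F (df_rho F) \<inter> leaves F) \<inter> cedges F (branch F (df_rhob F) \<inter> leaves F)"
  have "df_C F \<subseteq> Pow (df_V F)" using C_pair by (auto simp: leaves_def)
  then have finC: "finite (df_C F)" using finite_subset wf_facts(1) by blast
  have eq: "{df_a F e | e. e \<in> ?E} = df_a F ` ?E" by auto
  have fin: "finite (df_a F ` ?E)" using finC by (auto simp: cedges_def)
  have ne: "df_a F ` ?E \<noteq> {}"
  proof
    assume "df_a F ` ?E = {}"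
    then have "thmax F = 0" unfolding thmax_def eq Max0_def by simp
    then show False using assms False by simp
  qed
  then have "thmax F \<in> df_a F ` ?E" unfolding thmax_def eq Max0_def using Max_in[OF fin ne] by auto
  then obtain e where e: "e \<in> ?E" "\<theta> \<le> df_a F e" using assms by auto
  then obtain u v where uv: "u \<in> e" "u \<in> branch F (df_rho F)" "v \<in> e" "v \<in> branch F (df_rhob F)" and eC: "e \<in> df_C F"
    by (auto simp: cedges_def)
  have uM: "u \<in> MC" using uv eC by (auto simp: MC_def)
  have e': "e = {u, mt u}" using C_unique[OF eC MC_pair(1)[OF uM], of u] uv by auto
  have uV: "u \<in> Vstar F \<union> {df_rho F, df_rhob F}" "mt u \<in> Vstar F \<union> {df_rho F, df_rhob F}"
    using MC_pair(7)[OF uM] MC_pair(7)[OF MC_pair(3)[OF uM]] by auto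
  have "v = mt u" using B_one_root[OF uV(1)] uv e' by auto
  then have "mt u \<notin> branch F (df_rho F)" using B_one_root[OF uV(2)] uv by auto
  then have "u \<in> ext MC mt (df_rho F)" using uM uv by (auto simp: ext_def)
  moreover have "\<theta> \<le> bval F u" unfolding MC_pair(5)[OF uM] using e(2) e' by metis
  ultimately show ?thesis using assms unfolding cross_def by blast
qed (simp add: cross_def)

section \<open>Comparison of the integrands with the product over a state\<close>

lemma cfac_eq:
  assumes "{u, v} \<in> df_C F" "u \<noteq> v"
  shows "cfac F X {u, v} = tnorm (snd (X u) - snd (X v)) powr (- df_a F {u, v})"
proof -
  \<comment> \<open>The choice in \<open>cfac\<close> leaves only the order of the two endpoints
    open, and \<open>tnorm\<close> is symmetric.\<close>
  have "\<exists>d u' v'. {u, v} = {u', v'} \<and> u' \<noteq> v' \<and> d = tnorm (snd (X u') - snd (X v')) powr (- df_a F {u, v})"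
    using assms by blast
  then have "\<exists>u' v'. {u, v} = {u', v'} \<and> u' \<noteq> v' \<and> cfac F X {u, v} = tnorm (snd (X u') - snd (X v')) powr (- df_a F {u, v})"
    unfolding cfac_def by (rule someI_ex)
  then show ?thesis using tnorm_commute[of "snd (X u)" "snd (X v)"] by (auto simp: doubleton_eq_iff)
qed

text \<open>This is only an inequality because the factors differ on the diagonal, where
  \<open>powr\<close> gives 0 and \<open>sing\<close> gives infinity.\<close>

lemma prod_cfac_le:
  assumes "\<And>u. u \<in> Vstar F \<Longrightarrow> Y u = X u"
  shows "ennreal \<bar>\<Prod>e\<in>df_C F. cfac F Y e\<bar> \<le> PH MC mt (bval F) X"
proof -
  let ?g = "\<lambda>u. sing (bval F u / 2) (tnorm (snd (X u) - snd (X (mt u))))"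
  have "PH MC mt (bval F) X = (\<Prod>e\<in>df_C F. prod ?g e)"
    unfolding PH_def MC_def
  proof (subst prod.Union_disjoint)
    show "\<forall>A\<in>df_C F. finite A" using C_pair by fastforce
    show "\<forall>A\<in>df_C F. \<forall>B\<in>df_C F. A \<noteq> B \<longrightarrow> A \<inter> B = {}" using C_unique by blast
  qed simp
  moreover have "ennreal \<bar>cfac F Y e\<bar> \<le> prod ?g e" if e: "e \<in> df_C F" for e
  proof -
    obtain u where u: "u \<in> e" using C_pair[OF e] by auto
    have uM: "u \<in> MC" using u e by (auto simp: MC_def)
    have e': "e = {u, mt u}" using C_unique[OF e MC_pair(1)[OF uM], of u] u by auto
    note m = MC_pair[OF uM] and m' = MC_pair[OF MC_pair(3)[OF uM]]
    let ?d = "tnorm (snd (X u) - snd (X (mt u)))"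
    have b: "bval F (mt u) = bval F u" "0 < bval F u" using pairingD(6,7)[OF pairing_MC uM] by auto
    have "prod ?g e = sing (bval F u / 2) ?d * sing (bval F u / 2) ?d"
      unfolding e' using m(2,4) b tnorm_commute[of "snd (X (mt u))" "snd (X u)"] by simp
    also have "\<dots> = sing (bval F u) ?d" using sing_mult[of "bval F u / 2" "bval F u / 2" ?d] b by simp
    finally have "prod ?g e = sing (bval F u) ?d" .
    moreover have "cfac F Y e = ?d powr (- bval F u)"
      unfolding e' using cfac_eq[OF m(1) m(2)[symmetric], of Y] assms[OF m(7)] assms[OF m'(7)] m(5) by simp
    moreover have "ennreal (?d powr (- bval F u)) \<le> sing (bval F u) ?d" using b by (simp add: sing_def)
    ultimately show ?thesis by simp
  qed
  ultimately show ?thesis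
    by (simp add: abs_prod prod_ennreal[symmetric] prod_mono_ennreal)
qed

text \<open>The common reduction of both integrals: \<open>Y\<close> inserts the root positions,
  \<open>H\<close> is the factor of each tree edge and \<open>K\<close> its constant. The kernel
  bounds may assume all vertex times in \<open>[0, 1)\<close>, since this holds almost
  everywhere.\<close>

lemma nn_integral_forest_le:
  fixes q1 q2 :: "real \<times> real \<times> (real ^ 'n)"
    and G :: "('v \<Rightarrow> real \<times> (real ^ 'n)) \<Rightarrow> real" and H :: "('v \<Rightarrow> real \<times> (real ^ 'n)) \<Rightarrow> 'v \<Rightarrow> real"
    and Y :: "('v \<Rightarrow> real \<times> (real ^ 'n)) \<Rightarrow> 'v \<Rightarrow> real \<times> (real ^ 'n)" and K :: "'v \<Rightarrow> real"
  assumes q: "adm q1" "adm q2"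
    and G: "\<And>X :: 'v \<Rightarrow> real \<times> (real ^ 'n). G X = (\<Prod>e\<in>df_C F. cfac F (Y X) e) * (\<Prod>w\<in>df_V F. gfac F w (fst (Y X w))) * (\<Prod>w\<in>Vstar F. H X w)"
    and Y: "\<And>X u. u \<in> Vstar F \<Longrightarrow> Y X u = X u" "\<And>X u. u \<in> df_V F \<Longrightarrow> fst (Y X u) = fst (pos q1 q2 X u)"
    and K: "\<And>u. 0 \<le> K u"
    and H: "\<And>X u. u \<in> Vstar F \<Longrightarrow> (\<And>w. w \<in> Vstar F \<Longrightarrow> 0 \<le> fst (X w) \<and> fst (X w) < 1) \<Longrightarrow>
       ennreal \<bar>H X u\<bar> \<le> ennreal (K u) * kb2 (cw u) (pos q1 q2 X (df_par F u)) (X u)"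
  shows "(\<integral>\<^sup>+ X. ennreal \<bar>G X\<bar> \<partial>vint_measure F)
    \<le> ennreal (\<Prod>u\<in>Vstar F. K u) * (\<integral>\<^sup>+ X. Phi q1 q2 (Vstar F) MC mt (bval F) (df_beta F) X \<partial>PiM (Vstar F) vm)"
proof -
  have vm: "vint_measure F = PiM (Vstar F) vm" by (simp add: vint_measure_def)
  have "AE X in PiM (Vstar F) vm. \<forall>u\<in>Vstar F. 0 \<le> fst (X u) \<and> fst (X u) < 1"
    by (rule AE_PiM_vmeas[OF finite_V0])
  then have "(\<integral>\<^sup>+ X. ennreal \<bar>G X\<bar> \<partial>PiM (Vstar F) vm)
     \<le> (\<integral>\<^sup>+ X. ennreal (\<Prod>u\<in>Vstar F. K u) * Phi q1 q2 (Vstar F) MC mt (bval F) (df_beta F) X \<partial>PiM (Vstar F) vm)"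
  proof (intro nn_integral_mono_AE, eventually_elim)
    fix X :: "'v \<Rightarrow> real \<times> (real ^ 'n)" assume X: "\<forall>u\<in>Vstar F. 0 \<le> fst (X u) \<and> fst (X u) < 1"
    have 1: "ennreal \<bar>\<Prod>e\<in>df_C F. cfac F (Y X) e\<bar> \<le> PH MC mt (bval F) X"
      by (rule prod_cfac_le) (rule Y(1))
    have "ennreal \<bar>\<Prod>w\<in>df_V F. gfac F w (fst (Y X w))\<bar> = (\<Prod>w\<in>df_V F. ennreal \<bar>gfac F w (fst (Y X w))\<bar>)"
      by (simp add: abs_prod prod_ennreal)
    also have "\<dots> \<le> (\<Prod>w\<in>df_V F. tw (w \<in> {v. is_dirac F v}) (df_beta F w) (fst (pos q1 q2 X w)))"
      by (intro prod_mono_ennreal) (auto simp: gfac_def tw_def Y(2))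
    finally have 2: "ennreal \<bar>\<Prod>w\<in>df_V F. gfac F w (fst (Y X w))\<bar> \<le> PA q1 q2 (Vstar F) (df_beta F) X"
      unfolding PA_def V_eq .
    have "ennreal \<bar>\<Prod>w\<in>Vstar F. H X w\<bar> = (\<Prod>w\<in>Vstar F. ennreal \<bar>H X w\<bar>)"
      by (simp add: abs_prod prod_ennreal)
    also have "\<dots> \<le> (\<Prod>u\<in>Vstar F. ennreal (K u) * kb2 (cw u) (pos q1 q2 X (df_par F u)) (X u))"
      using X by (intro prod_mono_ennreal H) auto
    also have "\<dots> = ennreal (\<Prod>u\<in>Vstar F. K u) * PK q1 q2 (Vstar F) X"
      using K by (simp add: prod.distrib PK_def prod_ennreal)
    finally have 3: "ennreal \<bar>\<Prod>w\<in>Vstar F. H X w\<bar> \<le> ennreal (\<Prod>u\<in>Vstar F. K u) * PK q1 q2 (Vstar F) X" .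
    have "ennreal \<bar>G X\<bar> = ennreal \<bar>\<Prod>e\<in>df_C F. cfac F (Y X) e\<bar> * ennreal \<bar>\<Prod>w\<in>df_V F. gfac F w (fst (Y X w))\<bar>
        * ennreal \<bar>\<Prod>w\<in>Vstar F. H X w\<bar>"
      unfolding G by (simp add: abs_mult ennreal_mult)
    also have "\<dots> \<le> PH MC mt (bval F) X * PA q1 q2 (Vstar F) (df_beta F) X * (ennreal (\<Prod>u\<in>Vstar F. K u) * PK q1 q2 (Vstar F) X)"
      by (intro mult_mono 1 2 3) auto
    finally show "ennreal \<bar>G X\<bar> \<le> ennreal (\<Prod>u\<in>Vstar F. K u) * Phi q1 q2 (Vstar F) MC mt (bval F) (df_beta F) X"
      by (simp add: Phi_def mult_ac)
  qed
  also have "\<dots> = ennreal (\<Prod>u\<in>Vstar F. K u) * (\<integral>\<^sup>+ X. Phi q1 q2 (Vstar F) MC mt (bval F) (df_beta F) X \<partial>PiM (Vstar F) vm)"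
    by (rule nn_integral_cmult[OF borel_measurable_Phi_state[OF state_init]])
  finally show ?thesis unfolding vm .
qed

end

text \<open>Serves the edges whose kernel is evaluated at only one of the two times of the
  parent.\<close>

lemma kfac_pair_bound:
  fixes k :: "nat ^ 'n::finite"
  shows "\<exists>C>0. \<forall>s t y. s \<le> t \<longrightarrow> t < 1 \<longrightarrow>
    \<bar>kfac g k t y\<bar> \<le> C * (kb (g - kabs k / 2) t y + kb (g - kabs k / 2) s y)
    \<and> \<bar>kfac g k s y\<bar> \<le> C * (kb (g - kabs k / 2) t y + kb (g - kabs k / 2) s y)"
proof -
  let ?e = "g - kabs k / 2"
  obtain C where C: "C > 0" "\<And>r y. r < 1 \<Longrightarrow> \<bar>kfac g k r y\<bar> \<le> C * kb ?e r y" using kfac_bound by blast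
  have "\<bar>kfac g k r y\<bar> \<le> C * (kb ?e t y + kb ?e s y)" if "r = s \<or> r = t" "r < 1" for r s t y
  proof -
    have "C * kb ?e r y \<le> C * (kb ?e t y + kb ?e s y)" using that C(1) by (intro mult_left_mono) auto
    then show ?thesis using C(2)[OF that(2), of y] by linarith
  qed
  then show ?thesis using C(1) by (intro exI[of _ C]) auto
qed

section \<open>The two estimates for a decorated contracted forest\<close>

theorem theorem3p18:
  fixes F :: "('v, 'n::finite) dforest"
  assumes wf: "wf_dforest F"
    and noroot: "cedges F (roots F) = {}"
    and ha: "\<forall>v \<in> Vstar F. \<not> is_dirac F v \<longrightarrow> zval F v > -1"
    and hb: "\<forall>v \<in> Istar F. Lambda F v
               + Min0 {df_a F e / 4 | e. e \<in> cedges F (branch F v) \<inter> cedges F (df_V F - branch F v)} > -1"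
    and hc: "\<forall>e \<in> df_C F. 0 < df_a F e \<and> df_a F e < real CARD('n)"
  shows
   "(\<forall>\<theta>. 0 \<le> \<theta> \<and> \<theta> \<le> thmax F \<longrightarrow>
       (\<exists>C. \<forall>t tb x xb. 0 < t \<and> t < 1 \<and> 0 < tb \<and> tb < 1 \<and> tnorm (x - xb) \<noteq> 0 \<longrightarrow>
          Iint F t tb x xb \<le> ennreal (C * t powr (Lambda F (df_rho F) + \<theta> / 4)
                                        * tb powr (Lambda F (df_rhob F) + \<theta> / 4)
                                        * tnorm (x - xb) powr (- \<theta>))))
    \<and>
    (\<forall>\<theta> U W \<kappa> \<kappa>b.
       0 \<le> \<theta> \<and> \<theta> \<le> thmax F \<and> U \<subseteq> W \<and> W \<subseteq> children F (df_rho F) \<union> children F (df_rhob F) \<and>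
       card (U \<inter> children F (df_rho F)) \<le> 1 \<and> card (U \<inter> children F (df_rhob F)) \<le> 1 \<and>
       0 \<le> \<kappa> \<and> \<kappa> \<le> 1 \<and> 0 \<le> \<kappa>b \<and> \<kappa>b \<le> 1 \<and>
       (\<forall>l. U \<inter> children F (df_rho F) = {l} \<and> \<not> is_dirac F l \<longrightarrow> \<kappa> < 1 + zval F l) \<and>
       (\<forall>l. U \<inter> children F (df_rhob F) = {l} \<and> \<not> is_dirac F l \<longrightarrow> \<kappa>b < 1 + zval F l)
     \<longrightarrow> (let \<zeta> = \<kappa> * (if card (U \<inter> children F (df_rho F)) = 1 then 1 else 0)
                  + \<kappa>b * (if card (U \<inter> children F (df_rhob F)) = 1 then 1 else 0) in
         \<exists>C. \<forall>t s x xb. 0 < s \<and> s \<le> t \<and> t \<le> 2 * s \<and> t < 1 \<and> tnorm (x - xb) \<noteq> 0 \<longrightarrow>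
            Kint F W U t x xb s \<le> ennreal (C * (if \<zeta> = 0 then 1 else \<bar>t - s\<bar> powr \<zeta>)
                                         * t powr (Lambda F (df_rho F) + Lambda F (df_rhob F) + \<theta> / 2 - \<zeta>)
                                         * tnorm (x - xb) powr (- \<theta>))))"
    (is "?I \<and> ?K")
proof
  show ?I
  proof (intro allI impI)
    fix \<theta> assume th: "0 \<le> \<theta> \<and> \<theta> \<le> thmax F"
    interpret decorated_forest F "\<lambda>_. 0"
      using wf noroot ha hb hc by unfold_locales auto
    obtain C0 where C0: "C0 > 0" "\<And>q1 q2 :: real \<times> real \<times> (real ^ 'n). adm q1 \<Longrightarrow> adm q2 \<Longrightarrow>
      (\<integral>\<^sup>+ X. Phi q1 q2 (Vstar F) MC mt (bval F) (df_beta F) X \<partial>PiM (Vstar F) vm)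
        \<le> ennreal C0 * bnd (Vstar F) (bval F) (df_beta F) \<theta> q1 q2"
      using nn_integral_Phi_le[OF state_init cross_init] th by blast
    have "\<forall>u. \<exists>C>0. \<forall>r (y :: real ^ 'n). r < 1 \<longrightarrow> \<bar>kfac (df_gam F u) (df_k F u) r y\<bar> \<le> C * kb (df_gam F u - kabs (df_k F u) / 2) r y"
      using kfac_bound by blast
    then obtain K where K: "\<And>u. 0 < K u" "\<And>u r (y :: real ^ 'n). r < 1 \<Longrightarrow>
       \<bar>kfac (df_gam F u) (df_k F u) r y\<bar> \<le> K u * kb (df_gam F u - kabs (df_k F u) / 2) r y"
      by metis
    let ?P = "\<Prod>u\<in>Vstar F. K u"
    show "\<exists>C. \<forall>t tb x xb. 0 < t \<and> t < 1 \<and> 0 < tb \<and> tb < 1 \<and> tnorm (x - xb) \<noteq> 0 \<longrightarrow>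
          Iint F t tb x xb \<le> ennreal (C * t powr (Lambda F (df_rho F) + \<theta> / 4)
                                        * tb powr (Lambda F (df_rhob F) + \<theta> / 4)
                                        * tnorm (x - xb) powr (- \<theta>))"
    proof (intro exI[of _ "?P * C0"] allI impI)
      fix t tb :: real and x xb :: "real ^ 'n"
      assume A: "0 < t \<and> t < 1 \<and> 0 < tb \<and> tb < 1 \<and> tnorm (x - xb) \<noteq> 0"
      let ?q1 = "(t, t, x)" and ?q2 = "(tb, tb, xb)"
      let ?Y = "\<lambda>X :: 'v \<Rightarrow> real \<times> (real ^ 'n). X(df_rho F := (t, x), df_rhob F := (tb, xb))"
      let ?H = "\<lambda>X w. kfac (df_gam F w) (df_k F w) (fst (?Y X (df_par F w)) - fst (?Y X w)) (snd (?Y X (df_par F w)) - snd (?Y X w))"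
      have q: "adm ?q1" "adm ?q2" using A by (auto simp: adm_def)
      have Y: "?Y X u = X u" if "u \<in> Vstar F" for X u using that r1_V0 r2_V0 by auto
      have pos: "fst (pos ?q1 ?q2 X w) = fst (?Y X w)" "fst (snd (pos ?q1 ?q2 X w)) = fst (?Y X w)"
        "snd (snd (pos ?q1 ?q2 X w)) = snd (?Y X w)" for X w
        using r12 by (auto simp: pos_def)
      have P: "0 \<le> ?P" using K(1) by (intro prod_nonneg) (auto intro: less_imp_le)
      have "Iint F t tb x xb \<le> ennreal ?P * (\<integral>\<^sup>+ X. Phi ?q1 ?q2 (Vstar F) MC mt (bval F) (df_beta F) X \<partial>PiM (Vstar F) vm)"
        unfolding Iint_def Let_def
      proof (rule nn_integral_forest_le[OF q refl, where K = K])
        show "0 \<le> K u" for u using K(1)[of u] by simp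
        fix X :: "'v \<Rightarrow> real \<times> (real ^ 'n)" and u
        assume u: "u \<in> Vstar F" and X: "\<And>w. w \<in> Vstar F \<Longrightarrow> 0 \<le> fst (X w) \<and> fst (X w) < 1"
        let ?p = "df_par F u"
        have c: "cw u = df_gam F u - kabs (df_k F u) / 2" using u by (simp add: cw_def Vstar_def)
        \<comment> \<open>All time increments must be below 1, the range of the kernel
          bound.\<close>
        have "fst (?Y X ?p) < 1" using par_in[OF u] A X[of ?p] by auto
        then have "fst (?Y X ?p) - fst (?Y X u) < 1" using X[OF u] unfolding Y[OF u] by linarith
        then have "\<bar>?H X u\<bar> \<le> K u * kb (cw u) (fst (?Y X ?p) - fst (?Y X u)) (snd (?Y X ?p) - snd (?Y X u))"
          unfolding c by (rule K(2))
        then have "ennreal \<bar>?H X u\<bar> \<le> ennreal (K u) * ennreal (kb (cw u) (fst (?Y X ?p) - fst (?Y X u)) (snd (?Y X ?p) - snd (?Y X u)))"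
          using K(1)[of u] by (simp add: ennreal_mult'[symmetric] ennreal_leI)
        \<comment> \<open>Each root lists the same time twice in this estimate, so one summand of
          \<open>kb2\<close> suffices.\<close>
        also have "\<dots> \<le> ennreal (K u) * kb2 (cw u) (pos ?q1 ?q2 X ?p) (X u)"
          unfolding kb2_def pos Y[OF u] by (intro mult_left_mono) auto
        finally show "ennreal \<bar>?H X u\<bar> \<le> ennreal (K u) * kb2 (cw u) (pos ?q1 ?q2 X ?p) (X u)" .
      qed (use Y pos in auto)
      also have "\<dots> \<le> ennreal ?P * (ennreal C0 * bnd (Vstar F) (bval F) (df_beta F) \<theta> ?q1 ?q2)"
        by (intro mult_left_mono C0 q) auto
      also have "\<dots> = ennreal (?P * C0 * t powr (Lambda F (df_rho F) + \<theta> / 4)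
                                        * tb powr (Lambda F (df_rhob F) + \<theta> / 4)
                                        * tnorm (x - xb) powr (- \<theta>))"
      proof -
        have L: "Lam (Vstar F) (bval F) (df_beta F) (df_rho F) = Lambda F (df_rho F)"
          "Lam (Vstar F) (bval F) (df_beta F) (df_rhob F) = Lambda F (df_rhob F)"
          using Lam_Lambda wf_facts(2) by (auto simp: roots_def)
        have "sing \<theta> (tnorm (x - xb)) = ennreal (tnorm (x - xb) powr (- \<theta>))" using A by (simp add: sing_def)
        then show ?thesis unfolding bnd_def L using P C0(1) by (simp add: ennreal_mult' mult.assoc)
      qed
      finally show "Iint F t tb x xb \<le> ennreal (?P * C0 * t powr (Lambda F (df_rho F) + \<theta> / 4)
                                        * tb powr (Lambda F (df_rhob F) + \<theta> / 4)
                                        * tnorm (x - xb) powr (- \<theta>))" .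
    qed
  qed
next
  show ?K
  proof (intro allI impI, elim conjE)
    fix \<theta> \<kappa> \<kappa>b :: real and U W
    let ?C1 = "children F (df_rho F)" and ?C2 = "children F (df_rhob F)"
    assume th: "0 \<le> \<theta>" "\<theta> \<le> thmax F" and UW: "U \<subseteq> W" "W \<subseteq> ?C1 \<union> ?C2"
      and card: "card (U \<inter> ?C1) \<le> 1" "card (U \<inter> ?C2) \<le> 1"
      and kap: "0 \<le> \<kappa>" "\<kappa> \<le> 1" "0 \<le> \<kappa>b" "\<kappa>b \<le> 1"
      and h1: "\<forall>l. U \<inter> ?C1 = {l} \<and> \<not> is_dirac F l \<longrightarrow> \<kappa> < 1 + zval F l"
      and h2: "\<forall>l. U \<inter> ?C2 = {l} \<and> \<not> is_dirac F l \<longrightarrow> \<kappa>b < 1 + zval F l"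
    define z1 where "z1 = \<kappa> * (if card (U \<inter> ?C1) = 1 then 1 else 0)"
    define z2 where "z2 = \<kappa>b * (if card (U \<inter> ?C2) = 1 then 1 else 0)"
    define sh where "sh u = (if u \<in> U \<inter> ?C1 then \<kappa> else if u \<in> U \<inter> ?C2 then \<kappa>b else 0)" for u
    have finV: "finite (Vstar F)" and rne: "df_rho F \<noteq> df_rhob F" using wf by (auto simp: wf_dforest_def Vstar_def)
    have disj: "?C1 \<inter> ?C2 = {}" using rne by (auto simp: children_def)
    have finC: "finite (U \<inter> ?C1)" "finite (U \<inter> ?C2)" using finV by (auto simp: children_def intro: finite_subset[OF _ finV])
    have sing: "U \<inter> A = {} \<or> (\<exists>l. U \<inter> A = {l})" if "card (U \<inter> A) \<le> 1" "finite (U \<inter> A)" for A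
      using that by (metis card_0_eq card_1_singletonE le_neq_implies_less less_one)
    have s1: "U \<inter> ?C1 = {l}" if "l \<in> U \<inter> ?C1" for l using sing[OF card(1) finC(1)] that by (metis empty_iff singletonD)
    have s2: "U \<inter> ?C2 = {l}" if "l \<in> U \<inter> ?C2" for l using sing[OF card(2) finC(2)] that by (metis empty_iff singletonD)
    interpret decorated_forest F sh
    proof
      \<comment> \<open>The bounds imposed on the two Hoelder exponents are exactly condition (a)
        for the lowered \<open>\<gamma>\<close>.\<close>
      show "-1 < zval F v - sh v" if "v \<in> Vstar F" "\<not> is_dirac F v" for v
      proof (cases "v \<in> U \<inter> ?C1")
        case True
        then show ?thesis using h1 s1[OF True] that by (fastforce simp: sh_def)
      next
        case n1: False
        show ?thesis
        proof (cases "v \<in> U \<inter> ?C2")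
          case True
          then have "\<kappa>b < 1 + zval F v" using h2 s2[OF True] that by blast
          then show ?thesis using n1 True by (auto simp: sh_def)
        next
          case False
          then have "sh v = 0" unfolding sh_def using n1 by (simp only: if_False)
          then show ?thesis using ha that by auto
        qed
      qed
      show "df_par F v \<in> roots F" if "v \<in> Vstar F" "sh v \<noteq> 0" for v
        using that by (auto simp: sh_def children_def roots_def split: if_splits)
    qed (use wf noroot hb hc in auto)
    \<comment> \<open>A root's branch contains its own children and none of the other root's, so
      each tree sees only its own exponent.\<close>
    have sum1: "(\<Sum>u\<in>branch F (df_rho F) - {df_rho F}. sh u) = z1"
      and sum2: "(\<Sum>u\<in>branch F (df_rhob F) - {df_rhob F}. sh u) = z2"
    proof -
      have fin: "finite (branch F w)" for w using wf_facts(1) by (simp add: branch_def)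
      have ch: "u \<in> branch F r - {r}" if "u \<in> children F r" "r \<in> roots F" for u r
      proof -
        have u: "u \<in> Vstar F" "df_par F u = r" using that by (auto simp: children_def)
        then have "u \<noteq> r" using that by (auto simp: Vstar_def)
        then show ?thesis using branch_par[OF u(1)] u branch_self[of r] that wf_facts(2) by auto
      qed
      have other: "u \<notin> branch F r" if "u \<in> children F r'" "r \<in> roots F" "r' \<in> roots F" "r \<noteq> r'" for u r r'
      proof
        assume b: "u \<in> branch F r"
        have u: "u \<in> Vstar F" "df_par F u = r'" using that by (auto simp: children_def)
        then have "u \<noteq> r" using that by (auto simp: Vstar_def)
        then have "r' \<in> branch F r" using branch_par[OF u(1)] u b by auto
        then show False using branch_root that by blast
      qed
      have R: "df_rho F \<in> roots F" "df_rhob F \<in> roots F" by (auto simp: roots_def)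
      have c1: "sum sh (U \<inter> ?C1) = z1"
      proof (cases "U \<inter> ?C1 = {}")
        case False
        then obtain l where l: "U \<inter> ?C1 = {l}" using sing[OF card(1) finC(1)] by auto
        then have "l \<in> U \<inter> ?C1" by auto
        then have "sh l = \<kappa>" unfolding sh_def by (simp only: if_True)
        then show ?thesis unfolding z1_def l by simp
      qed (simp add: z1_def)
      have c2: "sum sh (U \<inter> ?C2) = z2"
      proof (cases "U \<inter> ?C2 = {}")
        case False
        then obtain l where l: "U \<inter> ?C2 = {l}" using sing[OF card(2) finC(2)] by auto
        then have "l \<in> U \<inter> ?C2" by auto
        moreover have "l \<notin> U \<inter> ?C1" using disj calculation by auto
        ultimately have "sh l = \<kappa>b" unfolding sh_def by (simp only: if_True if_False)
        then show ?thesis unfolding z2_def l by simp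
      qed (simp add: z2_def)
      have "sum sh (U \<inter> ?C1) = sum sh (branch F (df_rho F) - {df_rho F})"
      proof (rule sum.mono_neutral_left)
        show "finite (branch F (df_rho F) - {df_rho F})" using fin by auto
        show "U \<inter> ?C1 \<subseteq> branch F (df_rho F) - {df_rho F}" using ch R by auto
        show "\<forall>u\<in>branch F (df_rho F) - {df_rho F} - U \<inter> ?C1. sh u = 0"
          using other[of _ "df_rhob F" "df_rho F"] R rne by (auto simp: sh_def)
      qed
      then show "(\<Sum>u\<in>branch F (df_rho F) - {df_rho F}. sh u) = z1" using c1 by simp
      have "sum sh (U \<inter> ?C2) = sum sh (branch F (df_rhob F) - {df_rhob F})"
      proof (rule sum.mono_neutral_left)
        show "finite (branch F (df_rhob F) - {df_rhob F})" using fin by auto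
        show "U \<inter> ?C2 \<subseteq> branch F (df_rhob F) - {df_rhob F}" using ch R by auto
        show "\<forall>u\<in>branch F (df_rhob F) - {df_rhob F} - U \<inter> ?C2. sh u = 0"
          using other[of _ "df_rho F" "df_rhob F"] R rne by (auto simp: sh_def)
      qed
      then show "(\<Sum>u\<in>branch F (df_rhob F) - {df_rhob F}. sh u) = z2" using c2 by simp
    qed
    have z: "0 \<le> z1" "0 \<le> z2" using kap by (auto simp: z1_def z2_def)
    have shle: "0 \<le> sh u" "sh u \<le> 1" for u using kap by (auto simp: sh_def)
    obtain C0 where C0: "C0 > 0" "\<And>q1 q2 :: real \<times> real \<times> (real ^ 'n). adm q1 \<Longrightarrow> adm q2 \<Longrightarrow>
      (\<integral>\<^sup>+ X. Phi q1 q2 (Vstar F) MC mt (bval F) (df_beta F) X \<partial>PiM (Vstar F) vm)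
        \<le> ennreal C0 * bnd (Vstar F) (bval F) (df_beta F) \<theta> q1 q2"
      using nn_integral_Phi_le[OF state_init cross_init[OF th]] by blast
    have "\<forall>u. \<exists>C>0. \<forall>s t (y :: real ^ 'n). s \<le> t \<longrightarrow> t < 1 \<longrightarrow>
       \<bar>kfac (df_gam F u) (df_k F u) t y\<bar> \<le> C * (kb (df_gam F u - kabs (df_k F u) / 2) t y + kb (df_gam F u - kabs (df_k F u) / 2) s y)
     \<and> \<bar>kfac (df_gam F u) (df_k F u) s y\<bar> \<le> C * (kb (df_gam F u - kabs (df_k F u) / 2) t y + kb (df_gam F u - kabs (df_k F u) / 2) s y)"
      using kfac_pair_bound by blast
    from choice[OF this] obtain K1 where K1: "\<And>u. 0 < K1 u" "\<And>u s t (y :: real ^ 'n). s \<le> t \<Longrightarrow> t < 1 \<Longrightarrow>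
       \<bar>kfac (df_gam F u) (df_k F u) t y\<bar> \<le> K1 u * (kb (df_gam F u - kabs (df_k F u) / 2) t y + kb (df_gam F u - kabs (df_k F u) / 2) s y)"
       "\<And>u s t (y :: real ^ 'n). s \<le> t \<Longrightarrow> t < 1 \<Longrightarrow>
       \<bar>kfac (df_gam F u) (df_k F u) s y\<bar> \<le> K1 u * (kb (df_gam F u - kabs (df_k F u) / 2) t y + kb (df_gam F u - kabs (df_k F u) / 2) s y)"
      by blast
    have "\<forall>u. \<exists>C>0. \<forall>s t (y :: real ^ 'n). s \<le> t \<longrightarrow> t < 1 \<longrightarrow>
       \<bar>kfac (df_gam F u) (df_k F u) t y - kfac (df_gam F u) (df_k F u) s y\<bar> \<le> C * (if sh u = 0 then 1 else (t - s) powr sh u)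
         * (kb (df_gam F u - sh u - kabs (df_k F u) / 2) t y + kb (df_gam F u - sh u - kabs (df_k F u) / 2) s y)"
      using kfac_diff_bound shle by blast
    from choice[OF this] obtain K2 where K2: "\<And>u. 0 < K2 u" "\<And>u s t (y :: real ^ 'n). s \<le> t \<Longrightarrow> t < 1 \<Longrightarrow>
       \<bar>kfac (df_gam F u) (df_k F u) t y - kfac (df_gam F u) (df_k F u) s y\<bar> \<le> K2 u * (if sh u = 0 then 1 else (t - s) powr sh u)
         * (kb (df_gam F u - sh u - kabs (df_k F u) / 2) t y + kb (df_gam F u - sh u - kabs (df_k F u) / 2) s y)"
      by blast
    define KK where "KK u = (if u \<in> U then K2 u else K1 u)" for u
    have KK: "0 < KK u" for u using K1(1) K2(1) by (simp add: KK_def)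
    let ?P = "\<Prod>u\<in>Vstar F. KK u"
    have P: "0 \<le> ?P" using KK by (intro prod_nonneg) (auto intro: less_imp_le)
    have W: "w \<in> Vstar F \<and> df_par F w \<in> roots F" if "w \<in> W" for w
      using that UW by (auto simp: children_def roots_def)
    have subV: "U \<subseteq> Vstar F" "W \<subseteq> Vstar F" using W UW by auto
    have "\<exists>C. \<forall>t s x xb. 0 < s \<and> s \<le> t \<and> t \<le> 2 * s \<and> t < 1 \<and> tnorm (x - xb) \<noteq> 0 \<longrightarrow>
            Kint F W U t x xb s \<le> ennreal (C * (if z1 + z2 = 0 then 1 else \<bar>t - s\<bar> powr (z1 + z2))
                                         * t powr (Lambda F (df_rho F) + Lambda F (df_rhob F) + \<theta> / 2 - (z1 + z2))
                                         * tnorm (x - xb) powr (- \<theta>))"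
    proof (intro exI[of _ "?P * C0"] allI impI)
      fix t s :: real and x xb :: "real ^ 'n"
      assume A: "0 < s \<and> s \<le> t \<and> t \<le> 2 * s \<and> t < 1 \<and> tnorm (x - xb) \<noteq> 0"
      \<comment> \<open>The value 1 at exponent 0 keeps \<open>ep\<close> multiplicative even for
        \<open>t = s\<close>, where \<open>0 powr 0\<close> would be 0.\<close>
      define ep where "ep e = (if e = 0 then 1 else (t - s) powr e)" for e :: real
      have ep0: "0 \<le> ep e" for e by (simp add: ep_def)
      have ep_add: "ep a * ep b = ep (a + b)" if "0 \<le> a" "0 \<le> b" for a b
        using that by (auto simp: ep_def powr_add add_nonneg_eq_0_iff)
      \<comment> \<open>The assumption \<open>s \<le> t \<le> 2 * s\<close> is exactly the
        admissibility of these positions.\<close>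
      let ?q1 = "(t, s, x)" and ?q2 = "(t, s, xb)"
      let ?Y = "\<lambda>X :: 'v \<Rightarrow> real \<times> (real ^ 'n). X(df_rho F := (t, x), df_rhob F := (t, xb))"
      let ?k = "\<lambda>X w r. kfac (df_gam F w) (df_k F w) (r - fst (?Y X w)) (snd (?Y X (df_par F w)) - snd (?Y X w))"
      \<comment> \<open>The three products in the integrand merged into one factor per
        vertex.\<close>
      let ?H = "\<lambda>X w. if w \<in> U then ?k X w t - ?k X w s else if w \<in> W then ?k X w s else ?k X w (fst (?Y X (df_par F w)))"
      have q: "adm ?q1" "adm ?q2" using A by (auto simp: adm_def)
      have Y: "?Y X u = X u" if "u \<in> Vstar F" for X u using that r1_V0 r2_V0 by auto
      have pos: "fst (pos ?q1 ?q2 X w) = fst (?Y X w)" "snd (snd (pos ?q1 ?q2 X w)) = snd (?Y X w)"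
        "fst (snd (pos ?q1 ?q2 X w)) = (if w \<in> roots F then s else fst (?Y X w))" for X w
        using r12 by (auto simp: pos_def roots_def)
      have prodH: "(\<Prod>w\<in>Vstar F. ?H X w) = (\<Prod>u\<in>Vstar F - W. ?k X u (fst (?Y X (df_par F u))))
          * (\<Prod>v\<in>W - U. ?k X v s) * (\<Prod>w\<in>U. ?k X w t - ?k X w s)" for X
      proof -
        have "(\<Prod>w\<in>Vstar F. ?H X w) = (\<Prod>w\<in>Vstar F - W. ?H X w) * (\<Prod>w\<in>W. ?H X w)"
          by (rule prod.subset_diff[OF subV(2) finV])
        also have "(\<Prod>w\<in>W. ?H X w) = (\<Prod>w\<in>W - U. ?H X w) * (\<Prod>w\<in>U. ?H X w)"
          by (rule prod.subset_diff[OF UW(1) finite_subset[OF subV(2) finV]])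
        also have "(\<Prod>w\<in>Vstar F - W. ?H X w) = (\<Prod>u\<in>Vstar F - W. ?k X u (fst (?Y X (df_par F u))))"
          using UW by (intro prod.cong) auto
        also have "(\<Prod>w\<in>W - U. ?H X w) = (\<Prod>v\<in>W - U. ?k X v s)"
          by (intro prod.cong) auto
        also have "(\<Prod>w\<in>U. ?H X w) = (\<Prod>w\<in>U. ?k X w t - ?k X w s)"
          by (intro prod.cong) auto
        finally show ?thesis by (simp only: mult.assoc)
      qed
      have "Kint F W U t x xb s \<le> ennreal (\<Prod>u\<in>Vstar F. KK u * ep (sh u))
          * (\<integral>\<^sup>+ X. Phi ?q1 ?q2 (Vstar F) MC mt (bval F) (df_beta F) X \<partial>PiM (Vstar F) vm)"
        unfolding Kint_def Let_def
      proof (rule nn_integral_forest_le[OF q, where K = "\<lambda>u. KK u * ep (sh u)" and Y = ?Y and H = ?H])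
        show "(\<Prod>w\<in>df_V F. gfac F w (fst (?Y X w))) * (\<Prod>e\<in>df_C F. cfac F (?Y X) e)
          * (\<Prod>u\<in>Vstar F - W. ?k X u (fst (?Y X (df_par F u)))) * (\<Prod>v\<in>W - U. ?k X v s) * (\<Prod>w\<in>U. ?k X w t - ?k X w s)
          = (\<Prod>e\<in>df_C F. cfac F (?Y X) e) * (\<Prod>w\<in>df_V F. gfac F w (fst (?Y X w))) * (\<Prod>w\<in>Vstar F. ?H X w)" for X
          unfolding prodH by (simp only: mult_ac)
        show "0 \<le> KK u * ep (sh u)" for u using KK[of u] ep0 by simp
        fix X :: "'v \<Rightarrow> real \<times> (real ^ 'n)" and u
        assume u: "u \<in> Vstar F" and X: "\<And>w. w \<in> Vstar F \<Longrightarrow> 0 \<le> fst (X w) \<and> fst (X w) < 1"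
        let ?p = "df_par F u"
        let ?t = "fst (?Y X ?p) - fst (X u)" and ?s = "(if ?p \<in> roots F then s else fst (?Y X ?p)) - fst (X u)"
          and ?y = "snd (?Y X ?p) - snd (X u)"
        have c: "cw u = df_gam F u - sh u - kabs (df_k F u) / 2" using u by (simp add: cw_def Vstar_def)
        have rt: "fst (?Y X ?p) = t" if "?p \<in> roots F" using that by (auto simp: roots_def)
        have lt1: "?t < 1"
        proof -
          have "fst (?Y X ?p) < 1" using par_in[OF u] A X[of ?p] by auto
          then show ?thesis using X[OF u] by linarith
        qed
        have st: "?s \<le> ?t" using rt A by auto
        have "\<bar>?H X u\<bar> \<le> KK u * ep (sh u) * (kb (cw u) ?t ?y + kb (cw u) ?s ?y)"
        proof (cases "u \<in> U")
          case True
          then have pr: "?p \<in> roots F" using W UW by auto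
          have "?t - ?s = t - s" using pr rt[OF pr] by simp
          then show ?thesis
            using K2(2)[OF st lt1, of u ?y] True pr rt[OF pr] unfolding c Y[OF u] by (simp only: if_True ep_def KK_def)
        next
          case False
          then have sh0: "sh u = 0" by (simp add: sh_def)
          have "\<bar>?H X u\<bar> \<le> K1 u * (kb (cw u) ?t ?y + kb (cw u) ?s ?y)"
          proof (cases "u \<in> W")
            case True
            then have pr: "?p \<in> roots F" using W by auto
            show ?thesis using K1(3)[OF st lt1, of u ?y] False True pr unfolding c Y[OF u] sh0 by simp
          next
            case nW: False
            show ?thesis using K1(2)[OF st lt1, of u ?y] False nW unfolding c Y[OF u] sh0 by simp
          qed
          then show ?thesis using False by (simp add: KK_def sh0 ep_def)
        qed
        then have "ennreal \<bar>?H X u\<bar> \<le> ennreal (KK u * ep (sh u) * (kb (cw u) ?t ?y + kb (cw u) ?s ?y))" by (rule ennreal_leI)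
        also have "\<dots> = ennreal (KK u * ep (sh u)) * (ennreal (kb (cw u) ?t ?y) + ennreal (kb (cw u) ?s ?y))"
          using KK[of u] ep0[of "sh u"] by (subst ennreal_mult') (simp_all add: ennreal_plus)
        also have "\<dots> = ennreal (KK u * ep (sh u)) * kb2 (cw u) (pos ?q1 ?q2 X ?p) (X u)"
          unfolding kb2_def pos ..
        finally show "ennreal \<bar>?H X u\<bar> \<le> ennreal (KK u * ep (sh u)) * kb2 (cw u) (pos ?q1 ?q2 X ?p) (X u)" .
      qed (use Y pos(1) in auto)
      also have "\<dots> \<le> ennreal (\<Prod>u\<in>Vstar F. KK u * ep (sh u)) * (ennreal C0 * bnd (Vstar F) (bval F) (df_beta F) \<theta> ?q1 ?q2)"
        by (intro mult_left_mono C0 q) auto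
      \<comment> \<open>The branches of the two roots partition the remaining vertices, so the gains
        in \<open>t - s\<close> multiply to the exponent \<open>\<zeta>\<close>.\<close>
      also have "(\<Prod>u\<in>Vstar F. KK u * ep (sh u)) = ?P * ep (z1 + z2)"
      proof -
        have "(\<Prod>u\<in>A. ep (sh u)) = ep (\<Sum>u\<in>A. sh u)" if "finite A" for A
          using that
        proof induction
          case (insert u A)
          then show ?case using ep_add[OF shle(1) sum_nonneg[of A sh]] shle by simp
        qed (simp add: ep_def)
        moreover have "(\<Sum>u\<in>Vstar F. sh u) = z1 + z2"
        proof -
          let ?B1 = "branch F (df_rho F) - {df_rho F}" and ?B2 = "branch F (df_rhob F) - {df_rhob F}"
          have sub: "?B1 \<subseteq> Vstar F" "?B2 \<subseteq> Vstar F"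
            using branch_root by (auto simp: branch_def Vstar_def)
          have "Vstar F = ?B1 \<union> ?B2" using sub B_some_root r1_V0 r2_V0 by blast
          moreover have "?B1 \<inter> ?B2 = {}" using sub B_one_root by blast
          ultimately show ?thesis
            using sum.union_disjoint[of ?B1 ?B2 sh] finite_subset[OF sub(1) finV] finite_subset[OF sub(2) finV] sum1 sum2 by simp
        qed
        ultimately show ?thesis using finV by (simp add: prod.distrib)
      qed
      also have "ennreal (?P * ep (z1 + z2)) * (ennreal C0 * bnd (Vstar F) (bval F) (df_beta F) \<theta> ?q1 ?q2)
        = ennreal (?P * C0 * (if z1 + z2 = 0 then 1 else \<bar>t - s\<bar> powr (z1 + z2))
                                         * t powr (Lambda F (df_rho F) + Lambda F (df_rhob F) + \<theta> / 2 - (z1 + z2))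
                                         * tnorm (x - xb) powr (- \<theta>))"
      proof -
        \<comment> \<open>The losses at the two roots add up to the \<open>- \<zeta>\<close> in the
          power of \<open>t\<close>.\<close>
        have L: "Lam (Vstar F) (bval F) (df_beta F) (df_rho F) = Lambda F (df_rho F) - z1"
          "Lam (Vstar F) (bval F) (df_beta F) (df_rhob F) = Lambda F (df_rhob F) - z2"
          using Lam_Lambda wf_facts(2) sum1 sum2 by (auto simp: roots_def)
        have e: "(if z1 + z2 = 0 then 1 else \<bar>t - s\<bar> powr (z1 + z2)) = ep (z1 + z2)" using A by (simp add: ep_def)
        have p: "t powr (Lambda F (df_rho F) + Lambda F (df_rhob F) + \<theta> / 2 - (z1 + z2))
          = t powr (Lambda F (df_rho F) - z1 + \<theta> / 4) * t powr (Lambda F (df_rhob F) - z2 + \<theta> / 4)"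
          unfolding powr_add[symmetric] by (rule arg_cong[where f = "(powr) t"]) simp
        have sg: "sing \<theta> (tnorm (x - xb)) = ennreal (tnorm (x - xb) powr (- \<theta>))" using A by (simp add: sing_def)
        show ?thesis
          unfolding e p bnd_def L snd_conv fst_conv sg using P C0(1) ep0[of "z1 + z2"]
          by (simp add: ennreal_mult' mult_ac)
      qed
      finally show "Kint F W U t x xb s \<le> ennreal (?P * C0 * (if z1 + z2 = 0 then 1 else \<bar>t - s\<bar> powr (z1 + z2))
                                         * t powr (Lambda F (df_rho F) + Lambda F (df_rhob F) + \<theta> / 2 - (z1 + z2))
                                         * tnorm (x - xb) powr (- \<theta>))" .
    qed
    then show "let \<zeta> = \<kappa> * (if card (U \<inter> ?C1) = 1 then 1 else 0) + \<kappa>b * (if card (U \<inter> ?C2) = 1 then 1 else 0) in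
         \<exists>C. \<forall>t s x xb. 0 < s \<and> s \<le> t \<and> t \<le> 2 * s \<and> t < 1 \<and> tnorm (x - xb) \<noteq> 0 \<longrightarrow>
            Kint F W U t x xb s \<le> ennreal (C * (if \<zeta> = 0 then 1 else \<bar>t - s\<bar> powr \<zeta>)
                                         * t powr (Lambda F (df_rho F) + Lambda F (df_rhob F) + \<theta> / 2 - \<zeta>)
                                         * tnorm (x - xb) powr (- \<theta>))"
      unfolding Let_def z1_def z2_def .
  qed
qed

end
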